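(* Let $\chi\in\mathcal X$ and $p\in I$, assume that $\chi$ is $p$-finite, and let $T_p,T_p^-:\mathcal U(\chi)\to\mathcal U(r_p(\chi))/(\mathcal I_p^+(r_p(\chi)),\mathcal I_p^-(r_p(\chi)))$ be the Lusztig maps. Write $c_{pi}=c_{pi}^\chi$. (i) The maps $T_p$, $T^-_p$ induce algebra isomorphisms $$T_p,T^-_p:\mathcal U(\chi)/(\mathcal I_p^+(\chi),\mathcal I_p^-(\chi))\to\mathcal U(r_p(\chi))/(\mathcal I_p^+(r_p(\chi)),\mathcal I_p^-(r_p(\chi))).$$ (ii) The isomorphisms in (i) satisfy the following equations (in each composition, $T_p$ and $T_p^-$ are taken with respect to the bicharacter appropriate for its source, e.g. in $T_pT_p^-$ the map $T_p^-$ is defined with respect to $\chi$ and $T_p$ with respect to $r_p(\chi)$): - $T_pT_p^-=T_p^-T_p=\mathrm{id}$; - $T_p\varphi_{\underline a}=\varphi_{\underline b}T_p$ and $T_p^-\varphi_{\underline a}=\varphi_{\underline b}T_p^-$, for all $\underline a\in(\Bbbk^\times)^I$, where $b_i=a_ia_p^{-c_{pi}}$ for all $i\in I$; - $T_p\phi_2=\phi_2T_p^-\varphi_{\underline a}$, where $a_i=(-1)^{\delta_{i,p}}$ for all $i\in I$; - $T_p\phi_3=\phi_3T_p\varphi_{\underline\lambda}$, where $\lambda_p=q_{pp}^{-1}$ and $\lambda_i=\lambda_i(r_p(\chi))^{-1}$ for all $i\in I\setminus\{p\}$; - $T_p^-\phi_3=\phi_3T_p^-\varphi_{\underline\lambda}$,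 where $\lambda_p=q_{pp}^{-1}$ and $\lambda_i=(-1)^{c_{pi}}\lambda_i(r_p(\chi^{-1}))$ for all $i\in I\setminus\{p\}$; - $T_p\phi_4=\phi_4T_p^-\varphi_{\underline a}$ for some $\underline a\in(\Bbbk^\times)^I$.
   Context: Let $\Bbbk$ be a field, $\Bbbk^\times=\Bbbk\setminus\{0\}$, $I$ a non-empty finite set, $\{\alpha_i\}_{i\in I}$ the standard basis of $\mathbb Z^I$, $\mathcal X$ the set of bicharacters $\chi:\mathbb Z^I\times\mathbb Z^I\to\Bbbk^\times$ (multiplicative in each argument). Put $q_{ij}=\chi(\alpha_i,\alpha_j)$, $\chi^{\mathrm{op}}(a,b)=\chi(b,a)$, $\chi^{-1}(a,b)=\chi(a,b)^{-1}$. For $q\in\Bbbk^\times$: $(0)_q=0$, $(m)_q=1+q+\dots+q^{m-1}$, $(m)^!_q=\prod_{n=1}^m(n)_q$. $\chi$ is $p$-finite if for all $j\ne p$ there is $m\in\mathbb N_0$ with $(m+1)_{q_{pp}}=0$ or $q_{pp}^mq_{pj}q_{jp}=1$. Then $c_{pp}^\chi=2$, $c_{pj}^\chi=-\min\{m\in\mathbb N_0\mid(m+1)_{q_{pp}}(q_{pp}^mq_{pj}q_{jp}-1)=0\}$ for $j\neq p$, $\sigma_p^\chi(\alpha_j)=\alpha_j-c_{pj}^\chi\alpha_p$, and $r_p(\chi)(a,b)=\chi((\sigma_p^\chi)^{-1}(a),(\sigma_p^\chi)^{-1}(b))$. Then $r_p(\chi)$ is $p$-finite, $c_{pj}^{r_p(\chi)}=c_{pj}^\chi$,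 $r_p(r_p(\chi))=\chi$. For $i\ne p$: $\lambda_i(\chi)=(-c_{pi}^\chi)^!_{q_{pp}}\prod_{s=0}^{-c_{pi}^\chi-1}(q_{pp}^sq_{pi}q_{ip}-1)$ (depends on $p$). $h^\chi(\alpha_p)=\min\{m\in\mathbb N\mid(m)_{q_{pp}}=0\}$, or $\infty$ if no such $m$ exists. $\mathcal U(\chi)$ is the unital algebra generated by $K_i^{\pm1},L_i^{\pm1},E_i,F_i$ ($i\in I$) with relations: all $K_i^{\pm1},L_i^{\pm1}$ commute; $K_iK_i^{-1}=L_iL_i^{-1}=1$; $K_iE_jK_i^{-1}=q_{ij}E_j$; $L_iE_jL_i^{-1}=q_{ji}^{-1}E_j$; $K_iF_jK_i^{-1}=q_{ij}^{-1}F_j$; $L_iF_jL_i^{-1}=q_{ji}F_j$; $E_iF_j-F_jE_i=\delta_{i,j}(K_i-L_i)$. $\mathcal U^+(\chi),\mathcal U^-(\chi)$ are the (free) subalgebras generated by the $E_i$, resp. the $F_i$. Put $K_p\cdot X=K_pXK_p^{-1}$, $L_p\cdot X=L_pXL_p^{-1}$. For $i\ne p$: $E^\pm_{i,0}=E_i$, $E^+_{i,m+1}=E_pE^+_{i,m}-(K_p\cdot E^+_{i,m})E_p$, $E^-_{i,m+1}=E_pE^-_{i,m}-(L_p\cdot E^-_{i,m})E_p$; $F^\pm_{i,0}=F_i$, $F^+_{i,m+1}=F_pF^+_{i,m}-(L_p\cdot F^+_{i,m})F_p$, $F^-_{i,m+1}=F_pF^-_{i,m}-(K_p\cdot F^-_{i,m})F_p$.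 For $p$-finite $\chi$ and $h=h^\chi(\alpha_p)$: if $h<\infty$, $\mathcal I_p^+(\chi)$ is the ideal of $\mathcal U^+(\chi)$ generated by $E_p^h$ and all $E^+_{i,1-c_{pi}}$ with $i\ne p$, $1-c_{pi}<h$, and $\mathcal I_p^-(\chi)$ is the ideal of $\mathcal U^-(\chi)$ generated by $F_p^h$ and all $F^+_{i,1-c_{pi}}$ with $i\neq p$, $1-c_{pi}<h$; if $h=\infty$, they are generated by all $E^+_{i,1-c_{pi}}$, resp. all $F^+_{i,1-c_{pi}}$, $i\ne p$. $(\mathcal I^+_p,\mathcal I^-_p)$ is the ideal of $\mathcal U$ generated by both. Lusztig maps: underlining generators of the target $\mathcal U(r_p(\chi))$ (and elements $\underline E^\pm_{i,m},\underline F^\pm_{i,m}$ formed there), $T_p,T_p^-$ are the unique algebra maps $\mathcal U(\chi)\to\mathcal U(r_p(\chi))/(\mathcal I_p^+(r_p(\chi)),\mathcal I_p^-(r_p(\chi)))$ with, for $i\neq p$, $T_p(K_p)=T_p^-(K_p)=\underline K_p^{-1}$, $T_p(K_i)=T_p^-(K_i)=\underline K_i\underline K_p^{-c_{pi}}$, $T_p(L_p)=T_p^-(L_p)=\underline L_p^{-1}$, $T_p(L_i)=T_p^-(L_i)=\underline L_i\underline L_p^{-c_{pi}}$, $T_p(E_p)=\underline F_p\underline L_p^{-1}$, $T_p(E_i)=\underline E^+_{i,-c_{pi}}$, $T_p(F_p)=\underline K_p^{-1}\underline E_p$, $T_p(F_i)=\lambda_i(r_p(\chi))^{-1}\underline F^+_{i,-c_{pi}}$,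 $T_p^-(E_p)=\underline K_p^{-1}\underline F_p$, $T_p^-(E_i)=\lambda_i(r_p(\chi^{-1}))^{-1}\underline E^-_{i,-c_{pi}}$, $T_p^-(F_p)=\underline E_p\underline L_p^{-1}$, $T_p^-(F_i)=(-1)^{c_{pi}}\underline F^-_{i,-c_{pi}}$. Further maps (all inducing maps on the corresponding quotients by $(\mathcal I_p^+,\mathcal I_p^-)$): for $\underline a=(a_i)\in(\Bbbk^\times)^I$, $\varphi_{\underline a}$ is the algebra automorphism of $\mathcal U(\chi)$ fixing $K_i,L_i$ with $E_i\mapsto a_iE_i$, $F_i\mapsto a_i^{-1}F_i$; $\phi_2:\mathcal U(\chi)\to\mathcal U(\chi^{-1})$ is the algebra isomorphism $K_i\mapsto K_i,L_i\mapsto L_i,E_i\mapsto F_i,F_i\mapsto-E_i$; $\phi_3:\mathcal U(\chi)\to\mathcal U(\chi^{\mathrm{op}})$ is the algebra isomorphism $K_i\mapsto L_i,L_i\mapsto K_i,E_i\mapsto F_i,F_i\mapsto E_i$; $\phi_4$ is the algebra antiautomorphism of $\mathcal U(\chi)$ with $K_i\mapsto K_i,L_i\mapsto L_i,E_i\mapsto F_i,F_i\mapsto E_i$. *)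

theory Defs
  imports
    "HOL-Algebra.QuotRing"
    "HOL-Algebra.Subrings"
    "HOL-Algebra.Module"
    "HOL-Analysis.Finite_Cartesian_Product"
    "HOL-Library.Poly_Mapping"
    "HOL-Library.Extended_Nat"
begin

section \<open>Algebras over a field\<close>

text \<open>
  A unital associative algebra over a field of type \<open>'k\<close> is represented by a record of type
  \<open>('k, 'a) module\<close>: a (not necessarily commutative) ring together with a scalar multiplication.
\<close>

definition alg_hom :: "('k, 'a) module \<Rightarrow> ('k, 'b) module \<Rightarrow> ('a \<Rightarrow> 'b) set" where
  "alg_hom A B = {f \<in> ring_hom A B. \<forall>c. \<forall>x\<in>carrier A. f (c \<odot>\<^bsub>A\<^esub> x) = c \<odot>\<^bsub>B\<^esub> f x}"

definition alg_iso :: "('k, 'a) module \<Rightarrow> ('k, 'b) module \<Rightarrow> ('a \<Rightarrow> 'b) set" where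
  "alg_iso A B = {f \<in> alg_hom A B. bij_betw f (carrier A) (carrier B)}"

definition opposite_alg :: "('k, 'a) module \<Rightarrow> ('k, 'a) module" where
  "opposite_alg A = A\<lparr>mult := \<lambda>x y. y \<otimes>\<^bsub>A\<^esub> x\<rparr>"

definition quot_alg :: "('k, 'a) module \<Rightarrow> 'a set \<Rightarrow> ('k, 'a set) module" where
  "quot_alg A J =
     \<lparr>carrier = carrier (A Quot J), mult = mult (A Quot J), one = one (A Quot J),
      zero = zero (A Quot J), add = add (A Quot J),
      smult = (\<lambda>c X. \<Union>x\<in>X. J +>\<^bsub>A\<^esub> (c \<odot>\<^bsub>A\<^esub> x))\<rparr>"

definition generated_subalg :: "('k, 'a) module \<Rightarrow> 'a set \<Rightarrow> 'a set" where
  "generated_subalg A S =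
     \<Inter>{B. subring B A \<and> (\<forall>c. \<forall>x\<in>B. c \<odot>\<^bsub>A\<^esub> x \<in> B) \<and> S \<subseteq> B}"

text \<open>
  The unique algebra map \<open>A \<rightarrow> B\<close> satisfying \<open>P\<close>. Maps are normalised to be
  \<open>extensional\<close>, so that uniqueness on the carrier means uniqueness as a HOL function.
\<close>

definition the_alg_hom ::
  "('k, 'a) module \<Rightarrow> ('k, 'b) module \<Rightarrow> (('a \<Rightarrow> 'b) \<Rightarrow> bool) \<Rightarrow> 'a \<Rightarrow> 'b" where
  "the_alg_hom A B P = (THE f. f \<in> alg_hom A B \<and> f \<in> extensional (carrier A) \<and> P f)"

text \<open>
  \<open>induces A J f g\<close>: the map \<open>f\<close> on \<open>A\<close> is constant on the cosets of \<open>J\<close> and \<open>g\<close> is the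
  resulting map on the quotient.
\<close>

definition induces ::
  "('k, 'a) module \<Rightarrow> 'a set \<Rightarrow> ('a \<Rightarrow> 'b) \<Rightarrow> ('a set \<Rightarrow> 'b) \<Rightarrow> bool" where
  "induces A J f g \<longleftrightarrow> (\<forall>x\<in>carrier A. g (J +>\<^bsub>A\<^esub> x) = f x)"


section \<open>Free algebras\<close>

text \<open>The free monoid, written additively so that \<open>poly_mapping\<close> provides its monoid algebra.\<close>

datatype 'g free_monoid = Word (letters: "'g list")

instantiation free_monoid :: (type) monoid_add
begin

definition zero_free_monoid :: "'a free_monoid" where
  "0 = Word []"

definition plus_free_monoid :: "'a free_monoid \<Rightarrow> 'a free_monoid \<Rightarrow> 'a free_monoid" where
  "u + v = Word (letters u @ letters v)"

instance
  by standard (simp_all add: zero_free_monoid_def plus_free_monoid_def)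

end

definition free_alg :: "('k::field, 'g free_monoid \<Rightarrow>\<^sub>0 'k) module" where
  "free_alg = \<lparr>carrier = UNIV, mult = (*), one = 1, zero = 0, add = (+),
     smult = (\<lambda>c x. Poly_Mapping.single 0 c * x)\<rparr>"

definition letter :: "'g \<Rightarrow> ('g free_monoid \<Rightarrow>\<^sub>0 'k::field)" where
  "letter g = Poly_Mapping.single (Word [g]) 1"


section \<open>Bicharacters\<close>

type_synonym ('i, 'k) bichar = "int ^ 'i \<Rightarrow> int ^ 'i \<Rightarrow> 'k"

definition is_bichar :: "('i::finite, 'k::field) bichar \<Rightarrow> bool" where
  "is_bichar chi \<longleftrightarrow>
     (\<forall>a b. chi a b \<noteq> 0) \<and>
     (\<forall>a b c. chi (a + b) c = chi a c * chi b c) \<and>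
     (\<forall>a b c. chi a (b + c) = chi a b * chi a c)"

definition bichar_op :: "('i::finite, 'k::field) bichar \<Rightarrow> ('i, 'k) bichar" where
  "bichar_op chi = (\<lambda>a b. chi b a)"

definition bichar_inv :: "('i::finite, 'k::field) bichar \<Rightarrow> ('i, 'k) bichar" where
  "bichar_inv chi = (\<lambda>a b. inverse (chi a b))"

abbreviation simple_root :: "'i::finite \<Rightarrow> int ^ 'i" where
  "simple_root i \<equiv> axis i 1"

definition bq :: "('i::finite, 'k::field) bichar \<Rightarrow> 'i \<Rightarrow> 'i \<Rightarrow> 'k" where
  "bq chi i j = chi (simple_root i) (simple_root j)"

definition qnum :: "'k::field \<Rightarrow> nat \<Rightarrow> 'k" where
  "qnum q m = (\<Sum>n<m. q ^ n)"

definition qfact :: "'k::field \<Rightarrow> nat \<Rightarrow> 'k" where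
  "qfact q m = (\<Prod>n=1..m. qnum q n)"

definition p_finite :: "('i::finite, 'k::field) bichar \<Rightarrow> 'i \<Rightarrow> bool" where
  "p_finite chi p \<longleftrightarrow>
     (\<forall>j. j \<noteq> p \<longrightarrow>
       (\<exists>m. qnum (bq chi p p) (m + 1) = 0 \<or> bq chi p p ^ m * bq chi p j * bq chi j p = 1))"

definition cartan :: "('i::finite, 'k::field) bichar \<Rightarrow> 'i \<Rightarrow> 'i \<Rightarrow> int" where
  "cartan chi p j =
     (if j = p then 2
      else - int (LEAST m. qnum (bq chi p p) (m + 1) *
                            (bq chi p p ^ m * bq chi p j * bq chi j p - 1) = 0))"

text \<open>The linear map determined by \<open>\<alpha>\<^sub>j \<mapsto> \<alpha>\<^sub>j - c\<^sub>p\<^sub>j \<alpha>\<^sub>p\<close>.\<close>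

definition sigma :: "('i::finite, 'k::field) bichar \<Rightarrow> 'i \<Rightarrow> int ^ 'i \<Rightarrow> int ^ 'i" where
  "sigma chi p a = (\<Sum>j\<in>UNIV. (a $ j) *s (simple_root j - cartan chi p j *s simple_root p))"

definition reflect :: "('i::finite, 'k::field) bichar \<Rightarrow> 'i \<Rightarrow> ('i, 'k) bichar" where
  "reflect chi p =
     (\<lambda>a b. chi (inv_into UNIV (sigma chi p) a) (inv_into UNIV (sigma chi p) b))"

text \<open>Only used for \<open>i \<noteq> p\<close>, where \<open>- cartan chi p i\<close> is non-negative.\<close>

definition lambda :: "('i::finite, 'k::field) bichar \<Rightarrow> 'i \<Rightarrow> 'i \<Rightarrow> 'k" where
  "lambda chi p i =
     qfact (bq chi p p) (nat (- cartan chi p i)) *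
     (\<Prod>s<nat (- cartan chi p i). bq chi p p ^ s * bq chi p i * bq chi i p - 1)"

definition height :: "('i::finite, 'k::field) bichar \<Rightarrow> 'i \<Rightarrow> enat" where
  "height chi p =
     (if \<exists>m>0. qnum (bq chi p p) m = 0
      then enat (LEAST m. m > 0 \<and> qnum (bq chi p p) m = 0) else \<infinity>)"


section \<open>The algebra \<open>U(chi)\<close>\<close>

datatype 'i gen = gK 'i | gKi 'i | gL 'i | gLi 'i | gE 'i | gF 'i

type_synonym ('i, 'k) falg = "'i gen free_monoid \<Rightarrow>\<^sub>0 'k"
type_synonym ('i, 'k) ualg = "('i, 'k) falg set"
type_synonym ('i, 'k) qalg = "('i, 'k) ualg set"

definition cartan_gens :: "'i gen set" where
  "cartan_gens = range gK \<union> range gKi \<union> range gL \<union> range gLi"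

definition U_relations :: "('i::finite, 'k::field) bichar \<Rightarrow> ('i, 'k) falg set" where
  "U_relations chi =
     {letter x * letter y - letter y * letter x | x y. x \<in> cartan_gens \<and> y \<in> cartan_gens} \<union>
     {letter (gK i) * letter (gKi i) - 1 | i. True} \<union>
     {letter (gL i) * letter (gLi i) - 1 | i. True} \<union>
     {letter (gK i) * letter (gE j) * letter (gKi i)
        - bq chi i j \<odot>\<^bsub>free_alg\<^esub> letter (gE j) | i j. True} \<union>
     {letter (gL i) * letter (gE j) * letter (gLi i)
        - inverse (bq chi j i) \<odot>\<^bsub>free_alg\<^esub> letter (gE j) | i j. True} \<union>
     {letter (gK i) * letter (gF j) * letter (gKi i)
        - inverse (bq chi i j) \<odot>\<^bsub>free_alg\<^esub> letter (gF j) | i j. True} \<union>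
     {letter (gL i) * letter (gF j) * letter (gLi i)
        - bq chi j i \<odot>\<^bsub>free_alg\<^esub> letter (gF j) | i j. True} \<union>
     {letter (gE i) * letter (gF j) - letter (gF j) * letter (gE i)
        - (if i = j then letter (gK i) - letter (gL i) else 0) | i j. True}"

definition U_rel_ideal :: "('i::finite, 'k::field) bichar \<Rightarrow> ('i, 'k) falg set" where
  "U_rel_ideal chi = Idl\<^bsub>free_alg\<^esub> (U_relations chi)"

definition U :: "('i::finite, 'k::field) bichar \<Rightarrow> ('k, ('i, 'k) ualg) module" where
  "U chi = quot_alg free_alg (U_rel_ideal chi)"

definition ugen :: "('i::finite, 'k::field) bichar \<Rightarrow> 'i gen \<Rightarrow> ('i, 'k) ualg" where
  "ugen chi g = U_rel_ideal chi +>\<^bsub>free_alg\<^esub> letter g"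

abbreviation "uK chi i \<equiv> ugen chi (gK i)"
abbreviation "uKi chi i \<equiv> ugen chi (gKi i)"
abbreviation "uL chi i \<equiv> ugen chi (gL i)"
abbreviation "uLi chi i \<equiv> ugen chi (gLi i)"
abbreviation "uE chi i \<equiv> ugen chi (gE i)"
abbreviation "uF chi i \<equiv> ugen chi (gF i)"

definition U_plus :: "('i::finite, 'k::field) bichar \<Rightarrow> ('i, 'k) ualg set" where
  "U_plus chi = generated_subalg (U chi) (range (uE chi))"

definition U_minus :: "('i::finite, 'k::field) bichar \<Rightarrow> ('i, 'k) ualg set" where
  "U_minus chi = generated_subalg (U chi) (range (uF chi))"

definition adK ::
  "('i::finite, 'k::field) bichar \<Rightarrow> 'i \<Rightarrow> ('i, 'k) ualg \<Rightarrow> ('i, 'k) ualg" where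
  "adK chi p X = uK chi p \<otimes>\<^bsub>U chi\<^esub> X \<otimes>\<^bsub>U chi\<^esub> uKi chi p"

definition adL ::
  "('i::finite, 'k::field) bichar \<Rightarrow> 'i \<Rightarrow> ('i, 'k) ualg \<Rightarrow> ('i, 'k) ualg" where
  "adL chi p X = uL chi p \<otimes>\<^bsub>U chi\<^esub> X \<otimes>\<^bsub>U chi\<^esub> uLi chi p"

primrec Eplus ::
  "('i::finite, 'k::field) bichar \<Rightarrow> 'i \<Rightarrow> 'i \<Rightarrow> nat \<Rightarrow> ('i, 'k) ualg" where
  "Eplus chi p i 0 = uE chi i"
| "Eplus chi p i (Suc m) =
     (uE chi p \<otimes>\<^bsub>U chi\<^esub> Eplus chi p i m) \<ominus>\<^bsub>U chi\<^esub> (adK chi p (Eplus chi p i m) \<otimes>\<^bsub>U chi\<^esub> uE chi p)"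

primrec Eminus ::
  "('i::finite, 'k::field) bichar \<Rightarrow> 'i \<Rightarrow> 'i \<Rightarrow> nat \<Rightarrow> ('i, 'k) ualg" where
  "Eminus chi p i 0 = uE chi i"
| "Eminus chi p i (Suc m) =
     (uE chi p \<otimes>\<^bsub>U chi\<^esub> Eminus chi p i m) \<ominus>\<^bsub>U chi\<^esub> (adL chi p (Eminus chi p i m) \<otimes>\<^bsub>U chi\<^esub> uE chi p)"

primrec Fplus ::
  "('i::finite, 'k::field) bichar \<Rightarrow> 'i \<Rightarrow> 'i \<Rightarrow> nat \<Rightarrow> ('i, 'k) ualg" where
  "Fplus chi p i 0 = uF chi i"
| "Fplus chi p i (Suc m) =
     (uF chi p \<otimes>\<^bsub>U chi\<^esub> Fplus chi p i m) \<ominus>\<^bsub>U chi\<^esub> (adL chi p (Fplus chi p i m) \<otimes>\<^bsub>U chi\<^esub> uF chi p)"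

primrec Fminus ::
  "('i::finite, 'k::field) bichar \<Rightarrow> 'i \<Rightarrow> 'i \<Rightarrow> nat \<Rightarrow> ('i, 'k) ualg" where
  "Fminus chi p i 0 = uF chi i"
| "Fminus chi p i (Suc m) =
     (uF chi p \<otimes>\<^bsub>U chi\<^esub> Fminus chi p i m) \<ominus>\<^bsub>U chi\<^esub> (adK chi p (Fminus chi p i m) \<otimes>\<^bsub>U chi\<^esub> uF chi p)"


section \<open>The ideals and the quotient\<close>

text \<open>
  The cases of finite and infinite height are merged: for infinite height the first set of
  generators is empty and the condition \<open>1 - c\<^sub>p\<^sub>i < h\<close> is vacuous. The ideals are ideals of the
  subalgebras \<open>U_plus chi\<close> and \<open>U_minus chi\<close>, not of \<open>U chi\<close>.
\<close>

definition I_plus :: "('i::finite, 'k::field) bichar \<Rightarrow> 'i \<Rightarrow> ('i, 'k) ualg set" where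
  "I_plus chi p = Idl\<^bsub>(U chi)\<lparr>carrier := U_plus chi\<rparr>\<^esub>
     ({uE chi p [^]\<^bsub>U chi\<^esub> h | h::nat. height chi p = enat h} \<union>
      {Eplus chi p i (nat (1 - cartan chi p i)) | i.
         i \<noteq> p \<and> enat (nat (1 - cartan chi p i)) < height chi p})"

definition I_minus :: "('i::finite, 'k::field) bichar \<Rightarrow> 'i \<Rightarrow> ('i, 'k) ualg set" where
  "I_minus chi p = Idl\<^bsub>(U chi)\<lparr>carrier := U_minus chi\<rparr>\<^esub>
     ({uF chi p [^]\<^bsub>U chi\<^esub> h | h::nat. height chi p = enat h} \<union>
      {Fplus chi p i (nat (1 - cartan chi p i)) | i.
         i \<noteq> p \<and> enat (nat (1 - cartan chi p i)) < height chi p})"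

definition I_both :: "('i::finite, 'k::field) bichar \<Rightarrow> 'i \<Rightarrow> ('i, 'k) ualg set" where
  "I_both chi p = Idl\<^bsub>U chi\<^esub> (I_plus chi p \<union> I_minus chi p)"

definition Uq :: "('i::finite, 'k::field) bichar \<Rightarrow> 'i \<Rightarrow> ('k, ('i, 'k) qalg) module" where
  "Uq chi p = quot_alg (U chi) (I_both chi p)"

definition qproj ::
  "('i::finite, 'k::field) bichar \<Rightarrow> 'i \<Rightarrow> ('i, 'k) ualg \<Rightarrow> ('i, 'k) qalg" where
  "qproj chi p x = I_both chi p +>\<^bsub>U chi\<^esub> x"


section \<open>Lusztig maps\<close>

text \<open>
  In the defining equations \<open>\<rho>\<close> is the reflected bicharacter, so that \<open>uK \<rho>\<close>, \<open>Eplus \<rho> p\<close> etc.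
  are the generators and elements of the target. Images of the inverse generators are not
  prescribed, since they are determined by those of the \<open>K\<^sub>i\<close>, \<open>L\<^sub>i\<close>.
\<close>

definition Lusztig ::
  "('i::finite, 'k::field) bichar \<Rightarrow> 'i \<Rightarrow> ('i, 'k) ualg \<Rightarrow> ('i, 'k) qalg" where
  "Lusztig chi p =
    (let \<rho> = reflect chi p; c = cartan chi p in
     the_alg_hom (U chi) (Uq \<rho> p) (\<lambda>T.
       T (uK chi p) = qproj \<rho> p (uKi \<rho> p) \<and>
       T (uL chi p) = qproj \<rho> p (uLi \<rho> p) \<and>
       T (uE chi p) = qproj \<rho> p (uF \<rho> p \<otimes>\<^bsub>U \<rho>\<^esub> uLi \<rho> p) \<and>
       T (uF chi p) = qproj \<rho> p (uKi \<rho> p \<otimes>\<^bsub>U \<rho>\<^esub> uE \<rho> p) \<and>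
       (\<forall>i. i \<noteq> p \<longrightarrow>
         T (uK chi i) = qproj \<rho> p (uK \<rho> i \<otimes>\<^bsub>U \<rho>\<^esub> (uK \<rho> p [^]\<^bsub>U \<rho>\<^esub> nat (- c i))) \<and>
         T (uL chi i) = qproj \<rho> p (uL \<rho> i \<otimes>\<^bsub>U \<rho>\<^esub> (uL \<rho> p [^]\<^bsub>U \<rho>\<^esub> nat (- c i))) \<and>
         T (uE chi i) = qproj \<rho> p (Eplus \<rho> p i (nat (- c i))) \<and>
         T (uF chi i) =
           qproj \<rho> p (inverse (lambda \<rho> p i) \<odot>\<^bsub>U \<rho>\<^esub> Fplus \<rho> p i (nat (- c i))))))"

definition Lusztig_minus ::
  "('i::finite, 'k::field) bichar \<Rightarrow> 'i \<Rightarrow> ('i, 'k) ualg \<Rightarrow> ('i, 'k) qalg" where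
  "Lusztig_minus chi p =
    (let \<rho> = reflect chi p; c = cartan chi p in
     the_alg_hom (U chi) (Uq \<rho> p) (\<lambda>T.
       T (uK chi p) = qproj \<rho> p (uKi \<rho> p) \<and>
       T (uL chi p) = qproj \<rho> p (uLi \<rho> p) \<and>
       T (uE chi p) = qproj \<rho> p (uKi \<rho> p \<otimes>\<^bsub>U \<rho>\<^esub> uF \<rho> p) \<and>
       T (uF chi p) = qproj \<rho> p (uE \<rho> p \<otimes>\<^bsub>U \<rho>\<^esub> uLi \<rho> p) \<and>
       (\<forall>i. i \<noteq> p \<longrightarrow>
         T (uK chi i) = qproj \<rho> p (uK \<rho> i \<otimes>\<^bsub>U \<rho>\<^esub> (uK \<rho> p [^]\<^bsub>U \<rho>\<^esub> nat (- c i))) \<and>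
         T (uL chi i) = qproj \<rho> p (uL \<rho> i \<otimes>\<^bsub>U \<rho>\<^esub> (uL \<rho> p [^]\<^bsub>U \<rho>\<^esub> nat (- c i))) \<and>
         T (uE chi i) =
           qproj \<rho> p (inverse (lambda (reflect (bichar_inv chi) p) p i)
                        \<odot>\<^bsub>U \<rho>\<^esub> Eminus \<rho> p i (nat (- c i))) \<and>
         T (uF chi i) =
           qproj \<rho> p (((-1) powi (c i)) \<odot>\<^bsub>U \<rho>\<^esub> Fminus \<rho> p i (nat (- c i))))))"

text \<open>
  The maps on \<open>Uq chi p\<close>: the common value of the map on a coset (as in the library's treatment
  of the homomorphism theorem); meaningful when the map is constant on cosets.
\<close>

definition Lusztig_q ::
  "('i::finite, 'k::field) bichar \<Rightarrow> 'i \<Rightarrow> ('i, 'k) qalg \<Rightarrow> ('i, 'k) qalg" where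
  "Lusztig_q chi p X = the_elem (Lusztig chi p ` X)"

definition Lusztig_minus_q ::
  "('i::finite, 'k::field) bichar \<Rightarrow> 'i \<Rightarrow> ('i, 'k) qalg \<Rightarrow> ('i, 'k) qalg" where
  "Lusztig_minus_q chi p X = the_elem (Lusztig_minus chi p ` X)"


section \<open>Further maps\<close>

definition phi_diag ::
  "('i::finite, 'k::field) bichar \<Rightarrow> ('i \<Rightarrow> 'k) \<Rightarrow> ('i, 'k) ualg \<Rightarrow> ('i, 'k) ualg" where
  "phi_diag chi a = the_alg_hom (U chi) (U chi) (\<lambda>f. \<forall>i.
     f (uK chi i) = uK chi i \<and> f (uL chi i) = uL chi i \<and>
     f (uE chi i) = a i \<odot>\<^bsub>U chi\<^esub> uE chi i \<and> f (uF chi i) = inverse (a i) \<odot>\<^bsub>U chi\<^esub> uF chi i)"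

definition phi2 ::
  "('i::finite, 'k::field) bichar \<Rightarrow> ('i, 'k) ualg \<Rightarrow> ('i, 'k) ualg" where
  "phi2 chi = (let \<psi> = bichar_inv chi in the_alg_hom (U chi) (U \<psi>) (\<lambda>f. \<forall>i.
     f (uK chi i) = uK \<psi> i \<and> f (uL chi i) = uL \<psi> i \<and>
     f (uE chi i) = uF \<psi> i \<and> f (uF chi i) = \<ominus>\<^bsub>U \<psi>\<^esub> uE \<psi> i))"

definition phi3 ::
  "('i::finite, 'k::field) bichar \<Rightarrow> ('i, 'k) ualg \<Rightarrow> ('i, 'k) ualg" where
  "phi3 chi = (let \<psi> = bichar_op chi in the_alg_hom (U chi) (U \<psi>) (\<lambda>f. \<forall>i.
     f (uK chi i) = uL \<psi> i \<and> f (uL chi i) = uK \<psi> i \<and>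
     f (uE chi i) = uF \<psi> i \<and> f (uF chi i) = uE \<psi> i))"

definition phi4 ::
  "('i::finite, 'k::field) bichar \<Rightarrow> ('i, 'k) ualg \<Rightarrow> ('i, 'k) ualg" where
  "phi4 chi = the_alg_hom (U chi) (opposite_alg (U chi)) (\<lambda>f. \<forall>i.
     f (uK chi i) = uK chi i \<and> f (uL chi i) = uL chi i \<and>
     f (uE chi i) = uF chi i \<and> f (uF chi i) = uE chi i)"

text \<open>
  For \<open>f\<close> from \<open>U chi\<close> to \<open>U \<psi>\<close>, the induced map from \<open>Uq chi p\<close> to \<open>Uq \<psi> p\<close>;
  only the target bicharacter \<open>\<psi>\<close> is needed.
\<close>

definition induced_q ::
  "('i::finite, 'k::field) bichar \<Rightarrow> 'i \<Rightarrow> (('i, 'k) ualg \<Rightarrow> ('i, 'k) ualg)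
     \<Rightarrow> ('i, 'k) qalg \<Rightarrow> ('i, 'k) qalg" where
  "induced_q \<psi> p f X = the_elem ((\<lambda>x. qproj \<psi> p (f x)) ` X)"

definition phi_diag_q where
  "phi_diag_q chi p a = induced_q chi p (phi_diag chi a)"

definition phi2_q where
  "phi2_q chi p = induced_q (bichar_inv chi) p (phi2 chi)"

definition phi3_q where
  "phi3_q chi p = induced_q (bichar_op chi) p (phi3 chi)"

definition phi4_q where
  "phi4_q chi p = induced_q chi p (phi4 chi)"

end

theory Submission
  imports Defs
begin

text \<open>
  Notation: \<open>q\<close> is $q_{pp}$, \<open>Q\<close> is $q_{pi}q_{ip}$, \<open>c\<close> is $-c_{pi}$, and
  $a_m = (m)_q (q^{m-1} Q - 1)$.

  Why the images of the generators satisfy the relations. The commutator of $E^+_{i,m}$ with $F_p$ is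
  $a_m L_p E^+_{i,m-1}$ (\<open>qcom_commutator\<close>). Feeding this into the recursion for $F^+_{j,n}$ shows that
  $E^+_{i,m}$ and $F^+_{j,n}$ commute for $i \ne j$, and that the commutator of $E^+_{i,m}$ and
  $F^+_{i,m}$ is $a_1 \cdots a_m (K_i K_p^m - L_i L_p^m)$ (\<open>XE_XF_top\<close>). For $m = c$ the scalar is the
  number lambda by which the image of $F_i$ is divided, and it is non-zero because $c$ is minimal. The
  commutators of $T_p(E_p)$ with $T_p(F_i)$ and of $T_p(E_i)$ with $T_p(F_p)$ are multiples of
  $F^+_{i,c+1}$ and $E^+_{i,c+1}$, which is where the quotient of the target is needed.

  Why the ideals are preserved. A commutator with $T_p(E_p) = F_p L_p^{-1}$ undoes a commutator with
  $E_p$: the image of $E^-_{i,k}$ is a multiple of $E^+_{i,c-k}$, and so that of $E^-_{i,c+1}$ is zero.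
  The ideal, however, is generated by $E^+_{i,c+1}$. If $q^c Q = 1$, then $E^+_{i,c+1}$ and
  $E^-_{i,c+1}$ are equal, since they arise from $E_i$ by the same commuting operators
  $X \mapsto E_p X - t X E_p$ in opposite orders (\<open>qcom_reverse\<close>). Otherwise $(c+1)_q = 0$, thus $c + 1$
  is the height of $\alpha_p$, and by the vanishing of the inner q-binomial coefficients both elements
  lie in the ideal generated by $E_p^{c+1}$ (\<open>qcom_root\<close>).

  Why the maps are mutually inverse. At $k = c$ the same computation sends $E^-_{i,c}$ back to a multiple
  of $E_i$; that the scalars fit is \<open>mlambda_inverse_reflect\<close>. Up to signs, $T_p^-$ is $T_p$
  conjugated by $\phi_2$, which turns one of the two compositions into the other.

  How this is made precise. An algebra map out of \<open>U chi\<close> is a choice of images of the generators, that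
  is, a valuation \<open>v :: 'i gen \<Rightarrow> 'r\<close> that satisfies the relations (\<open>U_rep\<close>), and it factors through the
  quotient if moreover the generators of the ideals vanish (\<open>U_serre\<close>). Precomposition with the Lusztig
  maps and with the maps $\phi$ becomes the operations \<open>T_val\<close>, \<open>Tminus_val\<close>, \<open>diag\<close>, \<open>twist2\<close>, \<open>twist3\<close>
  and \<open>swapEF\<close> on valuations, and the theorem becomes a list of identities between composites of these
  operations. They are proved for valuations in an arbitrary ring type. A quotient of the free algebra
  by a variable ideal is not a type; the type \<open>residues\<close> of families of residues, indexed by all
  ideals, takes its place (\<open>residue_serre\<close>). Finally \<open>U chi\<close> and \<open>Uq chi p\<close> are described as
  images of the free algebra with known kernels (\<open>presented\<close>, \<open>serre_ideal\<close>), so that all maps of the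
  theorem are induced by substitutions in the free algebra.
\<close>

section \<open>q-numbers and iterated q-commutators\<close>

text \<open>
  An algebra over a field whose underlying ring is a type. The scaling is a parameter, so that the
  same facts serve the free algebra, the type of residues and the field itself.
\<close>

locale algebra_over = vector_space scale
  for scale :: "'k::field \<Rightarrow> 'r::ring_1 \<Rightarrow> 'r" (infixr "\<cdot>" 75) +
  assumes scale_mult_left: "(c \<cdot> x) * y = c \<cdot> (x * y)"
    and scale_mult_right: "x * (c \<cdot> y) = c \<cdot> (x * y)"
begin

lemmas scale_simps = scale_mult_left scale_mult_right scale_scale

lemmas scale_distribs = scale_right_distrib scale_right_diff_distrib
  scale_minus_right scale_sum_right

lemma scale_power: "(c \<cdot> x) ^ n = c ^ n \<cdot> x ^ n"
  by (induction n) (simp_all add: scale_simps)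

text \<open>
  Commutation up to a scalar (\<open>qcm\<close> for q-commute). All weight relations between the Cartan generators
  and products of the $E_i$, $F_i$ take this form, and the rules below compute the scalar.
\<close>

definition qcm :: "'k \<Rightarrow> 'r \<Rightarrow> 'r \<Rightarrow> bool" where
  "qcm u a b \<longleftrightarrow> a * b = u \<cdot> (b * a)"

lemma qcmD: "qcm u a b \<Longrightarrow> a * b = u \<cdot> (b * a)"
  by (simp add: qcm_def)

lemma qcmD2: "qcm u a b \<Longrightarrow> a * (b * z) = u \<cdot> (b * (a * z))"
  by (metis qcm_def mult.assoc scale_mult_left)

lemma qcm_one_right: "qcm 1 a 1"
  by (simp add: qcm_def)

lemma qcm_mult_right:
  assumes "qcm u a x" "qcm w a y"
  shows "qcm (u * w) a (x * y)"
proof -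
  have "a * (x * y) = (u \<cdot> (x * a)) * y"
    using assms(1) by (metis mult.assoc qcm_def)
  also have "\<dots> = u \<cdot> (x * (a * y))"
    by (simp add: scale_simps mult.assoc)
  also have "\<dots> = (u * w) \<cdot> (x * y * a)"
    using assms(2) by (simp add: qcm_def scale_simps mult.assoc)
  finally show ?thesis by (simp add: qcm_def)
qed

lemma qcm_mult_left:
  assumes "qcm u a x" "qcm w b x"
  shows "qcm (u * w) (a * b) x"
proof -
  have "a * b * x = a * (w \<cdot> (x * b))"
    using assms(2) by (simp add: qcm_def mult.assoc)
  also have "\<dots> = w \<cdot> ((a * x) * b)"
    by (simp add: scale_simps mult.assoc)
  also have "\<dots> = (u * w) \<cdot> (x * (a * b))"
    using assms(1) by (simp add: qcm_def scale_simps mult.assoc mult.commute)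
  finally show ?thesis by (simp add: qcm_def)
qed

lemma qcm_power_right: "qcm u a x \<Longrightarrow> qcm (u ^ n) a (x ^ n)"
  by (induction n) (simp_all add: qcm_one_right qcm_mult_right)

lemma qcm_power_left: "qcm u a x \<Longrightarrow> qcm (u ^ n) (a ^ n) x"
  by (induction n) (simp_all add: qcm_def[of 1] qcm_mult_left)

lemma qcm_scale_right: "qcm u a x \<Longrightarrow> qcm u a (c \<cdot> x)"
  by (simp add: qcm_def scale_simps mult.commute)

lemma qcm_diff_right: "qcm u a x \<Longrightarrow> qcm u a y \<Longrightarrow> qcm u a (x - y)"
  by (simp add: qcm_def right_diff_distrib left_diff_distrib scale_right_diff_distrib)

lemma qcm_minus_right: "qcm u a x \<Longrightarrow> qcm u a (- x)"
  by (simp add: qcm_def scale_minus_right)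

lemma qcm_inverse_left:
  assumes "qcm u a x" "u \<noteq> 0" "a * b = 1" "b * a = 1"
  shows "qcm (inverse u) b x"
proof -
  have "x * b = (b * a) * (x * b)" using assms by simp
  also have "\<dots> = b * (a * x) * b" by (simp add: mult.assoc)
  also have "\<dots> = u \<cdot> (b * x * (a * b))"
    using assms(1) by (simp add: qcm_def scale_simps mult.assoc)
  finally have "x * b = u \<cdot> (b * x)" using assms by simp
  then show ?thesis using assms(2) by (simp add: qcm_def)
qed

lemma qcm_inverse_right:
  assumes "qcm u a x" "u \<noteq> 0" "x * y = 1" "y * x = 1"
  shows "qcm (inverse u) a y"
proof -
  have "y * a = y * (a * x) * y" using assms by (simp add: mult.assoc)
  also have "\<dots> = u \<cdot> ((y * x) * (a * y))"
    using assms(1) by (simp add: qcm_def scale_simps mult.assoc)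
  finally have "y * a = u \<cdot> (a * y)" using assms by simp
  then show ?thesis using assms(2) by (simp add: qcm_def)
qed

lemma qcm_sym: "qcm u a x \<Longrightarrow> u \<noteq> 0 \<Longrightarrow> qcm (inverse u) x a"
  by (simp add: qcm_def)

lemma qcm_conj:
  assumes "qcm u a x" "a * b = 1"
  shows "a * x * b = u \<cdot> x"
  using assms by (simp add: qcm_def scale_simps mult.assoc)

text \<open>
  The elements $E^\pm_{i,m}$, $F^\pm_{i,m}$ with the action of $K_p$ or $L_p$ replaced by its eigenvalue on
  the previous element: \<open>w\<close> is the eigenvalue on \<open>x\<close>, and each factor \<open>e\<close> contributes \<open>q\<close>.
\<close>

primrec qcom :: "'r \<Rightarrow> 'k \<Rightarrow> 'k \<Rightarrow> 'r \<Rightarrow> nat \<Rightarrow> 'r" where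
  "qcom e w q x 0 = x"
| "qcom e w q x (Suc m) = e * qcom e w q x m - (w * q ^ m) \<cdot> (qcom e w q x m * e)"

lemma qcom_weight:
  assumes "qcm u y e" "qcm t y x"
  shows "qcm (t * u ^ m) y (qcom e w q x m)"
proof (induction m)
  case 0 then show ?case using assms by simp
next
  case (Suc m)
  have "qcm (u * (t * u ^ m)) y (e * qcom e w q x m)"
    by (rule qcm_mult_right[OF assms(1) Suc])
  moreover have "qcm ((t * u ^ m) * u) y (qcom e w q x m * e)"
    by (rule qcm_mult_right[OF Suc assms(1)])
  ultimately show ?case
    by (auto intro!: qcm_diff_right qcm_scale_right simp: algebra_simps)
qed

lemma qcom_commute:
  assumes "y * e = e * y" "y * x = x * y"
  shows "y * qcom e w q x m = qcom e w q x m * y"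
  using qcom_weight[of 1 y e 1 x m w q] assms by (simp add: qcm_def)

lemma qcom_scale: "qcom (c \<cdot> e) w q (d \<cdot> x) m = (d * c ^ m) \<cdot> qcom e w q x m"
proof (induction m)
  case (Suc m)
  then show ?case
    by (simp add: scale_simps scale_distribs mult_ac)
qed simp

lemma qcom_minus: "qcom (- e) w q (- x) m = (- 1) ^ Suc m \<cdot> qcom e w q x m"
  using qcom_scale[of "- 1" e w q "- 1" x m] by simp

lemma qcom_shift:
  "qcom e w q x (Suc m) = qcom e (w * q) q (e * x - w \<cdot> (x * e)) m"
  by (induction m) (simp_all add: mult_ac)

lemma qcom_apply:
  "e * qcom e w q x m - c \<cdot> (qcom e w q x m * e) = qcom e w q (e * x - c \<cdot> (x * e)) m"
proof (induction m)
  case (Suc m)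
  let ?X = "qcom e w q x m" and ?d = "w * q ^ m"
  have "e * (e * ?X - ?d \<cdot> (?X * e)) - c \<cdot> ((e * ?X - ?d \<cdot> (?X * e)) * e)
    = e * (e * ?X - c \<cdot> (?X * e)) - ?d \<cdot> ((e * ?X - c \<cdot> (?X * e)) * e)"
    by (simp add: algebra_simps scale_simps scale_distribs)
  then show ?case by (simp add: Suc)
qed simp

text \<open>
  \<open>qcom e w q x (Suc m)\<close> is the product of the operators $X \mapsto eX - w q^s Xe$, $0 \le s \le m$, applied to \<open>x\<close>.
  These operators commute; multiplying them in the opposite order amounts to starting at $w q^m$ with
  the inverse ratio. This is what identifies $E^+$ with $E^-$.
\<close>

lemma qcom_reverse:
  assumes "q \<noteq> 0"
  shows "qcom e w q x (Suc m) = qcom e (w * q ^ m) (inverse q) x (Suc m)"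
proof (induction m arbitrary: x)
  case 0 then show ?case by simp
next
  case (Suc m)
  let ?D = "\<lambda>c x. e * x - c \<cdot> (x * e)"
  have *: "w * q ^ Suc m * inverse q = w * q ^ m"
    using assms by simp
  have "qcom e w q x (Suc (Suc m)) = ?D (w * q ^ Suc m) (qcom e w q x (Suc m))"
    by simp
  also have "\<dots> = qcom e w q (?D (w * q ^ Suc m) x) (Suc m)"
    by (rule qcom_apply)
  also have "\<dots> = qcom e (w * q ^ m) (inverse q) (?D (w * q ^ Suc m) x) (Suc m)"
    by (rule Suc)
  also have "\<dots> = qcom e (w * q ^ Suc m) (inverse q) x (Suc (Suc m))"
    using assms by (subst qcom_shift[of _ _ _ _ "Suc m"]) (simp only: *)
  finally show ?case .
qed

end

text \<open>
  The elementary symmetric polynomial of degree k in $1, q, \dots, q^{m-1}$, i.e. $q^{k(k-1)/2}$ times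
  the q-binomial coefficient. It avoids a division in the q-binomial theorem.
\<close>

fun qsym :: "'k::field \<Rightarrow> nat \<Rightarrow> nat \<Rightarrow> 'k" where
  "qsym q m 0 = 1"
| "qsym q 0 (Suc k) = 0"
| "qsym q (Suc m) (Suc k) = qsym q m (Suc k) + q ^ m * qsym q m k"

lemma qsym_eq_0: "m < k \<Longrightarrow> qsym q m k = 0"
  by (induction q m k rule: qsym.induct) auto

lemma qsym_diag: "qsym q m m = (\<Prod>s<m. q ^ s)"
proof (induction m)
  case (Suc m)
  then show ?case by (simp add: qsym_eq_0 mult.commute)
qed simp

lemma qnum_0 [simp]: "qnum q 0 = 0"
  and qnum_Suc: "qnum q (Suc m) = qnum q m + q ^ m"
  by (simp_all add: qnum_def)

lemma qnum_Suc': "qnum q (Suc m) = 1 + q * qnum q m"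
  unfolding qnum_def by (subst sum.lessThan_Suc_shift) (simp add: sum_distrib_left)

text \<open>
  The q-analogue of $(k+1)\binom{m}{k+1} = (m-k)\binom{m}{k}$. It makes \<open>qsym q h k\<close> vanish for $0 < k < h$
  if $h$ is the first positive zero of \<open>qnum q\<close>.
\<close>

lemma qsym_qnum: "k \<le> m \<Longrightarrow> qnum q (Suc k) * qsym q m (Suc k) = q ^ k * qnum q (m - k) * qsym q m k"
proof (induction m arbitrary: k)
  case 0 then show ?case by simp
next
  case (Suc m)
  show ?case
  proof (cases "k = Suc m")
    case True
    then show ?thesis by (simp add: qsym_eq_0)
  next
    case False
    then have k: "k \<le> m" using Suc.prems by simp
    have *: "q ^ k * qnum q (Suc m - k) = q ^ k * qnum q (m - k) + q ^ m"
      using k by (simp add: Suc_diff_le qnum_Suc distrib_left power_add[symmetric])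
    show ?thesis
    proof (cases k)
      case 0
      then show ?thesis using Suc.IH[of 0] by (simp add: qnum_Suc algebra_simps)
    next
      case (Suc j)
      have "qnum q (Suc k) * qsym q (Suc m) (Suc k)
        = qnum q (Suc k) * qsym q m (Suc k) + q ^ m * qnum q (Suc k) * qsym q m k"
        by (simp add: algebra_simps)
      also have "\<dots> = q ^ k * qnum q (m - k) * qsym q m k + q ^ m * qnum q (Suc k) * qsym q m k"
        using Suc.IH[OF k] by simp
      also have "\<dots> = (q ^ k * qnum q (Suc m - k)) * qsym q m k + q ^ m * q * (qnum q k * qsym q m k)"
        unfolding * by (simp add: qnum_Suc'[of q k] algebra_simps)
      also have "qnum q k * qsym q m k = q ^ j * qnum q (m - j) * qsym q m j"
        using Suc.IH[of j] k Suc by simp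
      also have "q ^ m * q * \<dots> = (q ^ k * qnum q (Suc m - k)) * (q ^ m * qsym q m j)"
        using Suc by (simp add: algebra_simps)
      finally show ?thesis using Suc by (simp add: algebra_simps)
    qed
  qed
qed

lemma qsym_eq_0_root:
  assumes "qnum q h = 0" "\<And>m. 0 < m \<Longrightarrow> m < h \<Longrightarrow> qnum q m \<noteq> 0" "0 < k" "k < h"
  shows "qsym q h k = 0"
  using assms(3,4)
proof (induction k)
  case (Suc k)
  have "qnum q (Suc k) * qsym q h (Suc k) = q ^ k * qnum q (h - k) * qsym q h k"
    using Suc by (intro qsym_qnum) simp
  also have "\<dots> = 0"
    using Suc assms(1) by (cases "k = 0") auto
  finally show ?case using assms(2)[of "Suc k"] Suc by simp
qed simp

context algebra_over
begin

lemma qcom_expand: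
  "qcom e w q x m = (\<Sum>k\<le>m. ((- w) ^ k * qsym q m k) \<cdot> (e ^ (m - k) * x * e ^ k))"
proof (induction m)
  case 0 then show ?case by simp
next
  case (Suc m)
  let ?t = "\<lambda>m k. e ^ (m - k) * x * e ^ k"
  have A: "e * qcom e w q x m = (\<Sum>k\<le>Suc m. ((- w) ^ k * qsym q m k) \<cdot> ?t (Suc m) k)"
    unfolding Suc sum_distrib_left
    by (simp add: qsym_eq_0 scale_simps mult.assoc[symmetric] Suc_diff_le cong: sum.cong_simp)
  have B: "(w * q ^ m) \<cdot> (qcom e w q x m * e)
    = (\<Sum>k\<le>m. (w * q ^ m * (- w) ^ k * qsym q m k) \<cdot> ?t (Suc m) (Suc k))"
    unfolding Suc sum_distrib_right
    by (simp add: scale_simps scale_sum_right mult.assoc power_commutes)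
  have C: "(\<Sum>k\<le>Suc m. ((- w) ^ k * qsym q m k) \<cdot> ?t (Suc m) k)
    = ?t (Suc m) 0 + (\<Sum>k\<le>m. ((- w) ^ Suc k * qsym q m (Suc k)) \<cdot> ?t (Suc m) (Suc k))"
    by (subst sum.atMost_Suc_shift) simp
  have "qcom e w q x (Suc m) = ?t (Suc m) 0 +
     (\<Sum>k\<le>m. ((- w) ^ Suc k * qsym q m (Suc k)) \<cdot> ?t (Suc m) (Suc k)
         - (w * q ^ m * (- w) ^ k * qsym q m k) \<cdot> ?t (Suc m) (Suc k))"
    by (simp only: qcom.simps A B C sum_subtractf add_diff_eq)
  also have "\<dots> = ?t (Suc m) 0 +
     (\<Sum>k\<le>m. ((- w) ^ Suc k * qsym q (Suc m) (Suc k)) \<cdot> ?t (Suc m) (Suc k))"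
    by (simp add: scale_left_diff_distrib[symmetric] algebra_simps)
  also have "\<dots> = (\<Sum>k\<le>Suc m. ((- w) ^ k * qsym q (Suc m) k) \<cdot> ?t (Suc m) k)"
    by (subst sum.atMost_Suc_shift) simp
  finally show ?case .
qed

text \<open>
  Only the two outer terms of the q-binomial expansion survive, so the element lies in the ideal
  generated by the h-th power of e.
\<close>

lemma qcom_root:
  assumes "qnum q h = 0" "\<And>m. 0 < m \<Longrightarrow> m < h \<Longrightarrow> qnum q m \<noteq> 0" "0 < h"
  shows "qcom e w q x h = e ^ h * x + ((- w) ^ h * (\<Prod>s<h. q ^ s)) \<cdot> (x * e ^ h)"
proof -
  let ?f = "\<lambda>k. ((- w) ^ k * qsym q h k) \<cdot> (e ^ (h - k) * x * e ^ k)"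
  have "(\<Sum>k\<le>h. ?f k) = (\<Sum>k\<in>{0, h}. ?f k)"
    using assms qsym_eq_0_root[of q h] by (intro sum.mono_neutral_right) auto
  then show ?thesis
    using assms(3) by (simp add: qcom_expand qsym_diag)
qed

end

text \<open>
  The previous lemma in the field itself with all data 1: there the very first commutator is
  already zero. For a primitive root of unity this is the product of its powers.
\<close>

lemma root_prod_powers:
  fixes q :: "'k::field"
  assumes "qnum q h = 0" "\<And>m. 0 < m \<Longrightarrow> m < h \<Longrightarrow> qnum q m \<noteq> 0" "0 < h"
  shows "(- 1) ^ h * (\<Prod>s<h. q ^ s) = - 1"
proof -
  interpret A: algebra_over "(*) :: 'k \<Rightarrow> 'k \<Rightarrow> 'k"
    by unfold_locales (simp_all add: algebra_simps)
  have "A.qcom 1 1 q 1 (Suc m) = 0" for m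
    by (induction m) simp_all
  then have "A.qcom 1 1 q 1 h = 0" using assms(3) by (cases h) auto
  with A.qcom_root[OF assms, of 1 1 1] have "1 + (- 1) ^ h * (\<Prod>s<h. q ^ s) = 0"
    by simp
  then show ?thesis
    by (metis add_eq_0_iff)
qed


section \<open>Commutators of root vectors\<close>

text \<open>
  The structure constant $a_m$ of the commutator of $E^+_{i,m}$ with $F_p$; Q stands for $q_{pi} q_{ip}$.
\<close>

definition acoef :: "'k::field \<Rightarrow> 'k \<Rightarrow> nat \<Rightarrow> 'k" where
  "acoef q Q m = qnum q m * (q ^ (m - 1) * Q - 1)"

lemma acoef_0 [simp]: "acoef q Q 0 = 0"
  by (simp add: acoef_def)

lemma acoef_Suc: "acoef q Q (Suc m) = q ^ m * q ^ m * Q - 1 + q * acoef q Q m"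
proof (cases m)
  case (Suc n)
  have "acoef q Q (Suc m) = (qnum q m + q ^ m) * (q ^ m * Q) - (1 + q * qnum q m)"
    by (simp add: acoef_def right_diff_distrib qnum_Suc[symmetric] qnum_Suc'[symmetric])
  then show ?thesis using Suc
    by (simp add: acoef_def algebra_simps)
qed (simp add: acoef_def qnum_Suc)

context algebra_over
begin

text \<open>
  The basic commutator, stated for abstract elements so that it also applies with the roles of $E$
  and $F$, $K$ and $L$ exchanged. The $K$-terms cancel because \<open>w\<close> is the weight of \<open>x\<close> for \<open>k\<close>; the
  $L$-terms add up to the recursion \<open>acoef_Suc\<close>. For $m = 0$ the predecessor is a dummy, as its
  coefficient is zero.
\<close>

lemma qcom_commutator:
  assumes ef: "e * f = f * e + (k - l)" and xf: "x * f = f * x"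
    and ke: "qcm q k e" and kx: "qcm w k x"
    and le: "qcm (inverse q) l e" and lx: "qcm (inverse u) l x"
    and nz: "q \<noteq> 0" "u \<noteq> 0"
  shows "qcom e w q x m * f
    = f * qcom e w q x m + acoef q (w * u) m \<cdot> (l * qcom e w q x (m - 1))"
proof (induction m)
  case 0 then show ?case using xf by simp
next
  case (Suc m)
  let ?X = "qcom e w q x m" and ?Y = "qcom e w q x (m - 1)"
  let ?a = "acoef q (w * u) m" and ?c = "w * q ^ m"
  have kX: "k * ?X = ?c \<cdot> (?X * k)"
    using qcom_weight[OF ke kx] by (rule qcmD)
  have "qcm (inverse u * inverse q ^ m) l ?X"
    by (rule qcom_weight[OF le lx])
  then have Xl: "?X * l = (u * q ^ m) \<cdot> (l * ?X)"
    using nz by (simp add: qcm_def power_inverse field_simps)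
  have el: "e * (l * z) = q \<cdot> (l * (e * z))" for z
    using qcmD2[OF le, of z] nz by (simp add: scale_simps)
  have Y: "?a \<cdot> (e * (l * ?Y)) - (?a * ?c) \<cdot> (l * ?Y * e) = (q * ?a) \<cdot> (l * ?X)"
  proof (cases m)
    case (Suc n)
    have "?a \<cdot> (e * (l * ?Y)) - (?a * ?c) \<cdot> (l * ?Y * e)
      = (q * ?a) \<cdot> (l * (e * ?Y - (w * q ^ n) \<cdot> (?Y * e)))"
      using Suc by (simp add: el scale_simps right_diff_distrib scale_distribs mult_ac)
    then show ?thesis using Suc by simp
  qed simp
  have "qcom e w q x (Suc m) * f = e * (?X * f) - ?c \<cdot> (?X * (e * f))"
    by (simp add: left_diff_distrib scale_simps mult.assoc)
  also have "?X * (e * f) = ?X * f * e + ?X * k - ?X * l"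
    by (simp add: ef algebra_simps)
  also have "e * (?X * f) = (e * f) * ?X + ?a \<cdot> (e * (l * ?Y))"
    unfolding Suc by (simp add: algebra_simps scale_simps)
  also have "(e * f) * ?X + ?a \<cdot> (e * (l * ?Y)) - ?c \<cdot> (?X * f * e + ?X * k - ?X * l)
    = (f * e + (k - l)) * ?X + ?a \<cdot> (e * (l * ?Y))
      - ?c \<cdot> ((f * ?X + ?a \<cdot> (l * ?Y)) * e + ?X * k - ?X * l)"
    unfolding Suc ef ..
  also have "\<dots> = f * (e * ?X - ?c \<cdot> (?X * e)) + (k * ?X - ?c \<cdot> (?X * k))
      - l * ?X + ?c \<cdot> (?X * l) + (?a \<cdot> (e * (l * ?Y)) - (?a * ?c) \<cdot> (l * ?Y * e))"
    by (simp add: algebra_simps scale_simps scale_distribs)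
  also have "\<dots> = f * qcom e w q x (Suc m)
      + (q ^ m * q ^ m * (w * u) - 1 + q * ?a) \<cdot> (l * ?X)"
    unfolding Y kX Xl
    by (simp add: algebra_simps scale_simps scale_distribs)
  finally show ?case unfolding acoef_Suc by simp
qed

lemma power_commutator:
  assumes ef: "e * f = f * e + (k - l)" and ke: "qcm q k e"
    and le: "qcm (inverse q) l e" and nz: "q \<noteq> 0"
  shows "f * e ^ n = e ^ n * f - qnum (inverse q) n \<cdot> (k * e ^ (n - 1))
    + qnum q n \<cdot> (l * e ^ (n - 1))"
proof (induction n)
  case (Suc n)
  have ek: "e ^ n * (k * z) = inverse q ^ n \<cdot> (k * (e ^ n * z))" for z
    using qcmD2[OF qcm_power_right[OF ke, of n], of z] nz by (simp add: scale_simps power_inverse)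
  have el: "e ^ n * (l * z) = q ^ n \<cdot> (l * (e ^ n * z))" for z
    using qcmD2[OF qcm_power_right[OF le, of n], of z] nz by (simp add: scale_simps power_inverse)
  have S: "c \<cdot> (z * e ^ (n - 1)) * e = c \<cdot> (z * e ^ n)" if "n = 0 \<Longrightarrow> c = 0" for c z
    using that by (cases n) (simp_all add: scale_simps mult.assoc power_commutes)
  have "f * e ^ Suc n = (f * e ^ n) * e"
    by (simp add: power_commutes mult.assoc)
  also have "\<dots> = e ^ n * (f * e) - qnum (inverse q) n \<cdot> (k * e ^ n) + qnum q n \<cdot> (l * e ^ n)"
    unfolding Suc by (simp only: left_diff_distrib distrib_right S qnum_0 mult.assoc)
  also have "f * e = e * f - k + l" using ef by simp
  also have "e ^ n * (e * f - k + l) = e ^ Suc n * f - inverse q ^ n \<cdot> (k * e ^ n) + q ^ n \<cdot> (l * e ^ n)"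
    using ek[of 1] el[of 1] power_commutes[of e n] by (simp add: algebra_simps flip: mult.assoc)
  finally show ?case
    by (simp add: qnum_Suc algebra_simps scale_left_distrib)
qed simp

text \<open>
  One step of the recursion for the second factor in a commutator of two iterated q-commutators: the
  term that comes from moving f past X m is again such a commutator, with m lowered by one, since l
  q-commutes with Y n by exactly the scalar in the recursion for Y.
\<close>

lemma qcom_cross_step:
  assumes ef: "e * f = f * e + (k - l)" and xf: "x * f = f * x"
    and ke: "qcm q k e" and kx: "qcm w k x"
    and le: "qcm (inverse q) l e" and lx: "qcm (inverse u) l x"
    and lf: "qcm q l f" and ly: "qcm z l y"
    and nz: "q \<noteq> 0" "u \<noteq> 0"
  defines "X \<equiv> qcom e w q x" and "Y \<equiv> qcom f z q y"
  defines "C \<equiv> \<lambda>m n. X m * Y n - Y n * X m"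
  shows "C m (Suc n) = f * C m n - (z * q ^ n) \<cdot> (C m n * f)
    + acoef q (w * u) m \<cdot> (l * C (m - 1) n)"
proof -
  let ?a = "acoef q (w * u) m" and ?d = "z * q ^ n"
  have Xf: "X m * f = f * X m + ?a \<cdot> (l * X (m - 1))"
    unfolding X_def by (rule qcom_commutator[OF ef xf ke kx le lx nz])
  then have Xf': "X m * (f * t) = f * (X m * t) + ?a \<cdot> (l * (X (m - 1) * t))" for t
    by (metis distrib_right mult.assoc scale_mult_left)
  have "qcm ?d l (Y n)" unfolding Y_def by (rule qcom_weight[OF lf ly])
  then have lY: "l * (Y n * t) = ?d \<cdot> (Y n * (l * t))" for t
    by (rule qcmD2)
  have Y: "Y (Suc n) = f * Y n - ?d \<cdot> (Y n * f)" by (simp add: Y_def)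
  show ?thesis
    unfolding C_def Y
    by (simp add: algebra_simps scale_simps scale_distribs Xf Xf' lY)
qed

end

text \<open>
  The recursion of the definitions of $E^\pm_{i,m}$ and $F^\pm_{i,m}$, verbatim but in a ring type. Unlike
  \<open>qcom\<close> it is preserved by every ring homomorphism without reference to scalars.
\<close>

primrec qad :: "'r::ring_1 \<Rightarrow> 'r \<Rightarrow> 'r \<Rightarrow> 'r \<Rightarrow> nat \<Rightarrow> 'r" where
  "qad k ki e x 0 = x"
| "qad k ki e x (Suc m) = e * qad k ki e x m - (k * qad k ki e x m * ki) * e"

lemma (in algebra_over) qad_qcom:
  assumes "qcm q k e" "qcm w k x" "k * ki = 1"
  shows "qad k ki e x m = qcom e w q x m"
proof (induction m)
  case (Suc m)
  show ?case
    using qcm_conj[OF qcom_weight[OF assms(1,2), of m w q] assms(3)]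
    by (simp add: Suc scale_mult_left)
qed simp

text \<open>
  The coefficient of $K_i K_p^n E_p^{m-n}$ in the commutator of $E^+_{i,m}$ and $F^+_{i,n}$; \<open>u\<close> is $q_{ip}$ and \<open>w\<close> is
  $q_{pi}$.
\<close>

primrec bcoef :: "'k::field \<Rightarrow> 'k \<Rightarrow> 'k \<Rightarrow> nat \<Rightarrow> nat \<Rightarrow> 'k" where
  "bcoef q w u m 0 = (\<Prod>s<m. inverse u - q ^ s * w)"
| "bcoef q w u m (Suc n) = - (q ^ n) * u * qnum (inverse q) (m - n) * bcoef q w u m n"

lemma qnum_inverse:
  assumes "q \<noteq> 0"
  shows "q ^ n * qnum (inverse q) (Suc n) = qnum q (Suc n)"
proof (induction n)
  case 0 then show ?case by (simp add: qnum_Suc)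
next
  case (Suc n)
  have "q ^ Suc n * inverse q ^ Suc n = 1"
    using assms by (simp add: power_mult_distrib[symmetric] del: power_Suc)
  then have "q ^ Suc n * qnum (inverse q) (Suc (Suc n))
      = q * (q ^ n * qnum (inverse q) (Suc n)) + 1"
    by (simp add: qnum_Suc[of _ "Suc n"] distrib_left mult.assoc)
  then show ?case by (simp add: Suc qnum_Suc'[of q "Suc n"])
qed

text \<open>
  The cancellation of the terms with $L_p$ in the step from n to n + 1.
\<close>

lemma bcoef_rec:
  assumes "q \<noteq> 0" "u \<noteq> 0" "n < m"
  shows "q ^ n * u * qnum q (m - n) * bcoef q w u m n + acoef q (w * u) m * bcoef q w u (m - 1) n = 0"
  using assms(3)
proof (induction n)
  case 0
  then obtain m' where m: "m = Suc m'" by (cases m) auto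
  let ?P = "\<Prod>s<m'. inverse u - q ^ s * w"
  have "u * (inverse u - q ^ m' * w) = 1 - q ^ m' * (w * u)"
    using assms by (simp add: field_simps)
  then have "u * qnum q m * bcoef q w u m 0 = qnum q m * (1 - q ^ m' * (w * u)) * ?P"
    by (simp add: m mult_ac)
  then show ?case by (simp add: m acoef_def algebra_simps)
next
  case (Suc n)
  then obtain j where j: "m - n = Suc (Suc j)"
    by (metis Suc_diff_Suc Suc_lessD less_iff_Suc_add add_diff_cancel_left' add_Suc_right)
  have d: "m - Suc n = Suc j" "m - 1 - n = Suc j" using j by auto
  have IH: "q ^ n * u * qnum q (Suc (Suc j)) * bcoef q w u m n
      + acoef q (w * u) m * bcoef q w u (m - 1) n = 0"
    using Suc j by simp
  have e: "q ^ Suc n * qnum (inverse q) (Suc (Suc j)) * q ^ j = q ^ n * qnum q (Suc (Suc j))"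
    using qnum_inverse[OF assms(1), of "Suc j"] by (simp add: mult_ac)
  have e': "q ^ j * qnum (inverse q) (Suc j) = qnum q (Suc j)"
    by (rule qnum_inverse[OF assms(1)])
  have "q ^ j * (q ^ Suc n * u * qnum q (m - Suc n) * bcoef q w u m (Suc n)
       + acoef q (w * u) m * bcoef q w u (m - 1) (Suc n))
    = - (q ^ n * u * qnum q (Suc j)) * ((q ^ Suc n * qnum (inverse q) (Suc (Suc j)) * q ^ j) * u * bcoef q w u m n)
      - acoef q (w * u) m * (q ^ n * u) * (q ^ j * qnum (inverse q) (Suc j)) * bcoef q w u (m - 1) n"
    by (simp add: j d algebra_simps)
  also have "\<dots> = - (q ^ n * u * qnum q (Suc j)) * (q ^ n * u * qnum q (Suc (Suc j)) * bcoef q w u m n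
      + acoef q (w * u) m * bcoef q w u (m - 1) n)"
    unfolding e e' by (simp add: algebra_simps)
  finally show ?case using IH assms by simp
qed

lemma bcoef_diag:
  assumes "q \<noteq> 0" "u \<noteq> 0"
  shows "bcoef q w u m m = (\<Prod>s<m. acoef q (w * u) (Suc s))"
proof (induction m)
  case (Suc m)
  have "q ^ m * u * bcoef q w u (Suc m) m + acoef q (w * u) (Suc m) * bcoef q w u m m = 0"
    using bcoef_rec[OF assms, of m "Suc m" w] by (simp add: qnum_Suc)
  then have "acoef q (w * u) (Suc m) * bcoef q w u m m = - (q ^ m * u * bcoef q w u (Suc m) m)"
    by (simp only: add_eq_0_iff)
  then have "bcoef q w u (Suc m) (Suc m) = acoef q (w * u) (Suc m) * bcoef q w u m m"
    by (simp add: qnum_Suc Suc_diff_le)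
  then show ?case using Suc by (simp del: bcoef.simps)
qed simp


text \<open>
  A valuation of the generators in an algebra that satisfies the defining relations of $U(\chi)$; only
  the matrix $q_{ij}$ of the bicharacter enters. The relations with inverses are rewritten as
  q-commutations.
\<close>

locale U_rep = algebra_over scale
  for scale :: "'k::field \<Rightarrow> 'r::ring_1 \<Rightarrow> 'r" (infixr "\<cdot>" 75) +
  fixes q :: "'i \<Rightarrow> 'i \<Rightarrow> 'k" and v :: "'i gen \<Rightarrow> 'r"
  assumes q_nz: "q i j \<noteq> 0"
    and cartan_comm: "x \<in> cartan_gens \<Longrightarrow> y \<in> cartan_gens \<Longrightarrow> v x * v y = v y * v x"
    and K_Ki: "v (gK i) * v (gKi i) = 1"
    and L_Li: "v (gL i) * v (gLi i) = 1"
    and KE: "qcm (q i j) (v (gK i)) (v (gE j))"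
    and LE: "qcm (inverse (q j i)) (v (gL i)) (v (gE j))"
    and KF: "qcm (inverse (q i j)) (v (gK i)) (v (gF j))"
    and LF: "qcm (q j i) (v (gL i)) (v (gF j))"
    and EF: "v (gE i) * v (gF j) - v (gF j) * v (gE i) = (if i = j then v (gK i) - v (gL i) else 0)"
begin

abbreviation "K i \<equiv> v (gK i)"
abbreviation "Ki i \<equiv> v (gKi i)"
abbreviation "L i \<equiv> v (gL i)"
abbreviation "Li i \<equiv> v (gLi i)"
abbreviation "E i \<equiv> v (gE i)"
abbreviation "F i \<equiv> v (gF i)"

lemma cartan_mem [simp]: "gK i \<in> cartan_gens" "gKi i \<in> cartan_gens" "gL i \<in> cartan_gens" "gLi i \<in> cartan_gens"
  by (auto simp: cartan_gens_def)

lemma Ki_K: "Ki i * K i = 1" and Li_L: "Li i * L i = 1"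
  using K_Ki L_Li cartan_comm by simp_all

lemma EF_same: "E p * F p = F p * E p + (K p - L p)"
  using EF[of p p] by (simp add: algebra_simps)

lemma EF_diff: "i \<noteq> j \<Longrightarrow> E i * F j = F j * E i"
  using EF[of i j] by simp

lemma FE_same: "F p * E p = E p * F p + (L p - K p)"
  using EF_same[of p] by simp

text \<open>
  \<open>XE\<close>, \<open>XF\<close> are $E^+_{i,m}$, $F^+_{i,m}$, and \<open>YE\<close>, \<open>YF\<close> are $E^-_{i,m}$, $F^-_{i,m}$, by the four lemmas that follow.
\<close>

abbreviation "XE p i m \<equiv> qcom (E p) (q p i) (q p p) (E i) m"
abbreviation "XF p i m \<equiv> qcom (F p) (q i p) (q p p) (F i) m"
abbreviation "YE p i m \<equiv> qcom (E p) (inverse (q i p)) (inverse (q p p)) (E i) m"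
abbreviation "YF p i m \<equiv> qcom (F p) (inverse (q p i)) (inverse (q p p)) (F i) m"

lemma qad_XE: "qad (K p) (Ki p) (E p) (E i) m = XE p i m"
  and qad_XF: "qad (L p) (Li p) (F p) (F i) m = XF p i m"
  and qad_YE: "qad (L p) (Li p) (E p) (E i) m = YE p i m"
  and qad_YF: "qad (K p) (Ki p) (F p) (F i) m = YF p i m"
  by (intro qad_qcom KE LF LE KF K_Ki L_Li)+

lemma K_XE: "qcm (q j i * q j p ^ m) (K j) (XE p i m)"
  and L_XE: "qcm (inverse (q i j) * inverse (q p j) ^ m) (L j) (XE p i m)"
  and K_XF: "qcm (inverse (q j i) * inverse (q j p) ^ m) (K j) (XF p i m)"
  and L_XF: "qcm (q i j * q p j ^ m) (L j) (XF p i m)"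
  by (intro qcom_weight KE LE KF LF)+

lemma XE_F:
  assumes "i \<noteq> p"
  shows "XE p i m * F p = F p * XE p i m + acoef (q p p) (q p i * q i p) m \<cdot> (L p * XE p i (m - 1))"
  by (rule qcom_commutator[OF EF_same EF_diff KE KE LE LE q_nz q_nz]) (use assms in auto)

lemma XF_E:
  assumes "i \<noteq> p"
  shows "XF p i m * E p = E p * XF p i m + acoef (q p p) (q p i * q i p) m \<cdot> (K p * XF p i (m - 1))"
  using qcom_commutator[OF FE_same EF_diff[symmetric] LF LF KF KF q_nz q_nz, of p i m] assms
  by (auto simp: mult.commute)

lemma XE_XF_step:
  assumes "i \<noteq> p"
  shows "XE p i m * XF p j (Suc n) - XF p j (Suc n) * XE p i m
    = F p * (XE p i m * XF p j n - XF p j n * XE p i m)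
      - (q j p * q p p ^ n) \<cdot> ((XE p i m * XF p j n - XF p j n * XE p i m) * F p)
      + acoef (q p p) (q p i * q i p) m \<cdot> (L p * (XE p i (m - 1) * XF p j n - XF p j n * XE p i (m - 1)))"
  by (rule qcom_cross_step[OF EF_same EF_diff KE KE LE LE LF LF q_nz q_nz]) (use assms in auto)

text \<open>
  For $n = 0$ the element $F_j$ commutes with $E_p$ and $E_i$; the step expresses the commutator for $n + 1$
  linearly through commutators for $n$, with \<open>m\<close> and \<open>m - 1\<close>.
\<close>

lemma XE_XF_diff:
  assumes "i \<noteq> p" "j \<noteq> p" "i \<noteq> j"
  shows "XE p i m * XF p j n = XF p j n * XE p i m"
proof -
  have "XE p i m * XF p j n - XF p j n * XE p i m = 0"
  proof (induction n arbitrary: m)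
    case 0
    show ?case using qcom_commute[of "F j" "E p" "E i" "q p i" "q p p" m] assms
      by (simp add: EF_diff[of i j] EF_diff[of p j])
  next
    case (Suc n)
    show ?case unfolding XE_XF_step[OF assms(1)] Suc by simp
  qed
  then show ?thesis by simp
qed

lemma E_Kpow: "E j * (K i ^ n * z) = inverse (q i j) ^ n \<cdot> (K i ^ n * (E j * z))"
  using qcmD2[OF qcm_sym[OF qcm_power_left[OF KE[of i j], of n]], of z] q_nz
  by (simp add: power_inverse)

lemma F_Kpow: "F j * (K i ^ n * z) = q i j ^ n \<cdot> (K i ^ n * (F j * z))"
  using qcmD2[OF qcm_sym[OF qcm_power_left[OF KF[of i j], of n]], of z] q_nz
  by (simp add: power_inverse)

lemma XE_Fi:
  assumes "i \<noteq> p"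
  shows "XE p i m * F i - F i * XE p i m
    = bcoef (q p p) (q p i) (q i p) m 0 \<cdot> (K i * E p ^ m) - (if m = 0 then L i else 0)"
proof (induction m)
  case 0 then show ?case by (simp add: EF_same)
next
  case (Suc m)
  let ?X = "XE p i m" and ?c = "q p i * q p p ^ m" and ?b = "bcoef (q p p) (q p i) (q i p) m 0"
  let ?l = "if m = 0 then L i else 0"
  have eF: "E p * F i = F i * E p" using assms by (intro EF_diff) auto
  have EL: "E p * L i = q p i \<cdot> (L i * E p)"
    using qcm_sym[OF LE[of p i]] q_nz by (simp add: qcm_def)
  have l: "E p * ?l - ?c \<cdot> (?l * E p) = 0"
    using EL by simp
  have EK: "E p * (K i * E p ^ m) = inverse (q i p) \<cdot> (K i * E p ^ Suc m)"
    using E_Kpow[of p i 1 "E p ^ m"] by simp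
  have Xs: "?X * F i = F i * ?X + ?b \<cdot> (K i * E p ^ m) - ?l"
    using Suc by (simp add: algebra_simps)
  have "XE p i (Suc m) * F i = E p * (?X * F i) - ?c \<cdot> ((?X * F i) * E p)"
    by (simp add: left_diff_distrib scale_simps mult.assoc eF)
  also have "\<dots> = F i * XE p i (Suc m) + ?b \<cdot> (E p * (K i * E p ^ m)) - (?c * ?b) \<cdot> (K i * E p ^ Suc m)
     - (E p * ?l - ?c \<cdot> (?l * E p))"
    unfolding Xs
    by (simp add: algebra_simps scale_simps scale_distribs eF[symmetric] power_commutes)
      (simp add: mult.assoc[symmetric] eF)
  also have "\<dots> = F i * XE p i (Suc m) + (?b * inverse (q i p) - ?c * ?b) \<cdot> (K i * E p ^ Suc m)"
    unfolding l EK by (simp add: scale_simps scale_left_diff_distrib)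
  also have "?b * inverse (q i p) - ?c * ?b = bcoef (q p p) (q p i) (q i p) (Suc m) 0"
    by (simp add: algebra_simps)
  finally show ?case by simp
qed

abbreviation "acprod p i m \<equiv> \<Prod>s<m. acoef (q p p) (q p i * q i p) (Suc s)"

text \<open>
  By induction on $n$. The term with $L_i$ occurs only on the diagonal: it enters for $m = n = 0$ and is
  carried along by the summand of \<open>XE_XF_step\<close> with \<open>m - 1\<close>. All other terms with $L_p$ cancel by
  \<open>bcoef_rec\<close>.
\<close>

lemma XE_XF_same:
  assumes ip: "i \<noteq> p" and "n \<le> m"
  shows "XE p i m * XF p i n - XF p i n * XE p i m
    = bcoef (q p p) (q p i) (q i p) m n \<cdot> (K i * (K p ^ n * E p ^ (m - n)))
      - (if m = n then acprod p i m \<cdot> (L i * L p ^ m) else 0)"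
  using assms(2)
proof (induction n arbitrary: m)
  case 0
  show ?case using XE_Fi[OF ip, of m] by simp
next
  case (Suc n)
  let ?q = "q p p" and ?u = "q i p"
  let ?b = "bcoef ?q (q p i) ?u" and ?a = "acoef ?q (q p i * ?u)"
  let ?M = "\<lambda>n z. K i * (K p ^ n * z)"
  define r where "r = m - Suc n"
  have mn: "m - n = Suc r" "m = Suc (n + r)" "m - 1 - n = r" using Suc.prems by (auto simp: r_def)
  have FK: "F p * ?M n z = (?u * ?q ^ n) \<cdot> ?M n (F p * z)" for z
    using F_Kpow[of p i 1 "K p ^ n * z"] by (simp add: F_Kpow scale_simps)
  have C1: "XE p i m * XF p i n - XF p i n * XE p i m = ?b m n \<cdot> ?M n (E p ^ Suc r)"
    using Suc.IH[of m] Suc.prems mn by simp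
  have C2: "XE p i (m - 1) * XF p i n - XF p i n * XE p i (m - 1) = ?b (m - 1) n \<cdot> ?M n (E p ^ r)
      - (if r = 0 then acprod p i (m - 1) \<cdot> (L i * L p ^ n) else 0)"
    using Suc.IH[of "m - 1"] mn by (simp del: prod.lessThan_Suc)
  have LM: "L p * ?M n z = ?M n (L p * z)" for z
  proof -
    have "L p * K i = K i * L p" "L p * K p ^ n = K p ^ n * L p"
      by (simp_all add: cartan_comm power_commuting_commutes[symmetric])
    then show ?thesis by (metis mult.assoc)
  qed
  have KM: "?M n (K p * z) = ?M (Suc n) z" for z
    by (simp add: power_commutes mult.assoc) (metis mult.assoc power_commutes)
  have LL: "L p * (L i * L p ^ n) = L i * L p ^ Suc n"
    by (metis cartan_comm cartan_mem(3) mult.assoc power_Suc)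
  \<comment> \<open>moving \<open>F p\<close> through the power of \<open>E p\<close> produces the factor \<open>K p\<close> of the next coefficient\<close>
  have FE: "F p * E p ^ Suc r = E p ^ Suc r * F p - qnum (inverse ?q) (Suc r) \<cdot> (K p * E p ^ r)
      + qnum ?q (Suc r) \<cdot> (L p * E p ^ r)"
    using power_commutator[OF EF_same KE LE q_nz, of p "Suc r"] by simp
  have rec: "?q ^ n * ?u * qnum ?q (Suc r) * ?b m n + ?a m * ?b (m - 1) n = 0"
    using bcoef_rec[OF q_nz q_nz, of n m p p i p "q p i"] mn by simp
  have "XE p i m * XF p i (Suc n) - XF p i (Suc n) * XE p i m
    = (?u * ?q ^ n * ?b m n) \<cdot> (?M n (F p * E p ^ Suc r) - ?M n (E p ^ Suc r) * F p)
      + ?a m \<cdot> (?b (m - 1) n \<cdot> (?M n (L p * E p ^ r))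
          - (if r = 0 then acprod p i (m - 1) \<cdot> (L i * L p ^ Suc n) else 0))"
    unfolding XE_XF_step[OF ip] C1 C2
    by (simp add: scale_simps scale_distribs FK LM LL right_diff_distrib mult_ac)
  also have "?M n (F p * E p ^ Suc r) - ?M n (E p ^ Suc r) * F p
     = qnum ?q (Suc r) \<cdot> ?M n (L p * E p ^ r) - qnum (inverse ?q) (Suc r) \<cdot> ?M (Suc n) (E p ^ r)"
    unfolding FE KM[symmetric] by (simp add: algebra_simps scale_simps)
  also have "(?u * ?q ^ n * ?b m n) \<cdot> \<dots> + ?a m \<cdot> (?b (m - 1) n \<cdot> (?M n (L p * E p ^ r))
          - (if r = 0 then acprod p i (m - 1) \<cdot> (L i * L p ^ Suc n) else 0))
     = (?q ^ n * ?u * qnum ?q (Suc r) * ?b m n + ?a m * ?b (m - 1) n) \<cdot> ?M n (L p * E p ^ r)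
       + (- (?q ^ n) * ?u * qnum (inverse ?q) (Suc r) * ?b m n) \<cdot> ?M (Suc n) (E p ^ r)
       - (if r = 0 then (acprod p i (m - 1) * ?a m) \<cdot> (L i * L p ^ Suc n) else 0)"
    by (simp add: scale_simps scale_distribs scale_left_distrib mult_ac)
  also have "\<dots> = ?b m (Suc n) \<cdot> ?M (Suc n) (E p ^ (m - Suc n))
       - (if m = Suc n then acprod p i m \<cdot> (L i * L p ^ m) else 0)"
    unfolding rec using mn by (auto simp: r_def[symmetric])
  finally show ?case .
qed

lemma XE_XF_top:
  assumes "i \<noteq> p"
  shows "XE p i m * XF p i m - XF p i m * XE p i m
    = acprod p i m \<cdot> (K i * K p ^ m - L i * L p ^ m)"
  using XE_XF_same[OF assms order_refl, of m] bcoef_diag[OF q_nz q_nz]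
  by (simp add: scale_distribs)

end


section \<open>Reflection of the parameter matrix\<close>

text \<open>
  Cartan numbers, height, lambda and reflection depend on the bicharacter only through the matrix
  $q_{ij}$. The definitions below are the matrix versions; \<open>mcartan\<close> is the non-negative integer $-c_{pi}$.
\<close>

definition mcartan :: "('i \<Rightarrow> 'i \<Rightarrow> 'k::field) \<Rightarrow> 'i \<Rightarrow> 'i \<Rightarrow> nat" where
  "mcartan q p i = (LEAST m. qnum (q p p) (m + 1) * (q p p ^ m * q p i * q i p - 1) = 0)"

definition mfinite :: "('i \<Rightarrow> 'i \<Rightarrow> 'k::field) \<Rightarrow> 'i \<Rightarrow> bool" where
  "mfinite q p \<longleftrightarrow>
    (\<forall>i. i \<noteq> p \<longrightarrow> (\<exists>m. qnum (q p p) (m + 1) * (q p p ^ m * q p i * q i p - 1) = 0))"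

definition mlambda :: "('i \<Rightarrow> 'i \<Rightarrow> 'k::field) \<Rightarrow> 'i \<Rightarrow> 'i \<Rightarrow> 'k" where
  "mlambda q p i = (\<Prod>s<mcartan q p i. acoef (q p p) (q p i * q i p) (Suc s))"

definition qheight :: "'k::field \<Rightarrow> enat" where
  "qheight q = (if \<exists>m>0. qnum q m = 0 then enat (LEAST m. m > 0 \<and> qnum q m = 0) else \<infinity>)"

text \<open>
  The matrix of $r_p(\chi)$: the values of $\chi$ at the reflected simple roots $-\alpha_p$ and
  $\alpha_a - c_{pa} \alpha_p$.
\<close>

definition mreflect :: "'i \<Rightarrow> ('i \<Rightarrow> nat) \<Rightarrow> ('i \<Rightarrow> 'i \<Rightarrow> 'k::field) \<Rightarrow> 'i \<Rightarrow> 'i \<Rightarrow> 'k" where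
  "mreflect p c q a b =
    (if a = p then (if b = p then q p p else inverse (q p b * q p p ^ c b))
     else if b = p then inverse (q a p * q p p ^ c a)
     else q a b * q a p ^ c b * (q p b * q p p ^ c b) ^ c a)"

abbreviation (input) minverse :: "('i \<Rightarrow> 'i \<Rightarrow> 'k::field) \<Rightarrow> 'i \<Rightarrow> 'i \<Rightarrow> 'k" where
  "minverse q \<equiv> (\<lambda>a b. inverse (q a b))"

abbreviation (input) mtranspose :: "('i \<Rightarrow> 'i \<Rightarrow> 'k::field) \<Rightarrow> 'i \<Rightarrow> 'i \<Rightarrow> 'k" where
  "mtranspose q \<equiv> (\<lambda>a b. q b a)"

lemma qnum_root: "(q - 1) * qnum q m = q ^ m - 1"
  by (induction m) (simp_all add: qnum_Suc algebra_simps)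

lemma qnum_inverse_eq_0_iff: "q \<noteq> 0 \<Longrightarrow> qnum (inverse q) m = 0 \<longleftrightarrow> qnum q m = 0"
  using qnum_inverse[of q "m - 1"] by (cases m) auto

lemma qheight_finite:
  assumes "qheight q = enat h"
  shows "0 < h" "qnum q h = 0" "\<And>m. 0 < m \<Longrightarrow> m < h \<Longrightarrow> qnum q m \<noteq> 0"
proof -
  let ?P = "\<lambda>m. m > 0 \<and> qnum q m = 0"
  have ex: "\<exists>m. ?P m" and h: "h = (LEAST m. ?P m)"
    using assms by (auto simp: qheight_def split: if_splits)
  show "0 < h" "qnum q h = 0" using LeastI_ex[OF ex] h by auto
  show "qnum q m \<noteq> 0" if "0 < m" "m < h" for m
    using not_less_Least[of m ?P] that h by auto
qed

lemma qheight_less: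
  assumes "enat n < qheight q" "0 < m" "m \<le> n"
  shows "qnum q m \<noteq> 0"
proof (cases "qheight q")
  case (enat h)
  then show ?thesis using qheight_finite(3)[OF enat, of m] assms by simp
next
  case infinity
  then have "\<not> (\<exists>m>0. qnum q m = 0)" by (auto simp: qheight_def split: if_splits)
  then show ?thesis using assms(2) by blast
qed

lemma qheight_inverse: "q \<noteq> 0 \<Longrightarrow> qheight (inverse q) = qheight q"
  by (simp add: qheight_def qnum_inverse_eq_0_iff)

locale cartan_matrix =
  fixes q :: "'i \<Rightarrow> 'i \<Rightarrow> 'k::field" and p :: 'i
  assumes nz [simp]: "q i j \<noteq> 0" and mfinite: "mfinite q p"
begin

abbreviation "c \<equiv> mcartan q p"

lemma mcartan_zero:
  assumes "i \<noteq> p"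
  shows "qnum (q p p) (Suc (c i)) = 0 \<or> q p p ^ c i * (q p i * q i p) = 1"
proof -
  have "\<exists>m. qnum (q p p) (m + 1) * (q p p ^ m * q p i * q i p - 1) = 0"
    using mfinite assms by (auto simp: mfinite_def)
  from LeastI_ex[OF this] show ?thesis by (simp add: mcartan_def mult.assoc)
qed

lemma mcartan_minimal:
  assumes "s < c i"
  shows "qnum (q p p) (Suc s) \<noteq> 0" "q p p ^ s * (q p i * q i p) \<noteq> 1"
  using not_less_Least[of s "\<lambda>m. qnum (q p p) (m + 1) * (q p p ^ m * q p i * q i p - 1) = 0"] assms
  by (simp_all add: mcartan_def mult.assoc)

lemma mcartan_eqI:
  assumes "qnum (q p p) (Suc m) = 0 \<or> q p p ^ m * (r p i * r i p) = 1" "r p p = q p p"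
    and "\<And>s. s < m \<Longrightarrow> qnum (q p p) (Suc s) \<noteq> 0 \<and> q p p ^ s * (r p i * r i p) \<noteq> 1"
  shows "mcartan r p i = m"
  unfolding mcartan_def using assms
  by (intro Least_equality) (auto simp: mult.assoc not_less[symmetric])

lemma mlambda_nonzero: "mlambda q p i \<noteq> 0"
  using mcartan_minimal by (simp add: mlambda_def acoef_def)

abbreviation "q' \<equiv> mreflect p c q"

lemma q'_nz: "q' i j \<noteq> 0"
  by (simp add: mreflect_def)

lemma q'_p: "q' p p = q p p"
  by (simp add: mreflect_def)

lemma q'_prod:
  assumes "i \<noteq> p"
  shows "q' p i * q' i p = inverse (q p i * q i p * q p p ^ c i * q p p ^ c i)"
  using assms by (simp add: mreflect_def mult_ac)

lemma q'_zero:
  assumes "i \<noteq> p" "q p p ^ c i * (q p i * q i p) = 1"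
  shows "q p p ^ c i * (q' p i * q' i p) = 1"
proof -
  have "q p i * q i p = inverse (q p p ^ c i)"
    using assms(2) by (simp add: field_simps)
  then show ?thesis unfolding q'_prod[OF assms(1)] by simp
qed

text \<open>
  By \<open>q'_prod\<close> the new parameter is $Q' = (Q q^{2c})^{-1}$. Reaching zero at $c$ is clear in both cases. An
  earlier zero $q^s Q' = 1$ with $s < c$ would contradict minimality of $c$: if $q^c Q = 1$, then $q^s = q^c$,
  and if $(c+1)_q = 0$, then $q^{c+1} = 1$ and $q^{c-1-s} Q = 1$.
\<close>

lemma mcartan_reflect:
  assumes "i \<noteq> p"
  shows "mcartan q' p i = c i"
proof (rule mcartan_eqI)
  let ?q = "q p p" and ?Q = "q p i * q i p" and ?Q' = "q' p i * q' i p" and ?c = "c i"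
  show "qnum ?q (Suc ?c) = 0 \<or> ?q ^ ?c * ?Q' = 1"
    using mcartan_zero[OF assms] q'_zero[OF assms] by blast
  show "q' p p = ?q" by (rule q'_p)
  fix s assume s: "s < ?c"
  have "?q ^ s * ?Q' \<noteq> 1"
  proof
    assume "?q ^ s * ?Q' = 1"
    then have *: "?Q * ?q ^ ?c * ?q ^ ?c = ?q ^ s"
      unfolding q'_prod[OF assms] by (simp add: field_simps)
    consider "?q ^ ?c * ?Q = 1" | "qnum ?q (Suc ?c) = 0" using mcartan_zero[OF assms] by blast
    then show False
    proof cases
      case 1
      then have "?q ^ ?c = ?q ^ s" using * by (simp add: mult.commute)
      then show False using 1 mcartan_minimal(2)[OF s] by simp
    next
      case 2
      then have r: "?q ^ Suc ?c = 1" using qnum_root[of ?q "Suc ?c"] by simp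
      define t where "t = ?c - 1 - s"
      have t: "t < ?c" "?c = t + Suc s" using s by (auto simp: t_def)
      have "?q ^ ?c = ?q ^ t * ?q ^ Suc s" by (metis t(2) power_add)
      then have "?q ^ t * ?Q * ?q ^ Suc s = ?Q * ?q ^ ?c * ?q ^ Suc ?c"
        unfolding r by (simp add: mult_ac)
      also have "\<dots> = ?q ^ Suc s" using * by (simp add: mult_ac)
      finally have "?q ^ t * ?Q = 1" by simp
      then show False using mcartan_minimal(2)[OF t(1)] by simp
    qed
  qed
  then show "qnum ?q (Suc s) \<noteq> 0 \<and> ?q ^ s * ?Q' \<noteq> 1"
    using mcartan_minimal(1)[OF s] by simp
qed

lemma reflect_matrix: "cartan_matrix q' p"
proof
  show "mfinite q' p"
    unfolding mfinite_def q'_p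
  proof (intro allI impI)
    fix i assume i: "i \<noteq> p"
    then have "qnum (q p p) (c i + 1) * (q p p ^ c i * q' p i * q' i p - 1) = 0"
      using mcartan_zero[OF i] q'_zero[OF i] by (auto simp: mult.assoc)
    then show "\<exists>m. qnum (q p p) (m + 1) * (q p p ^ m * q' p i * q' i p - 1) = 0" ..
  qed
qed (rule q'_nz)

lemma mreflect_reflect: "mreflect p (mcartan q' p) q' = q"
proof (intro ext)
  fix a b
  have nzp [simp]: "q i j ^ n \<noteq> 0" for i j n by simp
  consider "a = p" "b = p" | "a = p" "b \<noteq> p" | "a \<noteq> p" "b = p" | "a \<noteq> p" "b \<noteq> p" by blast
  then show "mreflect p (mcartan q' p) q' a b = q a b"
  proof cases
    case 1 then show ?thesis by (simp add: mreflect_def)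
  next
    case 2
    then have "mreflect p (mcartan q' p) q' a b = inverse (inverse (q p b * q p p ^ c b) * q p p ^ c b)"
      using mcartan_reflect[of b] by (simp add: mreflect_def)
    then show ?thesis using 2 by simp
  next
    case 3
    then have "mreflect p (mcartan q' p) q' a b = inverse (inverse (q a p * q p p ^ c a) * q p p ^ c a)"
      using mcartan_reflect[of a] by (simp add: mreflect_def)
    then show ?thesis using 3 by simp
  next
    case 4
    let ?x = "q a p" and ?y = "q p b" and ?z = "q p p"
    have "mreflect p (mcartan q' p) q' a b = q a b * ?x ^ c b * (?y * ?z ^ c b) ^ c a
       * inverse (?x * ?z ^ c a) ^ c b * (inverse (?y * ?z ^ c b) * ?z ^ c b) ^ c a"
      using 4 mcartan_reflect[of a] mcartan_reflect[of b] by (simp add: mreflect_def)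
    also have "\<dots> = q a b * (?x * inverse ?x) ^ c b
        * (?y * ?z ^ c b * inverse (?y * ?z ^ c b)) ^ c a * (inverse (?z ^ c a) ^ c b * (?z ^ c b) ^ c a)"
      by (simp only: power_mult_distrib inverse_mult_distrib mult_ac)
    also have "inverse (?z ^ c a) ^ c b * (?z ^ c b) ^ c a = 1"
      by (simp add: power_inverse mult.commute flip: power_mult)
    also have "?y * ?z ^ c b * inverse (?y * ?z ^ c b) = 1"
      by (rule right_inverse) simp
    finally have "mreflect p (mcartan q' p) q' a b = q a b" by simp
    then show ?thesis .
  qed
qed

lemma minverse_condition:
  "qnum (inverse (q p p)) n * (inverse (q p p) ^ m * inverse (q p i) * inverse (q i p) - 1) = 0
    \<longleftrightarrow> qnum (q p p) n * (q p p ^ m * q p i * q i p - 1) = 0"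
proof -
  have "inverse (q p p) ^ m * inverse (q p i) * inverse (q i p) = inverse (q p p ^ m * q p i * q i p)"
    by (simp add: power_inverse)
  then show ?thesis
    using inverse_eq_1_iff[of "q p p ^ m * q p i * q i p"]
    by (simp only: mult_eq_0_iff qnum_inverse_eq_0_iff[OF nz] right_minus_eq)
qed

lemma mcartan_inverse: "mcartan (minverse q) p = c"
  by (rule ext) (simp only: mcartan_def minverse_condition)

lemma inverse_matrix: "cartan_matrix (minverse q) p"
  using mfinite by unfold_locales (simp_all only: mfinite_def minverse_condition, simp)

lemma mcartan_transpose: "mcartan (mtranspose q) p = c"
  by (rule ext) (simp add: mcartan_def mult_ac)

lemma transpose_matrix: "cartan_matrix (mtranspose q) p"
  using mfinite by unfold_locales (simp_all add: mfinite_def mult_ac)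

lemma mlambda_transpose: "mlambda (mtranspose q) p i = mlambda q p i"
  by (simp add: mlambda_def mcartan_transpose mult.commute)

lemma mreflect_inverse: "mreflect p c (minverse q) = minverse q'"
  by (intro ext) (simp add: mreflect_def power_inverse power_mult_distrib)

lemma mreflect_transpose: "mreflect p c (mtranspose q) = mtranspose q'"
  by (intro ext) (simp add: mreflect_def power_mult_distrib power_mult[symmetric] mult_ac)

text \<open>
  The scalar by which $T_p$ after $T_p^-$ could differ from the identity on $E_i$. If $q^c Q = 1$, the
  factors with index $s$ differ by $-q^{c-s}$. Otherwise $q^{c+1} = 1$, the factors agree in reverse order,
  and the remaining power of $q$ is evaluated by \<open>root_prod_powers\<close>.
\<close>

lemma mlambda_inverse_reflect:
  assumes "i \<noteq> p"
  shows "mlambda (minverse q') p i = (- q p p) ^ c i * mlambda q p i"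
proof -
  let ?q = "q p p" and ?Q = "q p i * q i p" and ?c = "c i"
  interpret r: cartan_matrix q' p by (rule reflect_matrix)
  let ?P = "\<Prod>s<?c. ?q ^ s"
  have Pnz: "?P \<noteq> 0" by simp
  have Q': "inverse (q' p i) * inverse (q' i p) = ?Q * ?q ^ ?c * ?q ^ ?c"
    using q'_prod[OF assms] by (simp flip: inverse_mult_distrib)
  \<comment> \<open>\<open>?P\<close> is the power of \<open>q\<close> by which the q-factorials for \<open>q\<close> and its inverse differ\<close>
  have fact: "?P * (\<Prod>s<?c. qnum (inverse ?q) (Suc s)) = (\<Prod>s<?c. qnum ?q (Suc s))"
    by (simp add: prod.distrib[symmetric] qnum_inverse)
  have "mlambda (minverse q') p i
    = (\<Prod>s<?c. qnum (inverse ?q) (Suc s) * (inverse ?q ^ s * (?Q * ?q ^ ?c * ?q ^ ?c) - 1))"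
    by (simp add: mlambda_def r.mcartan_inverse mcartan_reflect[OF assms] acoef_def q'_p Q')
  also have "\<dots> = (\<Prod>s<?c. qnum (inverse ?q) (Suc s))
      * (\<Prod>s<?c. inverse ?q ^ s * (?Q * ?q ^ ?c * ?q ^ ?c) - 1)"
    by (rule prod.distrib)
  finally have "?P * mlambda (minverse q') p i = (\<Prod>s<?c. qnum ?q (Suc s))
      * (\<Prod>s<?c. inverse ?q ^ s * (?Q * ?q ^ ?c * ?q ^ ?c) - 1)"
    by (simp add: fact[symmetric] mult_ac)
  also have "(\<Prod>s<?c. inverse ?q ^ s * (?Q * ?q ^ ?c * ?q ^ ?c) - 1)
      = ?P * (- ?q) ^ ?c * (\<Prod>s<?c. ?q ^ s * ?Q - 1)"
  proof (cases "?q ^ ?c * ?Q = 1")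
    case True
    then have Q: "?Q = inverse (?q ^ ?c)" by (simp add: field_simps)
    have "inverse ?q ^ s * (?Q * ?q ^ ?c * ?q ^ ?c) - 1
        = - (?q ^ (?c - s)) * (?q ^ s * ?Q - 1)" if "s < ?c" for s
    proof -
      have c: "?q ^ ?c = ?q ^ (?c - s) * ?q ^ s" using that by (simp flip: power_add)
      show ?thesis unfolding Q by (simp add: c field_simps)
    qed
    then have "(\<Prod>s<?c. inverse ?q ^ s * (?Q * ?q ^ ?c * ?q ^ ?c) - 1)
      = (\<Prod>s<?c. - (?q ^ (?c - s))) * (\<Prod>s<?c. ?q ^ s * ?Q - 1)"
      by (simp add: prod.distrib[symmetric])
    also have "(\<Prod>s<?c. - (?q ^ (?c - s))) = (\<Prod>s<?c. - ?q * ?q ^ (?c - Suc s))"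
      by (intro prod.cong) (auto simp: Suc_diff_Suc simp flip: power_Suc)
    also have "\<dots> = (- ?q) ^ ?c * (\<Prod>s<?c. ?q ^ (?c - Suc s))"
      by (simp add: prod.distrib del: mult_minus_left)
    also have "(\<Prod>s<?c. ?q ^ (?c - Suc s)) = ?P"
      by (rule prod.nat_diff_reindex)
    finally show ?thesis by (simp add: mult_ac)
  next
    case False
    then have r0: "qnum ?q (Suc ?c) = 0" using mcartan_zero[OF assms] by blast
    then have r: "?q * ?q ^ ?c = 1" using qnum_root[of ?q "Suc ?c"] by simp
    have min: "qnum ?q m \<noteq> 0" if "0 < m" "m < Suc ?c" for m
      using mcartan_minimal(1)[of "m - 1" i] that by auto
    have "(- 1) ^ Suc ?c * (\<Prod>s<Suc ?c. ?q ^ s) = - 1"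
      using root_prod_powers[OF r0 min] by simp
    then have "- (?P * (- ?q) ^ ?c) = - 1"
      by (simp add: power_minus[of ?q] mult_ac)
    then have one: "?P * (- ?q) ^ ?c = 1" by simp
    have "inverse ?q ^ s * (?Q * ?q ^ ?c * ?q ^ ?c) = ?q ^ (?c - Suc s) * ?Q" if "s < ?c" for s
    proof -
      have c: "?q ^ ?c = ?q ^ (?c - Suc s) * ?q ^ s * ?q"
        using that by (simp flip: power_add power_Suc2)
      have "inverse ?q ^ s * (?Q * ?q ^ ?c * ?q ^ ?c)
        = (inverse ?q ^ s * ?q ^ s) * (?q * ?q ^ ?c) * ?q ^ (?c - Suc s) * ?Q"
        by (subst (2) c) (simp only: mult_ac)
      then show ?thesis unfolding r by (simp add: power_inverse)
    qed
    then have "(\<Prod>s<?c. inverse ?q ^ s * (?Q * ?q ^ ?c * ?q ^ ?c) - 1)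
      = (\<Prod>s<?c. ?q ^ (?c - Suc s) * ?Q - 1)"
      by (intro prod.cong refl) (simp only: lessThan_iff)
    also have "\<dots> = (\<Prod>s<?c. ?q ^ s * ?Q - 1)"
      by (rule prod.nat_diff_reindex)
    finally show ?thesis using one by simp
  qed
  also have "(\<Prod>s<?c. qnum ?q (Suc s)) * (?P * (- ?q) ^ ?c * (\<Prod>s<?c. ?q ^ s * ?Q - 1))
      = ?P * ((- ?q) ^ ?c * mlambda q p i)"
    by (simp add: mlambda_def acoef_def prod.distrib mult_ac)
  finally show ?thesis using Pnz by simp
qed

end


section \<open>The Lusztig maps on generators\<close>

text \<open>
  The operations on valuations that correspond to $\phi_2$, $\phi_3$, $\varphi_a$, $T_p$ and $T_p^-$: if \<open>v\<close> gives the
  images of the generators under a map $f$, then \<open>twist2 v\<close> gives those under $f \circ \phi_2$, and so on. In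
  particular composites of maps turn into composites of operations in the opposite order. In \<open>T_val\<close>
  and \<open>Tminus_val\<close> the parameters \<open>c\<close> and \<open>lam\<close> are $-c_{pi}$ and the normalising scalars.
\<close>

primrec twist2 :: "('i gen \<Rightarrow> 'r::ring_1) \<Rightarrow> 'i gen \<Rightarrow> 'r" where
  "twist2 v (gK i) = v (gK i)"
| "twist2 v (gKi i) = v (gKi i)"
| "twist2 v (gL i) = v (gL i)"
| "twist2 v (gLi i) = v (gLi i)"
| "twist2 v (gE i) = v (gF i)"
| "twist2 v (gF i) = - v (gE i)"

primrec twist3 :: "('i gen \<Rightarrow> 'r) \<Rightarrow> 'i gen \<Rightarrow> 'r" where
  "twist3 v (gK i) = v (gL i)"
| "twist3 v (gKi i) = v (gLi i)"
| "twist3 v (gL i) = v (gK i)"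
| "twist3 v (gLi i) = v (gKi i)"
| "twist3 v (gE i) = v (gF i)"
| "twist3 v (gF i) = v (gE i)"

primrec diag :: "('k::field \<Rightarrow> 'r \<Rightarrow> 'r) \<Rightarrow> ('i \<Rightarrow> 'k) \<Rightarrow> ('i gen \<Rightarrow> 'r::ring_1) \<Rightarrow> 'i gen \<Rightarrow> 'r" where
  "diag sc a v (gK i) = v (gK i)"
| "diag sc a v (gKi i) = v (gKi i)"
| "diag sc a v (gL i) = v (gL i)"
| "diag sc a v (gLi i) = v (gLi i)"
| "diag sc a v (gE i) = sc (a i) (v (gE i))"
| "diag sc a v (gF i) = sc (inverse (a i)) (v (gF i))"

primrec T_val :: "('k::field \<Rightarrow> 'r \<Rightarrow> 'r) \<Rightarrow> 'i \<Rightarrow> ('i \<Rightarrow> nat) \<Rightarrow> ('i \<Rightarrow> 'k)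
    \<Rightarrow> ('i gen \<Rightarrow> 'r::ring_1) \<Rightarrow> 'i gen \<Rightarrow> 'r" where
  "T_val sc p c lam v (gK i) = (if i = p then v (gKi p) else v (gK i) * v (gK p) ^ c i)"
| "T_val sc p c lam v (gKi i) = (if i = p then v (gK p) else v (gKi i) * v (gKi p) ^ c i)"
| "T_val sc p c lam v (gL i) = (if i = p then v (gLi p) else v (gL i) * v (gL p) ^ c i)"
| "T_val sc p c lam v (gLi i) = (if i = p then v (gL p) else v (gLi i) * v (gLi p) ^ c i)"
| "T_val sc p c lam v (gE i) = (if i = p then v (gF p) * v (gLi p)
     else qad (v (gK p)) (v (gKi p)) (v (gE p)) (v (gE i)) (c i))"
| "T_val sc p c lam v (gF i) = (if i = p then v (gKi p) * v (gE p)
     else sc (inverse (lam i)) (qad (v (gL p)) (v (gLi p)) (v (gF p)) (v (gF i)) (c i)))"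

primrec Tminus_val :: "('k::field \<Rightarrow> 'r \<Rightarrow> 'r) \<Rightarrow> 'i \<Rightarrow> ('i \<Rightarrow> nat) \<Rightarrow> ('i \<Rightarrow> 'k)
    \<Rightarrow> ('i gen \<Rightarrow> 'r::ring_1) \<Rightarrow> 'i gen \<Rightarrow> 'r" where
  "Tminus_val sc p c lam v (gK i) = (if i = p then v (gKi p) else v (gK i) * v (gK p) ^ c i)"
| "Tminus_val sc p c lam v (gKi i) = (if i = p then v (gK p) else v (gKi i) * v (gKi p) ^ c i)"
| "Tminus_val sc p c lam v (gL i) = (if i = p then v (gLi p) else v (gL i) * v (gL p) ^ c i)"
| "Tminus_val sc p c lam v (gLi i) = (if i = p then v (gL p) else v (gLi i) * v (gLi p) ^ c i)"
| "Tminus_val sc p c lam v (gE i) = (if i = p then v (gKi p) * v (gF p)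
     else sc (inverse (lam i)) (qad (v (gL p)) (v (gLi p)) (v (gE p)) (v (gE i)) (c i)))"
| "Tminus_val sc p c lam v (gF i) = (if i = p then v (gE p) * v (gLi p)
     else sc ((- 1) ^ c i) (qad (v (gK p)) (v (gKi p)) (v (gF p)) (v (gF i)) (c i)))"

context algebra_over
begin

lemma qad_scale: "qad k ki (a \<cdot> e) (b \<cdot> x) m = (b * a ^ m) \<cdot> qad k ki e x m"
  by (induction m) (simp_all add: scale_simps scale_distribs mult_ac)

lemma qad_minus: "qad k ki (- e) (- x) m = (- 1) ^ Suc m \<cdot> qad k ki e x m"
  using qad_scale[of k ki "- 1" e "- 1" x m] by simp

lemma diag_diag: "diag scale a (diag scale b v) = diag scale (\<lambda>i. a i * b i) v"
  by (rule ext, case_tac x) (simp_all add: mult.commute)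

lemma twist2_diag: "twist2 (diag scale a v) = diag scale (\<lambda>i. inverse (a i)) (twist2 v)"
  by (rule ext, case_tac x) (simp_all add: scale_minus_right)

text \<open>
  $T_p(E_i)$ is homogeneous of degree $\alpha_i + c\,\alpha_p$ and $T_p(E_p)$ of degree $-\alpha_p$, so rescaling by \<open>b\<close>
  rescales the images by \<open>a\<close>.
\<close>

lemma T_val_diag:
  assumes "\<And>i. b i = a i * (if i = p then inverse (a p * a p) else a p ^ c i)" "a p \<noteq> 0"
  shows "T_val scale p c lam (diag scale b v) = diag scale a (T_val scale p c lam v)"
proof
  fix x
  have bp: "b p = inverse (a p)" using assms by (simp add: field_simps)
  have bi: "b i * b p ^ c i = a i" if "i \<noteq> p" for i
    using that assms(2) by (simp add: assms(1)[of i] bp power_inverse)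
  show "T_val scale p c lam (diag scale b v) x = diag scale a (T_val scale p c lam v) x"
  proof (cases x)
    case (gF i)
    have "inverse (b i) * inverse (b p) ^ c i = inverse (a i)" if "i \<noteq> p"
      using bi[OF that] by (simp add: power_inverse flip: inverse_mult_distrib)
    then show ?thesis using gF by (auto simp: bp qad_scale scale_simps mult_ac)
  qed (use bi in \<open>auto simp: bp qad_scale scale_simps\<close>)
qed

text \<open>
  $T_p^-$ is $T_p$ conjugated by $\phi_2$, up to the signs produced by the minus sign in $\phi_2(F_j) = -E_j$.
  This transfers every fact about \<open>T_val\<close> to \<open>Tminus_val\<close>.
\<close>

lemma Tminus_val_T_val:
  "Tminus_val scale p c lam v
    = diag scale (\<lambda>i. if i = p then 1 else (- 1) ^ Suc (c i)) (twist2 (T_val scale p c lam (twist2 v)))"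
proof
  fix x
  have sign: "inverse ((- 1) ^ n) = ((- 1) ^ n :: 'k)" for n
    by (simp flip: power_inverse)
  have sign2: "(- 1) ^ n * (a * (- 1) ^ n) = (a :: 'k)" for n a
    by (cases "even n") simp_all
  show "Tminus_val scale p c lam v x = diag scale (\<lambda>i. if i = p then 1 else (- 1) ^ Suc (c i))
      (twist2 (T_val scale p c lam (twist2 v))) x"
    by (cases x)
      (simp_all add: qad_minus sign sign2 scale_mult_left del: power_Suc, simp_all)
qed

end

context U_rep
begin

lemma diag_rep:
  assumes "\<And>i. a i \<noteq> 0"
  shows "U_rep scale q (diag scale a v)"
proof unfold_locales
  fix x y :: "'i gen" and i j
  show "x \<in> cartan_gens \<Longrightarrow> y \<in> cartan_gens \<Longrightarrow>
      diag scale a v x * diag scale a v y = diag scale a v y * diag scale a v x"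
    using cartan_comm[of x y] by (auto simp: cartan_gens_def)
  show "diag scale a v (gE i) * diag scale a v (gF j) - diag scale a v (gF j) * diag scale a v (gE i)
    = (if i = j then diag scale a v (gK i) - diag scale a v (gL i) else 0)"
    using EF[of i j] assms
    by (auto simp: scale_simps mult.commute simp flip: scale_right_diff_distrib)
qed (use q_nz KE LE KF LF K_Ki L_Li in \<open>auto intro: qcm_scale_right\<close>)

lemma twist2_rep: "U_rep scale (minverse q) (twist2 v)"
proof unfold_locales
  fix x y :: "'i gen" and i j
  show "x \<in> cartan_gens \<Longrightarrow> y \<in> cartan_gens \<Longrightarrow> twist2 v x * twist2 v y = twist2 v y * twist2 v x"
    using cartan_comm[of x y] by (auto simp: cartan_gens_def)
  show "twist2 v (gE i) * twist2 v (gF j) - twist2 v (gF j) * twist2 v (gE i)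
    = (if i = j then twist2 v (gK i) - twist2 v (gL i) else 0)"
    using EF[of j i] by auto
qed (use q_nz KE LE KF LF K_Ki L_Li in \<open>auto intro: qcm_minus_right\<close>)

lemma twist3_rep: "U_rep scale (mtranspose q) (twist3 v)"
proof unfold_locales
  fix x y :: "'i gen" and i j
  show "x \<in> cartan_gens \<Longrightarrow> y \<in> cartan_gens \<Longrightarrow> twist3 v x * twist3 v y = twist3 v y * twist3 v x"
    using cartan_comm by (auto simp: cartan_gens_def)
  show "twist3 v (gE i) * twist3 v (gF j) - twist3 v (gF j) * twist3 v (gE i)
    = (if i = j then twist3 v (gK i) - twist3 v (gL i) else 0)"
    using EF[of j i] by (auto simp: algebra_simps)
qed (use q_nz KE LE KF LF K_Ki L_Li in auto)

end

lemma inverse_pair_mult: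
  fixes a b :: "'r::monoid_mult"
  assumes "a * b = 1" "c * d = 1" "c * b = b * c"
  shows "(a * c) * (b * d) = 1"
  by (metis assms mult.assoc mult_1_right)

text \<open>
  A valuation of the target of $T_p$ in which the Serre elements vanish. The matrix \<open>q\<close> belongs to the
  target, \<open>mreflect p c q\<close> to the source.
\<close>

locale U_T_val = U_rep scale q v
  for scale :: "'k::field \<Rightarrow> 'r::ring_1 \<Rightarrow> 'r" (infixr "\<cdot>" 75) and q :: "'i \<Rightarrow> 'i \<Rightarrow> 'k" and v +
  fixes p :: 'i and c :: "'i \<Rightarrow> nat" and lam :: "'i \<Rightarrow> 'k"
  assumes XE0: "i \<noteq> p \<Longrightarrow> XE p i (Suc (c i)) = 0"
    and XF0: "i \<noteq> p \<Longrightarrow> XF p i (Suc (c i)) = 0"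
    and lam: "i \<noteq> p \<Longrightarrow> lam i = acprod p i (c i)"
    and lam_nz: "i \<noteq> p \<Longrightarrow> lam i \<noteq> 0"
begin

abbreviation "t \<equiv> T_val scale p c lam v"
abbreviation "q' \<equiv> mreflect p c q"

lemma t_E: "t (gE i) = (if i = p then F p * Li p else XE p i (c i))"
  and t_F: "t (gF i) = (if i = p then Ki p * E p else inverse (lam i) \<cdot> XF p i (c i))"
  by (simp_all add: qad_XE qad_XF)

lemma t_K_weight:
  assumes "\<And>j. qcm (u j) (K j) x" "u p \<noteq> 0"
  shows "qcm (if i = p then inverse (u p) else u i * u p ^ c i) (t (gK i)) x"
  using assms qcm_inverse_left[OF assms(1)[of p] assms(2) K_Ki Ki_K]
  by (auto intro!: qcm_mult_left qcm_power_left)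

lemma t_L_weight:
  assumes "\<And>j. qcm (u j) (L j) x" "u p \<noteq> 0"
  shows "qcm (if i = p then inverse (u p) else u i * u p ^ c i) (t (gL i)) x"
  using assms qcm_inverse_left[OF assms(1)[of p] assms(2) L_Li Li_L]
  by (auto intro!: qcm_mult_left qcm_power_left)

lemma cartan_qcm: "x \<in> cartan_gens \<Longrightarrow> y \<in> cartan_gens \<Longrightarrow> qcm 1 (v x) (v y)"
  using cartan_comm[of x y] by (simp add: qcm_def)

lemma K_t_E: "qcm (if i = p then inverse (q j p) else q j i * q j p ^ c i) (K j) (t (gE i))"
  using K_XE qcm_mult_right[OF KF[of j p] cartan_qcm[of "gK j" "gLi p"]] by (simp add: qad_XE)

lemma L_t_E: "qcm (if i = p then q p j else inverse (q i j * q p j ^ c i)) (L j) (t (gE i))"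
  using L_XE[of i j p "c i"] qcm_mult_right[OF LF[of p j] cartan_qcm[of "gL j" "gLi p"]]
  by (simp add: qad_XE power_inverse)

lemma K_t_F: "qcm (if i = p then q j p else inverse (q j i * q j p ^ c i)) (K j) (t (gF i))"
  using K_XF[of j i p "c i"] qcm_mult_right[OF cartan_qcm[of "gK j" "gKi p"] KE[of j p]]
  by (simp add: qad_XF power_inverse qcm_scale_right)

lemma L_t_F: "qcm (if i = p then inverse (q p j) else q i j * q p j ^ c i) (L j) (t (gF i))"
  using L_XF[of i j p "c i"] qcm_mult_right[OF cartan_qcm[of "gL j" "gKi p"] LE[of p j]]
  by (simp add: qad_XF qcm_scale_right)

lemma t_cartan_comm:
  assumes "x \<in> cartan_gens" "y \<in> cartan_gens"
  shows "t x * t y = t y * t x"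
proof -
  have A: "qcm 1 (v z) (t y)" if z: "z \<in> cartan_gens" for z
  proof -
    have m: "qcm 1 (v z) (v g * v h ^ n)" if "g \<in> cartan_gens" "h \<in> cartan_gens" for g h n
      using qcm_mult_right[OF cartan_qcm[OF z that(1)] qcm_power_right[OF cartan_qcm[OF z that(2)]]]
      by simp
    from assms(2) show ?thesis
      by (auto simp: cartan_gens_def intro!: cartan_qcm z m[unfolded cartan_gens_def])
  qed
  have m: "qcm 1 (v g * v h ^ n) (t y)" if "g \<in> cartan_gens" "h \<in> cartan_gens" for g h n
    using qcm_mult_left[OF A[OF that(1)] qcm_power_left[OF A[OF that(2)]]]
    by simp
  from assms(1) have "qcm 1 (t x) (t y)"
    unfolding cartan_gens_def by (elim UnE rangeE) (simp_all add: A m del: T_val.simps, simp_all add: A m)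
  then show ?thesis by (simp add: qcm_def)
qed

text \<open>
  These four facts move the Cartan part of $T_p(E_p)$, $T_p(F_p)$ past a root vector; the scalar
  converts between ordinary commutators and q-commutators.
\<close>

lemma F_Li_XE:
  assumes "i \<noteq> p"
  shows "F p * Li p * XE p i m = (q i p * q p p ^ m) \<cdot> (F p * XE p i m * Li p)"
proof -
  have "qcm (q i p * q p p ^ m) (Li p) (XE p i m)"
    using qcm_inverse_left[OF L_XE[of i p p m] _ L_Li Li_L] q_nz by (simp add: power_inverse)
  from qcmD[OF this] show ?thesis by (simp add: mult.assoc scale_simps)
qed

lemma F_Li_XF:
  assumes "i \<noteq> p"
  shows "F p * Li p * XF p i m = inverse (q i p * q p p ^ m) \<cdot> (F p * XF p i m * Li p)"
proof -
  have "qcm (inverse (q i p * q p p ^ m)) (Li p) (XF p i m)"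
    using qcm_inverse_left[OF L_XF[of i p p m] _ L_Li Li_L] q_nz by simp
  from qcmD[OF this] show ?thesis by (simp add: mult.assoc scale_simps)
qed

lemma XE_Ki_E:
  assumes "i \<noteq> p"
  shows "XE p i m * (Ki p * E p) = (q p i * q p p ^ m) \<cdot> (Ki p * (XE p i m * E p))"
proof -
  have "qcm (inverse (q p i * q p p ^ m)) (Ki p) (XE p i m)"
    using qcm_inverse_left[OF K_XE[of p i p m] _ K_Ki Ki_K] q_nz by simp
  from qcmD2[OF qcm_sym[OF this], of "E p"] show ?thesis using q_nz by simp
qed

lemma XF_Ki_E:
  assumes "i \<noteq> p"
  shows "(q p i * q p p ^ m) \<cdot> (XF p i m * (Ki p * E p)) = Ki p * (XF p i m * E p)"
proof -
  have "qcm (q p i * q p p ^ m) (Ki p) (XF p i m)"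
    using qcm_inverse_left[OF K_XF[of p i p m] _ K_Ki Ki_K] q_nz by (simp add: power_inverse)
  from qcmD2[OF this, of "E p"] show ?thesis by simp
qed

lemma t_EF: "t (gE i) * t (gF j) - t (gF j) * t (gE i) = (if i = j then t (gK i) - t (gL i) else 0)"
proof -
  consider "i = p" "j = p" | "i = p" "j \<noteq> p" | "i \<noteq> p" "j = p" | "i \<noteq> p" "j \<noteq> p" by blast
  then show ?thesis
  proof cases
    case 1
    have Ki_E: "qcm (inverse (q p p)) (Ki p) (E p)"
      by (rule qcm_inverse_left[OF KE q_nz K_Ki Ki_K])
    have Li_E: "qcm (q p p) (Li p) (E p)"
      using qcm_inverse_left[OF LE _ L_Li Li_L, of p p] q_nz by simp
    have Ki_F: "qcm (q p p) (Ki p) (F p)"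
      using qcm_inverse_left[OF KF _ K_Ki Ki_K, of p p] q_nz by simp
    have KL: "Ki p * Li p = Li p * Ki p" by (simp add: cartan_comm)
    have "F p * Li p * (Ki p * E p) = F p * E p * (Li p * Ki p)"
      using q_nz by (simp add: mult.assoc qcmD[OF Ki_E] scale_simps qcmD2[OF Li_E])
    moreover have "Ki p * E p * (F p * Li p) = E p * F p * (Ki p * Li p)"
      using q_nz by (simp add: mult.assoc qcmD2[OF Ki_E] qcmD2[OF Ki_F] scale_simps)
    ultimately have "t (gE p) * t (gF p) - t (gF p) * t (gE p) = (F p * E p - E p * F p) * (Ki p * Li p)"
      by (simp add: qad_XE qad_XF left_diff_distrib KL)
    also have "\<dots> = L p * Li p * Ki p - K p * Ki p * Li p"
      by (simp only: FE_same add_diff_cancel_left' left_diff_distrib) (simp add: mult.assoc KL)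
    finally show ?thesis using 1 by (simp add: K_Ki L_Li)
  next
    case 2
    let ?d = "q j p * q p p ^ c j"
    have d: "inverse (q j p) * (inverse (q p p ^ c j) * (q j p * q p p ^ c j)) = 1"
      using q_nz by (simp add: field_simps)
    have "F p * Li p * XF p j (c j) - XF p j (c j) * (F p * Li p)
      = inverse ?d \<cdot> ((F p * XF p j (c j) - ?d \<cdot> (XF p j (c j) * F p)) * Li p)"
      using F_Li_XF[OF 2(2)] by (simp add: d left_diff_distrib scale_simps scale_distribs mult.assoc)
    also have "\<dots> = 0" using XF0[OF 2(2)] by simp
    finally show ?thesis using 2 by (simp add: qad_XE qad_XF scale_simps flip: scale_right_diff_distrib)
  next
    case 3
    have "XE p i (c i) * (Ki p * E p) - Ki p * E p * XE p i (c i) = - (Ki p * XE p i (Suc (c i)))"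
      using XE_Ki_E[OF 3(1)] by (simp add: right_diff_distrib scale_simps mult.assoc)
    also have "\<dots> = 0" using XE0[OF 3(1)] by simp
    finally show ?thesis using 3 by (simp add: qad_XE qad_XF)
  next
    case 4
    then have "t (gE i) * t (gF j) - t (gF j) * t (gE i)
      = inverse (lam j) \<cdot> (XE p i (c i) * XF p j (c j) - XF p j (c j) * XE p i (c i))"
      by (simp add: qad_XE qad_XF scale_simps scale_distribs)
    then show ?thesis using 4 XE_XF_diff[of i p j] XE_XF_top[of i p] lam[of i] lam_nz[of i]
      by auto
  qed
qed

text \<open>
  $T_p$ is well defined: the weights are those of the reflected matrix by construction, and the
  commutators are \<open>t_EF\<close>.
\<close>

lemma T_val_rep: "U_rep scale q' t"
proof unfold_locales
  fix x y :: "'i gen" and i j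
  show "q' i j \<noteq> 0" using q_nz by (simp add: mreflect_def)
  show "x \<in> cartan_gens \<Longrightarrow> y \<in> cartan_gens \<Longrightarrow> t x * t y = t y * t x"
    by (rule t_cartan_comm)
  show "t (gK i) * t (gKi i) = 1"
    using K_Ki Ki_K left_right_inverse_power[OF K_Ki] cartan_comm[of "gK p" "gKi i"]
    by (auto intro!: inverse_pair_mult power_commuting_commutes)
  show "t (gL i) * t (gLi i) = 1"
    using L_Li Li_L left_right_inverse_power[OF L_Li] cartan_comm[of "gL p" "gLi i"]
    by (auto intro!: inverse_pair_mult power_commuting_commutes)
  show "t (gE i) * t (gF j) - t (gF j) * t (gE i) = (if i = j then t (gK i) - t (gL i) else 0)"
    by (rule t_EF)
  show "qcm (q' i j) (t (gK i)) (t (gE j))"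
    by (rule back_subst[where P = "\<lambda>u. qcm u _ _", OF t_K_weight[OF K_t_E]])
      (use q_nz in \<open>auto simp: mreflect_def power_inverse power_mult_distrib mult_ac simp flip: power_mult\<close>)
  show "qcm (inverse (q' j i)) (t (gL i)) (t (gE j))"
    by (rule back_subst[where P = "\<lambda>u. qcm u _ _", OF t_L_weight[OF L_t_E]])
      (use q_nz in \<open>auto simp: mreflect_def power_inverse power_mult_distrib mult_ac simp flip: power_mult\<close>)
  show "qcm (inverse (q' i j)) (t (gK i)) (t (gF j))"
    by (rule back_subst[where P = "\<lambda>u. qcm u _ _", OF t_K_weight[OF K_t_F]])
      (use q_nz in \<open>auto simp: mreflect_def power_inverse power_mult_distrib mult_ac simp flip: power_mult\<close>)
  show "qcm (q' j i) (t (gL i)) (t (gF j))"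
    by (rule back_subst[where P = "\<lambda>u. qcm u _ _", OF t_L_weight[OF L_t_F]])
      (use q_nz in \<open>auto simp: mreflect_def power_inverse power_mult_distrib mult_ac simp flip: power_mult\<close>)
qed

end


section \<open>Compatibility with the Serre relations\<close>

context U_T_val
begin

abbreviation "ac i \<equiv> acoef (q p p) (q p i * q i p)"

lemma ac_prod_rev: "(\<Prod>s<m. ac i (m - s)) = acprod p i m"
proof -
  have "(\<Prod>s<m. ac i (m - s)) = (\<Prod>s<m. ac i (Suc (m - Suc s)))"
    by (intro prod.cong refl) (simp add: Suc_diff_Suc)
  also have "\<dots> = acprod p i m" by (rule prod.nat_diff_reindex)
  finally show ?thesis .
qed

text \<open>
  Commuting with $T_p(E_p) = F_p L_p^{-1}$ lowers the index of $E^+$: after moving $L_p^{-1}$ to the right, the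
  q-commutator of $T_p(E_p)$ with $E^+_{i,m+1}$ is the plain commutator of $F_p$ with $E^+_{i,m+1}$.
\<close>

lemma t_qcom_E:
  assumes i: "i \<noteq> p" and "k \<le> c i"
  shows "qcom (t (gE p)) (q i p * q p p ^ c i) (inverse (q p p)) (t (gE i)) k
    = ((- q p p) ^ k * (\<Prod>s<k. ac i (c i - s))) \<cdot> XE p i (c i - k)"
  using assms(2)
proof (induction k)
  case 0 then show ?case using i by (simp add: qad_XE)
next
  case (Suc k)
  let ?q = "q p p"
  define m where "m = c i - Suc k"
  have cm: "c i - k = Suc m" "c i = Suc m + k" using Suc.prems by (auto simp: m_def)
  let ?a = "(- ?q) ^ k * (\<Prod>s<k. ac i (c i - s))" and ?d = "q i p * ?q ^ Suc m"
  have d: "q i p * ?q ^ c i * inverse ?q ^ k = ?d"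
    using q_nz unfolding cm(2) by (simp add: power_add power_inverse)
  have L: "L p * XE p i m * Li p = (inverse (q i p) * inverse ?q ^ m) \<cdot> XE p i m"
    by (rule qcm_conj[OF L_XE L_Li])
  have "qcom (t (gE p)) (q i p * ?q ^ c i) (inverse ?q) (t (gE i)) (Suc k)
    = F p * Li p * (?a \<cdot> XE p i (Suc m)) - ?d \<cdot> (?a \<cdot> XE p i (Suc m) * (F p * Li p))"
    using Suc by (simp add: cm(1) d del: T_val.simps) (simp add: t_E del: T_val.simps)
  also have "\<dots> = (?a * ?d) \<cdot> ((F p * XE p i (Suc m) - XE p i (Suc m) * F p) * Li p)"
    using F_Li_XE[OF i, of "Suc m"]
    by (simp add: scale_simps scale_distribs left_diff_distrib mult.assoc mult_ac del: qcom.simps power_Suc)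
  also have "F p * XE p i (Suc m) - XE p i (Suc m) * F p = - (ac i (Suc m) \<cdot> (L p * XE p i m))"
    using XE_F[OF i, of "Suc m"] by simp
  also have "(?a * ?d) \<cdot> (- (ac i (Suc m) \<cdot> (L p * XE p i m)) * Li p)
    = - (?a * ?d * ac i (Suc m) * (inverse (q i p) * inverse ?q ^ m)) \<cdot> XE p i m"
    using L by (simp add: scale_simps)
  also have "- (?a * ?d * ac i (Suc m) * (inverse (q i p) * inverse ?q ^ m))
    = (- ?q) ^ Suc k * (\<Prod>s<Suc k. ac i (c i - s))"
    using q_nz by (simp add: cm(1) power_inverse mult_ac)
  finally show ?case by (simp add: m_def)
qed

text \<open>
  The same for $T_p(F_p) = K_p^{-1} E_p$; here the scalar $-q$ is replaced by $-1$, because the Cartan parts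
  cancel without a q-shift.
\<close>

lemma t_qcom_F:
  assumes i: "i \<noteq> p" and "k \<le> c i"
  shows "qcom (t (gF p)) (q p i * q p p ^ c i) (inverse (q p p)) (t (gF i)) k
    = (inverse (lam i) * (- 1) ^ k * (\<Prod>s<k. ac i (c i - s))) \<cdot> XF p i (c i - k)"
  using assms(2)
proof (induction k)
  case 0 then show ?case using i by (simp add: qad_XF)
next
  case (Suc k)
  let ?q = "q p p"
  define m where "m = c i - Suc k"
  have cm: "c i - k = Suc m" "c i = Suc m + k" using Suc.prems by (auto simp: m_def)
  let ?a = "inverse (lam i) * (- 1) ^ k * (\<Prod>s<k. ac i (c i - s))" and ?d = "q p i * ?q ^ Suc m"
  have d: "q p i * ?q ^ c i * inverse ?q ^ k = ?d"
    using q_nz unfolding cm(2) by (simp add: power_add power_inverse)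
  have "qcom (t (gF p)) (q p i * ?q ^ c i) (inverse ?q) (t (gF i)) (Suc k)
    = Ki p * E p * (?a \<cdot> XF p i (Suc m)) - ?d \<cdot> (?a \<cdot> XF p i (Suc m) * (Ki p * E p))"
    using Suc by (simp add: cm(1) d del: T_val.simps) (simp add: t_F del: T_val.simps)
  also have "\<dots> = ?a \<cdot> (Ki p * (E p * XF p i (Suc m)) - ?d \<cdot> (XF p i (Suc m) * (Ki p * E p)))"
    by (simp add: scale_simps scale_distribs mult.assoc mult_ac del: qcom.simps power_Suc)
  also have "\<dots> = ?a \<cdot> (Ki p * (E p * XF p i (Suc m) - XF p i (Suc m) * E p))"
    unfolding XF_Ki_E[OF i] by (simp add: right_diff_distrib)
  also have "E p * XF p i (Suc m) - XF p i (Suc m) * E p = - (ac i (Suc m) \<cdot> (K p * XF p i m))"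
    using XF_E[OF i, of "Suc m"] by simp
  also have "?a \<cdot> (Ki p * - (ac i (Suc m) \<cdot> (K p * XF p i m))) = - (?a * ac i (Suc m)) \<cdot> XF p i m"
    using Ki_K[of p] by (simp add: scale_simps flip: mult.assoc)
  also have "- (?a * ac i (Suc m)) = inverse (lam i) * (- 1) ^ Suc k * (\<Prod>s<Suc k. ac i (c i - s))"
    by (simp add: cm(1))
  finally show ?case by (simp add: m_def)
qed

sublocale T: U_rep scale q' t by (rule T_val_rep)

lemma inverse_q'_ip: "i \<noteq> p \<Longrightarrow> inverse (q' i p) = q i p * q p p ^ c i"
  and inverse_q'_pi: "i \<noteq> p \<Longrightarrow> inverse (q' p i) = q p i * q p p ^ c i"
  and q'_pp: "q' p p = q p p"
  by (simp_all add: mreflect_def)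

lemma t_YE_top:
  assumes i: "i \<noteq> p"
  shows "T.YE p i (c i) = ((- q p p) ^ c i * lam i) \<cdot> E i"
  using t_qcom_E[OF i order_refl] lam[OF i]
  by (simp add: inverse_q'_ip[OF i] q'_pp ac_prod_rev del: T_val.simps)

lemma t_YF_top:
  assumes i: "i \<noteq> p"
  shows "T.YF p i (c i) = (- 1) ^ c i \<cdot> F i"
  using t_qcom_F[OF i order_refl] lam[OF i] lam_nz[OF i]
  by (simp add: inverse_q'_pi[OF i] q'_pp ac_prod_rev del: T_val.simps)

text \<open>
  The last commutator, of $F_p$ with $E^+_{i,0} = E_i$, is zero.
\<close>

lemma t_YE_Suc:
  assumes i: "i \<noteq> p"
  shows "T.YE p i (Suc (c i)) = 0"
proof -
  have "F p * Li p * E i = q i p \<cdot> (E i * (F p * Li p))"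
    using F_Li_XE[OF i, of 0] EF_diff[OF i] by (simp add: mult.assoc[symmetric])
  then have "t (gE p) * E i - q i p \<cdot> (E i * t (gE p)) = 0"
    by (simp add: t_E)
  moreover have "inverse (q' i p) * inverse (q' p p) ^ c i = q i p"
    using q_nz by (simp add: inverse_q'_ip[OF i] q'_pp power_inverse)
  ultimately show ?thesis
    unfolding qcom.simps t_YE_top[OF i]
    by (simp add: scale_simps mult_ac del: T_val.simps)
qed

lemma t_YF_Suc:
  assumes i: "i \<noteq> p"
  shows "T.YF p i (Suc (c i)) = 0"
proof -
  have "Ki p * E p * F i = q p i \<cdot> (F i * (Ki p * E p))"
    using XF_Ki_E[OF i, of 0] EF_diff[of p i] i by (simp add: mult.assoc)
  then have "t (gF p) * F i - q p i \<cdot> (F i * t (gF p)) = 0"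
    by (simp add: t_F)
  moreover have "inverse (q' p i) * inverse (q' p p) ^ c i = q p i"
    using q_nz by (simp add: inverse_q'_pi[OF i] q'_pp power_inverse)
  ultimately show ?thesis
    unfolding qcom.simps t_YF_top[OF i]
    by (simp add: scale_simps mult_ac del: T_val.simps)
qed

text \<open>
  Applying $T_p^-$ first and $T_p$ second fixes all generators; the scalar required for $E_i$ is the one of
  \<open>mlambda_inverse_reflect\<close>.
\<close>

lemma Tminus_val_T_val_id:
  assumes "\<And>i. i \<noteq> p \<Longrightarrow> lam2 i = (- q p p) ^ c i * lam i"
  shows "Tminus_val scale p c lam2 t = v"
proof
  fix x
  have pow: "K p ^ n * Ki p ^ n = 1" "L p ^ n * Li p ^ n = 1" "Ki p ^ n * K p ^ n = 1" "Li p ^ n * L p ^ n = 1" for n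
    by (simp_all add: left_right_inverse_power K_Ki L_Li Ki_K Li_L)
  show "Tminus_val scale p c lam2 t x = v x"
  proof (cases x)
    case (gE i)
    show ?thesis
    proof (cases "i = p")
      case True then show ?thesis using gE K_Ki by (simp flip: mult.assoc)
    next
      case False
      have "inverse (lam2 i) * ((- q p p) ^ c i * lam i) = 1"
        unfolding assms[OF False] by (rule left_inverse) (simp add: lam_nz[OF False] q_nz)
      then show ?thesis
        using gE t_YE_top[OF False] False
        by (simp add: T.qad_YE del: T_val.simps)
    qed
  next
    case (gF i)
    show ?thesis
    proof (cases "i = p")
      case True then show ?thesis using gF Li_L by (simp add: mult.assoc)
    next
      case False
      have "(- 1) ^ c i * (- 1) ^ c i = (1 :: 'k)" by (simp flip: power_mult_distrib)
      then show ?thesis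
        using gF t_YF_top[OF False] False
        by (simp add: T.qad_YF del: T_val.simps)
    qed
  qed (auto simp: pow mult.assoc)
qed

end

text \<open>
  A valuation that factors through the quotient of $U(\chi)$ by $(I_p^+, I_p^-)$: the generators of the two
  ideals vanish.
\<close>

locale U_serre = U_rep scale q v
  for scale :: "'k::field \<Rightarrow> 'r::ring_1 \<Rightarrow> 'r" (infixr "\<cdot>" 75) and q :: "'i \<Rightarrow> 'i \<Rightarrow> 'k" and v +
  fixes p :: 'i
  assumes mfinite: "mfinite q p"
    and nilE: "qheight (q p p) = enat h \<Longrightarrow> E p ^ h = 0"
    and nilF: "qheight (q p p) = enat h \<Longrightarrow> F p ^ h = 0"
    and serreE: "i \<noteq> p \<Longrightarrow> enat (Suc (mcartan q p i)) < qheight (q p p)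
       \<Longrightarrow> XE p i (Suc (mcartan q p i)) = 0"
    and serreF: "i \<noteq> p \<Longrightarrow> enat (Suc (mcartan q p i)) < qheight (q p p)
       \<Longrightarrow> XF p i (Suc (mcartan q p i)) = 0"
begin

sublocale cartan_matrix q p
  by unfold_locales (rule q_nz, rule mfinite)

text \<open>
  Since $(h)_q = 0$ for the height $h$, one always has $c + 1 \le h$. Hence the Serre elements that are not
  among the generators of the ideals are those with $c + 1 = h$.
\<close>

lemma height_cases:
  assumes "i \<noteq> p"
  obtains "enat (Suc (c i)) < qheight (q p p)" "q p p ^ c i * (q p i * q i p) = 1"
    | "qheight (q p p) = enat (Suc (c i))"
proof (cases "enat (Suc (c i)) < qheight (q p p)")
  case True
  then have "qnum (q p p) (Suc (c i)) \<noteq> 0" by (rule qheight_less) auto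
  then show ?thesis using that(1) True mcartan_zero[OF assms] by blast
next
  case False
  have "qheight (q p p) = enat (Suc (c i))"
  proof (cases "qheight (q p p)")
    case (enat h)
    note h = qheight_finite[OF enat]
    have "\<not> h - 1 < c i"
    proof
      assume "h - 1 < c i"
      from mcartan_minimal(1)[OF this] h(1,2) show False by simp
    qed
    then show ?thesis using False enat h(1) by simp
  next
    case infinity then show ?thesis using False by simp
  qed
  then show ?thesis by (rule that(2))
qed

lemma reverse_E:
  assumes "q p p ^ c i * (q p i * q i p) = 1"
  shows "XE p i (Suc (c i)) = YE p i (Suc (c i))"
proof -
  have "q p i * q p p ^ c i = inverse (q i p)"
    using assms nz[of i p] by (simp add: field_simps)
  then show ?thesis using qcom_reverse[OF nz, of "E p" "q p i" p p "E i" "c i"] by simp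
qed

lemma reverse_F:
  assumes "q p p ^ c i * (q p i * q i p) = 1"
  shows "XF p i (Suc (c i)) = YF p i (Suc (c i))"
proof -
  have "q i p * q p p ^ c i = inverse (q p i)"
    using assms nz[of p i] by (simp add: field_simps)
  then show ?thesis using qcom_reverse[OF nz, of "F p" "q i p" p p "F i" "c i"] by simp
qed

lemma qcom_nil:
  assumes "qheight (q p p) = enat h" "e ^ h = 0"
  shows "qcom e w (q p p) x h = 0" "qcom e w (inverse (q p p)) x h = 0"
proof -
  note h = qheight_finite[OF assms(1)]
  show "qcom e w (q p p) x h = 0"
    using qcom_root[OF h(2,3,1), of e w x] assms(2) by simp
  have "qheight (inverse (q p p)) = enat h" using assms(1) by (simp add: qheight_inverse)
  note h = qheight_finite[OF this]
  show "qcom e w (inverse (q p p)) x h = 0"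
    using qcom_root[OF h(2,3,1), of e w x] assms(2) by simp
qed

text \<open>
  All four Serre elements vanish, including those with $c + 1 = h$ and those of type $E^-$, $F^-$, which
  are not generators of the ideals.
\<close>

lemma serre:
  assumes i: "i \<noteq> p"
  shows "XE p i (Suc (c i)) = 0" "XF p i (Suc (c i)) = 0"
    "YE p i (Suc (c i)) = 0" "YF p i (Suc (c i)) = 0"
proof -
  have "XE p i (Suc (c i)) = 0 \<and> XF p i (Suc (c i)) = 0 \<and> YE p i (Suc (c i)) = 0 \<and> YF p i (Suc (c i)) = 0"
  proof (cases rule: height_cases[OF i])
    case 1
    show ?thesis
      using serreE[OF i 1(1)] serreF[OF i 1(1)] reverse_E[OF 1(2)] reverse_F[OF 1(2)] by simp
  next
    case 2
    show ?thesis using qcom_nil[OF 2 nilE[OF 2]] qcom_nil[OF 2 nilF[OF 2]] by (simp del: qcom.simps)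
  qed
  then show "XE p i (Suc (c i)) = 0" "XF p i (Suc (c i)) = 0"
    "YE p i (Suc (c i)) = 0" "YF p i (Suc (c i)) = 0" by blast+
qed

sublocale T: U_T_val scale q v p "mcartan q p" "mlambda q p"
  by unfold_locales (rule serre(1) serre(2) mlambda_nonzero mlambda_def | assumption)+

lemma twist2_serre: "U_serre scale (minverse q) (twist2 v) p"
proof -
  interpret W: U_rep scale "minverse q" "twist2 v" by (rule twist2_rep)
  interpret C: cartan_matrix "minverse q" p by (rule inverse_matrix)
  show ?thesis
  proof unfold_locales
    show "mfinite (minverse q) p" by (rule C.mfinite)
    show "qheight (inverse (q p p)) = enat h \<Longrightarrow> twist2 v (gE p) ^ h = 0"
      and "qheight (inverse (q p p)) = enat h \<Longrightarrow> twist2 v (gF p) ^ h = 0" for h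
      using nilE[of h] nilF[of h] by (simp_all add: qheight_inverse power_minus[of "E p"])
    show "W.XE p i (Suc (mcartan (minverse q) p i)) = 0"
      and "W.XF p i (Suc (mcartan (minverse q) p i)) = 0" if "i \<noteq> p" for i
      using serre[OF that] by (simp_all add: mcartan_inverse qcom_minus del: qcom.simps)
  qed
qed

lemma twist3_serre: "U_serre scale (mtranspose q) (twist3 v) p"
proof -
  interpret W: U_rep scale "mtranspose q" "twist3 v" by (rule twist3_rep)
  interpret C: cartan_matrix "mtranspose q" p by (rule transpose_matrix)
  show ?thesis
  proof unfold_locales
    show "mfinite (mtranspose q) p" by (rule C.mfinite)
    show "qheight (q p p) = enat h \<Longrightarrow> twist3 v (gE p) ^ h = 0"
      and "qheight (q p p) = enat h \<Longrightarrow> twist3 v (gF p) ^ h = 0" for h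
      using nilE[of h] nilF[of h] by simp_all
    show "W.XE p i (Suc (mcartan (mtranspose q) p i)) = 0"
      and "W.XF p i (Suc (mcartan (mtranspose q) p i)) = 0" if "i \<noteq> p" for i
      using serre[OF that] by (simp_all add: mcartan_transpose del: qcom.simps)
  qed
qed

lemma diag_serre:
  assumes "\<And>i. a i \<noteq> 0"
  shows "U_serre scale q (diag scale a v) p"
proof -
  interpret W: U_rep scale q "diag scale a v" by (rule diag_rep[OF assms])
  show ?thesis
  proof unfold_locales
    show "qheight (q p p) = enat h \<Longrightarrow> diag scale a v (gE p) ^ h = 0"
      and "qheight (q p p) = enat h \<Longrightarrow> diag scale a v (gF p) ^ h = 0" for h
      using nilE[of h] nilF[of h] by (simp_all add: scale_power)
    show "W.XE p i (Suc (mcartan q p i)) = 0"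
      and "W.XF p i (Suc (mcartan q p i)) = 0" if "i \<noteq> p" for i
      using serre[OF that] by (simp_all add: qcom_scale del: qcom.simps)
  qed (rule mfinite)
qed

abbreviation "T \<equiv> T_val scale p (mcartan q p) (mlambda q p) v"

text \<open>
  This makes the powers of $F_p L_p^{-1}$ and $K_p^{-1} E_p$ vanish together with those of $F_p$ and $E_p$.
\<close>

lemma qcm_mult_power: "qcm u a b \<Longrightarrow> \<exists>d. (a * b) ^ n = d \<cdot> (a ^ n * b ^ n)"
proof (induction n)
  case 0 then show ?case by (auto intro: exI[of _ 1])
next
  case (Suc n)
  then obtain d where d: "(a * b) ^ n = d \<cdot> (a ^ n * b ^ n)" by blast
  have bn: "b ^ n * (a * z) = w \<cdot> (a * (b ^ n * z))" if "w * u ^ n = 1" for w z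
  proof -
    from qcmD2[OF qcm_power_right[OF Suc.prems], of n z]
    have "w \<cdot> (a * (b ^ n * z)) = (w * u ^ n) \<cdot> (b ^ n * (a * z))" by (simp add: scale_simps)
    then show ?thesis using that by simp
  qed
  show ?case
  proof (cases "u = 0")
    case True
    then have "a * b = 0" using Suc.prems by (simp add: qcm_def)
    then show ?thesis by (auto intro: exI[of _ 0])
  next
    case False
    then have w: "inverse (u ^ n) * u ^ n = 1" by simp
    have "(a * b) ^ Suc n = (a * b) ^ n * (a * b)" by (rule power_Suc2)
    also have "\<dots> = (d * inverse (u ^ n)) \<cdot> (a ^ n * a * (b ^ n * b))"
      unfolding d by (simp add: scale_simps mult.assoc bn[OF w])
    finally show ?thesis by (auto simp: power_Suc2 simp del: power_Suc)
  qed
qed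

text \<open>
  $T_p$ maps the ideals to zero. For a Serre element among the generators $q^c Q = 1$ holds, and this
  persists for the reflected matrix; therefore it equals the corresponding element of type $E^-$ or
  $F^-$, which vanishes by \<open>t_YE_Suc\<close>, \<open>t_YF_Suc\<close>.
\<close>

lemma T_val_serre: "U_serre scale (mreflect p c q) T p"
proof -
  interpret C: cartan_matrix "mreflect p c q" p by (rule reflect_matrix)
  show ?thesis
  proof unfold_locales
    show "mfinite (mreflect p c q) p" by (rule C.mfinite)
    fix h i
    show "T (gE p) ^ h = 0" if "qheight (mreflect p c q p p) = enat h"
    proof -
      have "qcm (inverse (inverse (q p p))) (F p) (Li p)"
        using qcm_inverse_right[OF qcm_sym[OF LF nz] _ L_Li Li_L] by simp
      from qcm_mult_power[OF this, of h] nilF[of h] that show ?thesis by (auto simp: q'_p)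
    qed
    show "T (gF p) ^ h = 0" if "qheight (mreflect p c q p p) = enat h"
    proof -
      have "qcm (inverse (q p p)) (Ki p) (E p)"
        by (rule qcm_inverse_left[OF KE nz K_Ki Ki_K])
      from qcm_mult_power[OF this, of h] nilE[of h] that show ?thesis by (auto simp: q'_p)
    qed
    assume i: "i \<noteq> p" and "enat (Suc (mcartan (mreflect p c q) p i)) < qheight (mreflect p c q p p)"
    then have "enat (Suc (c i)) < qheight (q p p)" by (simp add: mcartan_reflect q'_p)
    then have "q p p ^ c i * (q p i * q i p) = 1"
      using qheight_less[of "Suc (c i)" "q p p" "Suc (c i)"] mcartan_zero[OF i] by auto
    then have 1: "mreflect p c q p p ^ c i * (mreflect p c q p i * mreflect p c q i p) = 1"
      using q'_zero[OF i] by (simp add: q'_p)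
    have 2: "mreflect p c q p i * mreflect p c q p p ^ c i = inverse (mreflect p c q i p)"
       "mreflect p c q i p * mreflect p c q p p ^ c i = inverse (mreflect p c q p i)"
      using 1 C.nz[of i p] C.nz[of p i] by (simp_all add: field_simps)
    show "T.T.XE p i (Suc (mcartan (mreflect p c q) p i)) = 0"
      using T.t_YE_Suc[OF i] by (simp only: mcartan_reflect[OF i] qcom_reverse[OF C.nz] 2)
    show "T.T.XF p i (Suc (mcartan (mreflect p c q) p i)) = 0"
      using T.t_YF_Suc[OF i] by (simp only: mcartan_reflect[OF i] qcom_reverse[OF C.nz] 2)
  qed
qed

end


section \<open>Inverse maps and twists\<close>

text \<open>
  The values of $\phi_4$ on generators; $\phi_4$ reverses products, so \<open>qadr\<close> is the image of \<open>qad\<close> under an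
  antihomomorphism.
\<close>

primrec swapEF :: "('i gen \<Rightarrow> 'r) \<Rightarrow> 'i gen \<Rightarrow> 'r" where
  "swapEF v (gK i) = v (gK i)"
| "swapEF v (gKi i) = v (gKi i)"
| "swapEF v (gL i) = v (gL i)"
| "swapEF v (gLi i) = v (gLi i)"
| "swapEF v (gE i) = v (gF i)"
| "swapEF v (gF i) = v (gE i)"

primrec qadr :: "'r::ring_1 \<Rightarrow> 'r \<Rightarrow> 'r \<Rightarrow> 'r \<Rightarrow> nat \<Rightarrow> 'r" where
  "qadr k ki e x 0 = x"
| "qadr k ki e x (Suc m) = qadr k ki e x m * e - e * (ki * (qadr k ki e x m * k))"

lemma acoef_inverse:
  assumes "q \<noteq> 0" "Q \<noteq> 0"
  shows "acoef (inverse q) (inverse Q) (Suc s) = - inverse (q ^ s * q ^ s * Q) * acoef q Q (Suc s)"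
proof -
  have "qnum (inverse q) (Suc s) = inverse (q ^ s) * qnum q (Suc s)"
    using qnum_inverse[OF assms(1), of s] assms by (simp add: field_simps)
  then show ?thesis using assms by (simp add: acoef_def power_inverse field_simps)
qed

context algebra_over
begin

lemma sign_inverse: "inverse ((- 1) ^ n) = ((- 1) ^ n :: 'k)"
  by (simp flip: power_inverse)

lemma sign_square: "(- 1) ^ n * ((- 1) ^ n * a) = (a :: 'k)"
  by (cases "even n") simp_all

text \<open>
  Reversing all products turns a q-commutator into a scalar multiple of the q-commutator with the
  inverse scalars.
\<close>

lemma qadr_qcom:
  assumes k: "qcm q k e" "qcm w k x" "ki * k = 1" and nz: "q \<noteq> 0" "w \<noteq> 0"
  shows "qadr k ki e x m = (\<Prod>s<m. - inverse (w * q ^ s)) \<cdot> qcom e w q x m"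
proof (induction m)
  case (Suc m)
  let ?X = "qcom e w q x m" and ?d = "w * q ^ m" and ?P = "\<Prod>s<m. - inverse (w * q ^ s)"
  have "?X * k = inverse ?d \<cdot> (k * ?X)"
    using nz by (intro qcmD qcm_sym qcom_weight k) simp
  then have "ki * (?X * k) = inverse ?d \<cdot> ?X"
    using k(3) by (simp add: scale_simps flip: mult.assoc)
  then have "qadr k ki e x (Suc m) = ?P \<cdot> (?X * e - inverse ?d \<cdot> (e * ?X))"
    by (simp add: Suc scale_simps scale_distribs)
  also have "?X * e - inverse ?d \<cdot> (e * ?X) = - inverse ?d \<cdot> (e * ?X - ?d \<cdot> (?X * e))"
  proof -
    have "- inverse ?d * ?d = - 1" using nz by (simp add: field_simps)
    then show ?thesis by (simp only: scale_right_diff_distrib scale_scale) simp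
  qed
  finally show ?case by (simp add: scale_simps)
qed simp

lemma twist2_inject:
  fixes v w :: "'i gen \<Rightarrow> 'r"
  assumes "twist2 v = twist2 w"
  shows "v = w"
proof
  fix x
  have *: "twist2 v g = twist2 w g" for g using assms by simp
  show "v x = w x"
    by (cases x)
      (use *[of "gK _"] *[of "gKi _"] *[of "gL _"] *[of "gLi _"] *[of "gE _"] *[of "gF _"] in auto)
qed

lemma Tminus_val_diag:
  assumes "\<And>i. b i = a i * (if i = p then inverse (a p * a p) else a p ^ c i)" "a p \<noteq> 0"
  shows "Tminus_val scale p c lam (diag scale b v) = diag scale a (Tminus_val scale p c lam v)"
proof -
  have "T_val scale p c lam (diag scale (\<lambda>i. inverse (b i)) (twist2 v))
      = diag scale (\<lambda>i. inverse (a i)) (T_val scale p c lam (twist2 v))"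
    by (rule T_val_diag) (use assms in \<open>simp_all add: power_inverse\<close>)
  then show ?thesis
    by (simp add: Tminus_val_T_val twist2_diag diag_diag mult.commute del: T_val.simps)
qed

lemma twist2_T_val:
  "twist2 (T_val scale p c lam v)
    = diag scale (\<lambda>i. if i = p then - 1 else 1) (Tminus_val scale p c lam (twist2 v))"
proof
  fix x
  show "twist2 (T_val scale p c lam v) x
    = diag scale (\<lambda>i. if i = p then - 1 else 1) (Tminus_val scale p c lam (twist2 v)) x"
    by (cases x) (simp_all add: qad_minus sign_square scale_simps)
qed

end

context U_rep
begin

text \<open>
  $\phi_3$ exchanges the $E^+$ and $F^+$ and leaves their recursions unchanged, so only the normalisation
  of the images of $F_i$ and the order of the factors in $T_p(E_p)$, $T_p(F_p)$ matter.
\<close>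

lemma twist3_T_val:
  assumes "\<And>i. i \<noteq> p \<Longrightarrow> lam i \<noteq> 0"
  shows "twist3 (T_val scale p c lam v)
    = diag scale (\<lambda>i. if i = p then inverse (q p p) else inverse (lam i)) (T_val scale p c lam (twist3 v))"
proof
  fix x
  have 1: "E p * Ki p = q p p \<cdot> (Ki p * E p)"
    using qcm_inverse_left[OF KE q_nz K_Ki Ki_K, of p p] q_nz by (simp add: qcm_def)
  have 2: "F p * Li p = q p p \<cdot> (Li p * F p)"
    using qcm_inverse_left[OF LF q_nz L_Li Li_L, of p p] q_nz by (simp add: qcm_def)
  show "twist3 (T_val scale p c lam v) x
    = diag scale (\<lambda>i. if i = p then inverse (q p p) else inverse (lam i)) (T_val scale p c lam (twist3 v)) x"
    using 1 2 assms q_nz by (cases x) (auto simp: scale_simps)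
qed

lemma twist3_Tminus_val:
  assumes "\<And>i. i \<noteq> p \<Longrightarrow> lam i \<noteq> 0"
  shows "twist3 (Tminus_val scale p c lam v)
    = diag scale (\<lambda>i. if i = p then inverse (q p p) else (- 1) ^ c i * lam i) (Tminus_val scale p c lam (twist3 v))"
proof
  fix x
  have 1: "Li p * E p = q p p \<cdot> (E p * Li p)"
    using qcm_inverse_left[OF LE _ L_Li Li_L, of p p] q_nz by (simp add: qcm_def)
  have 2: "Ki p * F p = q p p \<cdot> (F p * Ki p)"
    using qcm_inverse_left[OF KF _ K_Ki Ki_K, of p p] q_nz by (simp add: qcm_def)
  show "twist3 (Tminus_val scale p c lam v) x
    = diag scale (\<lambda>i. if i = p then inverse (q p p) else (- 1) ^ c i * lam i) (Tminus_val scale p c lam (twist3 v)) x"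
    using 1 2 assms q_nz by (cases x) (auto simp: scale_simps sign_inverse sign_square mult_ac)
qed

end

context U_serre
begin

lemma Tminus_val_serre:
  "U_serre scale (mreflect p c q) (Tminus_val scale p c (mlambda (minverse q) p) v) p"
proof -
  interpret W: U_serre scale "minverse q" "twist2 v" p by (rule twist2_serre)
  interpret WT: U_serre scale "minverse (mreflect p c q)" "T_val scale p c (mlambda (minverse q) p) (twist2 v)" p
    using W.T_val_serre by (simp only: mcartan_inverse mreflect_inverse)
  interpret R: U_serre scale "mreflect p c q" "twist2 (T_val scale p c (mlambda (minverse q) p) (twist2 v))" p
    using WT.twist2_serre by simp
  show ?thesis
    unfolding Tminus_val_T_val by (rule R.diag_serre) simp
qed

lemma Tminus_val_T_val_inverse:
  "Tminus_val scale p c (mlambda (minverse (mreflect p c q)) p) (T_val scale p c (mlambda q p) v) = v"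
  by (rule T.Tminus_val_T_val_id) (rule mlambda_inverse_reflect)

text \<open>
  The previous lemma for $\chi^{-1}$, conjugated by $\phi_2$ with the help of \<open>Tminus_val_T_val\<close>. The
  signs \<open>?s\<close> square to one and are invariant under \<open>T_val_diag\<close>, so that they cancel.
\<close>

lemma T_val_Tminus_val_inverse:
  "T_val scale p c (mlambda (mreflect p c q) p) (Tminus_val scale p c (mlambda (minverse q) p) v) = v"
proof -
  interpret W: U_serre scale "minverse q" "twist2 v" p by (rule twist2_serre)
  let ?s = "\<lambda>i. if i = p then 1 else (- 1) ^ Suc (c i) :: 'k"
  let ?lam = "mlambda (mreflect p c q) p"
  define w where "w = twist2 (T_val scale p c (mlambda (minverse q) p) (twist2 v))"
  define y where "y = T_val scale p c ?lam w"
  have s: "?s i * ?s i = 1" "inverse (?s i) = ?s i" for i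
    by (simp_all add: sign_square[of _ 1, simplified] sign_inverse)
  have "Tminus_val scale p c ?lam (T_val scale p c (mlambda (minverse q) p) (twist2 v)) = twist2 v"
    using W.Tminus_val_T_val_inverse by (simp add: mcartan_inverse mreflect_inverse)
  then have "diag scale ?s (twist2 y) = twist2 v"
    by (simp only: Tminus_val_T_val w_def y_def)
  then have "twist2 (diag scale ?s y) = twist2 v"
    by (simp only: twist2_diag s)
  then have y: "diag scale ?s y = v" by (rule twist2_inject)
  have "T_val scale p c ?lam (Tminus_val scale p c (mlambda (minverse q) p) v)
    = T_val scale p c ?lam (diag scale ?s w)"
    by (simp only: Tminus_val_T_val w_def)
  also have "\<dots> = diag scale ?s y"
    unfolding y_def by (rule T_val_diag) simp_all
  finally show ?thesis using y by simp
qed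

lemma mlambda_minverse:
  "mlambda (minverse q) p i
    = mlambda q p i * (\<Prod>s<c i. - inverse (q p p ^ s * q p p ^ s * (q p i * q i p)))"
proof -
  have "acoef (inverse (q p p)) (inverse (q p i) * inverse (q i p)) (Suc s)
    = acoef (q p p) (q p i * q i p) (Suc s) * - inverse (q p p ^ s * q p p ^ s * (q p i * q i p))" for s
    using acoef_inverse[of "q p p" "q p i * q i p" s] by (simp only: inverse_mult_distrib nz mult_eq_0_iff simp_thms mult_ac)
  then show ?thesis
    by (simp only: mlambda_def mcartan_inverse prod.distrib)
qed

text \<open>
  The scalars for the relation with $\phi_4$. They are forced by the images of the $F_i$; that they also fit
  the images of the $E_i$ is \<open>anti_E\<close>.
\<close>

definition anti_coef :: "'i \<Rightarrow> 'k" where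
  "anti_coef i = (if i = p then inverse (q p p) else inverse (\<Prod>s<c i. q p i * q p p ^ s))"

lemma anti_coef_nz: "anti_coef i \<noteq> 0"
  by (simp add: anti_coef_def)

lemma anti_E:
  assumes i: "i \<noteq> p"
  shows "inverse (mlambda q p i) \<cdot> XF p i (c i)
    = anti_coef i \<cdot> (inverse (mlambda (minverse q) p i) \<cdot> qadr (L p) (Li p) (F p) (F i) (c i))"
proof -
  let ?A = "\<Prod>s<c i. q p i * q p p ^ s" and ?B = "\<Prod>s<c i. - inverse (q p p ^ s * q p p ^ s * (q p i * q i p))"
    and ?C = "\<Prod>s<c i. - inverse (q i p * q p p ^ s)"
  have "?A * ?B = ?C"
    unfolding prod.distrib[symmetric] by (intro prod.cong refl) (simp add: field_simps)
  moreover have "inverse ?A * (inverse ?B * (?A * ?B)) = 1"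
  proof -
    have "inverse a * (inverse b * (a * b)) = 1" if "a \<noteq> 0" "b \<noteq> 0" for a b :: 'k
      using that by (simp add: field_simps)
    from this[of ?A ?B] show ?thesis by simp
  qed
  ultimately have "inverse ?A * (inverse ?B * ?C) = 1" by (simp only:)
  then have "inverse ?A * (inverse (mlambda q p i * ?B) * ?C) = inverse (mlambda q p i)"
    by (simp only: inverse_mult_distrib mult_ac mult_1_right mult_1_left)
  then show ?thesis
    using i qadr_qcom[OF LF LF Li_L nz nz, of p p i "c i"]
    by (simp only: anti_coef_def mlambda_minverse if_False scale_scale)
qed

lemma anti_F:
  assumes i: "i \<noteq> p"
  shows "XE p i (c i) = inverse (anti_coef i) \<cdot> ((- 1) ^ c i \<cdot> qadr (K p) (Ki p) (E p) (E i) (c i))"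
proof -
  let ?A = "\<Prod>s<c i. q p i * q p p ^ s"
  have "(\<Prod>s<c i. - inverse (q p i * q p p ^ s)) = (\<Prod>s<c i. (- 1) * inverse (q p i * q p p ^ s))"
    by simp
  also have "\<dots> = (- 1) ^ c i * inverse ?A"
    by (simp only: prod.distrib prod_constant card_lessThan prod_inversef o_def)
      (simp add: prod_inversef[symmetric] o_def prod.distrib power_inverse)
  finally show ?thesis
    using i qadr_qcom[OF KE KE Ki_K nz nz, of p p i "c i"]
    by (simp add: anti_coef_def scale_simps sign_square mult_ac)
qed

lemma qadr_serre:
  assumes i: "i \<noteq> p"
  shows "qadr (K p) (Ki p) (F p) (F i) (Suc (c i)) = 0"
    "qadr (L p) (Li p) (E p) (E i) (Suc (c i)) = 0"
  using qadr_qcom[OF KF KF Ki_K, of p p i "Suc (c i)"] qadr_qcom[OF LE LE Li_L, of p p i "Suc (c i)"]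
    serre[OF i] by (simp_all del: qcom.simps qadr.simps)

end


section \<open>Free algebras and residues modulo variable ideals\<close>

text \<open>
  The scalar multiplication of \<open>free_alg\<close>.
\<close>

definition fscale :: "'k::field \<Rightarrow> ('g free_monoid \<Rightarrow>\<^sub>0 'k) \<Rightarrow> ('g free_monoid \<Rightarrow>\<^sub>0 'k)" where
  "fscale c x = Poly_Mapping.single 0 c * x"

lemma poly_mapping_single_induct:
  assumes "P 0" "\<And>w a. P (Poly_Mapping.single w a)" "\<And>x y. P x \<Longrightarrow> P y \<Longrightarrow> P (x + y)"
  shows "P (x :: 'w \<Rightarrow>\<^sub>0 'k::comm_monoid_add)"
proof (induction x rule: update_induct)
  case const then show ?case by (rule assms(1))
next
  case (update f a b)
  have "Poly_Mapping.update a b f = Poly_Mapping.single a b + f"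
    using update(1) by (intro poly_mapping_eqI)
      (auto simp: lookup_update lookup_add lookup_single when_def in_keys_iff)
  then show ?case using assms(2,3) update by simp
qed

lemma single_word_Cons:
  "Poly_Mapping.single (Word (g # l)) 1 = (letter g * Poly_Mapping.single (Word l) 1 :: 'g free_monoid \<Rightarrow>\<^sub>0 'k::field)"
  by (simp add: letter_def mult_single plus_free_monoid_def)

lemma fscale_single: "fscale c (Poly_Mapping.single w a) = Poly_Mapping.single w (c * a)"
  by (simp add: fscale_def mult_single)

lemma falg_induct [case_names one letter scale add]:
  fixes x :: "'g free_monoid \<Rightarrow>\<^sub>0 'k::field"
  assumes one: "P 1" and letter: "\<And>g x. P x \<Longrightarrow> P (letter g * x)"
    and scale: "\<And>c x. P x \<Longrightarrow> P (fscale c x)" and add: "\<And>x y. P x \<Longrightarrow> P y \<Longrightarrow> P (x + y)"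
  shows "P x"
proof (induction x rule: poly_mapping_single_induct)
  show "P 0" using scale[OF one, of 0] by (simp add: fscale_def)
  fix w :: "'g free_monoid" and a :: 'k
  have "P (Poly_Mapping.single (Word l) 1)" for l
  proof (induction l)
    case Nil then show ?case using one by (simp flip: zero_free_monoid_def)
  next
    case (Cons g l) then show ?case using letter by (simp add: single_word_Cons)
  qed
  from scale[OF this, of a "letters w"] show "P (Poly_Mapping.single w a)"
    by (simp add: fscale_single)
qed (rule add)

lemma single_0_central: "Poly_Mapping.single 0 c * x = x * Poly_Mapping.single (0 :: 'g free_monoid) (c :: 'k::field)"
proof (induction x rule: poly_mapping_single_induct)
  case (2 w a)
  show ?case by (simp add: mult_single mult.commute)
qed (simp_all add: algebra_simps)

interpretation falg: algebra_over "fscale :: 'k::field \<Rightarrow> ('g free_monoid \<Rightarrow>\<^sub>0 'k) \<Rightarrow> _"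
proof unfold_locales
  fix a b :: 'k and x y :: "'g free_monoid \<Rightarrow>\<^sub>0 'k"
  show "fscale a (x + y) = fscale a x + fscale a y" by (simp add: fscale_def algebra_simps)
  show "fscale (a + b) x = fscale a x + fscale b x"
    by (simp add: fscale_def single_add algebra_simps)
  show "fscale a (fscale b x) = fscale (a * b) x"
    by (simp add: fscale_def mult_single flip: mult.assoc)
  show "fscale 1 x = x" by (simp add: fscale_def)
  show "fscale a x * y = fscale a (x * y)" by (simp add: fscale_def mult.assoc)
  show "x * fscale a y = fscale a (x * y)"
    unfolding fscale_def by (metis mult.assoc single_0_central)
qed

text \<open>
  The linear extension of a map on words; its values on products are determined by those on words, in
  both the multiplicative and the antimultiplicative case.
\<close>

definition lin :: "('k::zero \<Rightarrow> 'r \<Rightarrow> 'r) \<Rightarrow> ('w \<Rightarrow> 'r::comm_monoid_add) \<Rightarrow> ('w \<Rightarrow>\<^sub>0 'k) \<Rightarrow> 'r" where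
  "lin sc m x = (\<Sum>w\<in>Poly_Mapping.keys x. sc (Poly_Mapping.lookup x w) (m w))"

text \<open>
  Two-sided ideals of a ring type. For the free algebra they are the ideals of the record
  \<open>free_alg\<close> (\<open>ideal_free_alg_iff\<close>).
\<close>

definition two_ideal :: "'a::ring_1 set \<Rightarrow> bool" where
  "two_ideal J \<longleftrightarrow> 0 \<in> J \<and> (\<forall>x\<in>J. \<forall>y\<in>J. x - y \<in> J) \<and> (\<forall>x\<in>J. \<forall>a. a * x \<in> J \<and> x * a \<in> J)"

lemma two_idealD:
  assumes "two_ideal J"
  shows "0 \<in> J" "x \<in> J \<Longrightarrow> y \<in> J \<Longrightarrow> x - y \<in> J" "x \<in> J \<Longrightarrow> a * x \<in> J" "x \<in> J \<Longrightarrow> x * a \<in> J"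
    "x \<in> J \<Longrightarrow> - x \<in> J" "x \<in> J \<Longrightarrow> y \<in> J \<Longrightarrow> x + y \<in> J"
proof -
  show 0: "0 \<in> J" and "x \<in> J \<Longrightarrow> a * x \<in> J" and "x \<in> J \<Longrightarrow> x * a \<in> J"
    using assms by (auto simp: two_ideal_def)
  show d: "x \<in> J \<Longrightarrow> y \<in> J \<Longrightarrow> x - y \<in> J" for x y
    using assms by (auto simp: two_ideal_def)
  show m: "x \<in> J \<Longrightarrow> - x \<in> J" for x using d[OF 0, of x] by simp
  show "x \<in> J \<Longrightarrow> y \<in> J \<Longrightarrow> x + y \<in> J" using d[OF _ m, of x y] by simp
qed

locale linear_map_falg = algebra_over scale
  for scale :: "'k::field \<Rightarrow> 'r::ring_1 \<Rightarrow> 'r" (infixr "\<cdot>" 75) +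
  fixes f :: "('g free_monoid \<Rightarrow>\<^sub>0 'k) \<Rightarrow> 'r"
  assumes add: "f (x + y) = f x + f y"
    and scale: "f (fscale c x) = c \<cdot> f x"
    and one: "f 1 = 1"
begin

lemma zero: "f 0 = 0"
  using add[of 0 0] by simp

lemma minus: "f (- x) = - f x"
  using add[of x "- x"] zero by (simp add: eq_neg_iff_add_eq_0 add.commute)

lemma diff: "f (x - y) = f x - f y"
  using add[of x "- y"] minus by simp

end

locale alg_map = linear_map_falg +
  assumes mult: "f (x * y) = f x * f y"
begin

lemma power: "f (x ^ n) = f x ^ n"
  by (induction n) (simp_all add: one mult)

lemma qad: "f (qad k ki e x m) = qad (f k) (f ki) (f e) (f x) m"
  by (induction m) (simp_all add: diff mult)

lemma preimage_two_ideal: "two_ideal J \<Longrightarrow> two_ideal {x. f x \<in> J}"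
  by (simp add: two_ideal_def zero diff mult)

end

locale anti_map = linear_map_falg +
  assumes mult: "f (x * y) = f y * f x"
begin

lemma power: "f (x ^ n) = f x ^ n"
  by (induction n) (simp_all add: one mult power_commutes)

lemma qad: "f (qad k ki e x m) = qadr (f k) (f ki) (f e) (f x) m"
  by (induction m) (simp_all add: diff mult)

lemma preimage_two_ideal: "two_ideal J \<Longrightarrow> two_ideal {x. f x \<in> J}"
  by (simp add: two_ideal_def zero diff mult)

end

lemma alg_map_eqI:
  assumes "alg_map sc f" "alg_map sc g" "\<And>x. f (letter x) = g (letter x)"
  shows "f x = g x"
proof -
  interpret f: alg_map sc f by fact
  interpret g: alg_map sc g by fact
  show ?thesis
    by (induction x rule: falg_induct)
      (simp_all add: f.one g.one f.mult g.mult f.scale g.scale f.add g.add assms(3))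
qed

lemma anti_map_eqI:
  assumes "anti_map sc f" "anti_map sc g" "\<And>x. f (letter x) = g (letter x)"
  shows "f x = g x"
proof -
  interpret f: anti_map sc f by fact
  interpret g: anti_map sc g by fact
  show ?thesis
    by (induction x rule: falg_induct)
      (simp_all add: f.one g.one f.mult g.mult f.scale g.scale f.add g.add assms(3))
qed

context algebra_over
begin

lemma lin_superset:
  assumes "finite S" "Poly_Mapping.keys x \<subseteq> S"
  shows "lin scale m x = (\<Sum>w\<in>S. Poly_Mapping.lookup x w \<cdot> m w)"
  unfolding lin_def using assms by (intro sum.mono_neutral_left) (auto simp: in_keys_iff)

lemma lin_add: "lin scale m (x + y) = lin scale m x + lin scale m y"
proof -
  let ?S = "Poly_Mapping.keys x \<union> Poly_Mapping.keys y"
  show ?thesis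
    using lin_superset[of ?S x m] lin_superset[of ?S y m] lin_superset[of ?S "x + y" m]
    by (simp add: keys_add lookup_add scale_left_distrib sum.distrib)
qed

lemma lin_single: "lin scale m (Poly_Mapping.single w a) = a \<cdot> m w"
  by (simp add: lin_def)

lemma lin_zero: "lin scale m 0 = 0"
  by (simp add: lin_def)

lemma lin_linear_map:
  assumes "m 0 = 1"
  shows "linear_map_falg scale (lin scale m)"
proof unfold_locales
  fix c x y
  show "lin scale m (fscale c x) = c \<cdot> lin scale m x"
    by (induction x rule: poly_mapping_single_induct)
      (simp_all add: lin_single fscale_single lin_add lin_zero falg.scale_right_distrib scale_right_distrib)
  show "lin scale m 1 = 1"
    using lin_single[of m 0 1] assms by simp
qed (rule lin_add)

lemma lin_alg_map:
  assumes "m 0 = 1" "\<And>u w. m (u + w) = m u * m w"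
  shows "alg_map scale (lin scale m)"
proof -
  interpret linear_map_falg scale "lin scale m" using assms(1) by (rule lin_linear_map)
  show ?thesis
  proof unfold_locales
    fix x y
    show "lin scale m (x * y) = lin scale m x * lin scale m y"
    proof (induction x rule: poly_mapping_single_induct)
      case (2 w a)
      show ?case
        by (induction y rule: poly_mapping_single_induct)
          (simp_all add: mult_single lin_single lin_zero scale_simps assms distrib_left lin_add)
    qed (simp_all add: lin_zero distrib_right lin_add)
  qed
qed

lemma lin_anti_map:
  assumes "m 0 = 1" "\<And>u w. m (u + w) = m w * m u"
  shows "anti_map scale (lin scale m)"
proof -
  interpret linear_map_falg scale "lin scale m" using assms(1) by (rule lin_linear_map)
  show ?thesis
  proof unfold_locales
    fix x y
    show "lin scale m (x * y) = lin scale m y * lin scale m x"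
    proof (induction x rule: poly_mapping_single_induct)
      case (2 w a)
      show ?case
        by (induction y rule: poly_mapping_single_induct)
          (simp_all add: mult_single lin_single lin_zero scale_simps assms distrib_left distrib_right lin_add mult.commute
              scale_right_distrib)
    qed (simp_all add: lin_zero distrib_left distrib_right lin_add)
  qed
qed

end

definition eval :: "('k::field \<Rightarrow> 'r \<Rightarrow> 'r) \<Rightarrow> ('g \<Rightarrow> 'r::ring_1) \<Rightarrow> ('g free_monoid \<Rightarrow>\<^sub>0 'k) \<Rightarrow> 'r" where
  "eval sc v = lin sc (\<lambda>w. prod_list (map v (letters w)))"

definition anti_eval :: "('k::field \<Rightarrow> 'r \<Rightarrow> 'r) \<Rightarrow> ('g \<Rightarrow> 'r::ring_1) \<Rightarrow> ('g free_monoid \<Rightarrow>\<^sub>0 'k) \<Rightarrow> 'r" where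
  "anti_eval sc v = lin sc (\<lambda>w. prod_list (map v (rev (letters w))))"

context algebra_over
begin

lemma eval_alg_map: "alg_map scale (eval scale v)"
  unfolding eval_def by (rule lin_alg_map) (simp_all add: zero_free_monoid_def plus_free_monoid_def)

lemma anti_eval_anti_map: "anti_map scale (anti_eval scale v)"
  unfolding anti_eval_def by (rule lin_anti_map) (simp_all add: zero_free_monoid_def plus_free_monoid_def)

lemma eval_letter: "eval scale v (letter g) = v g"
  by (simp add: eval_def letter_def lin_single)

lemma anti_eval_letter: "anti_eval scale v (letter g) = v g"
  by (simp add: anti_eval_def letter_def lin_single)

end

abbreviation subst :: "('g \<Rightarrow> 'h free_monoid \<Rightarrow>\<^sub>0 'k::field) \<Rightarrow> ('g free_monoid \<Rightarrow>\<^sub>0 'k) \<Rightarrow> ('h free_monoid \<Rightarrow>\<^sub>0 'k)" where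
  "subst \<equiv> eval fscale"

abbreviation anti_subst :: "('g \<Rightarrow> 'h free_monoid \<Rightarrow>\<^sub>0 'k::field) \<Rightarrow> ('g free_monoid \<Rightarrow>\<^sub>0 'k) \<Rightarrow> ('h free_monoid \<Rightarrow>\<^sub>0 'k)" where
  "anti_subst \<equiv> anti_eval fscale"

lemma alg_map_comp:
  assumes "alg_map sc f" "alg_map fscale g"
  shows "alg_map sc (\<lambda>x. f (g x))"
proof -
  interpret f: alg_map sc f by fact
  interpret g: alg_map fscale g by fact
  show ?thesis
    by unfold_locales (simp_all add: f.add g.add f.scale g.scale f.one g.one f.mult g.mult)
qed

lemma anti_alg_map_comp:
  assumes "anti_map sc f" "alg_map fscale g"
  shows "anti_map sc (\<lambda>x. f (g x))"
proof -
  interpret f: anti_map sc f by fact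
  interpret g: alg_map fscale g by fact
  show ?thesis
    by unfold_locales (simp_all add: f.add g.add f.scale g.scale f.one g.one f.mult g.mult)
qed

lemma alg_anti_map_comp:
  assumes "alg_map sc f" "anti_map fscale g"
  shows "anti_map sc (\<lambda>x. f (g x))"
proof -
  interpret f: alg_map sc f by fact
  interpret g: anti_map fscale g by fact
  show ?thesis
    by unfold_locales (simp_all add: f.add g.add f.scale g.scale f.one g.one f.mult g.mult)
qed

text \<open>
  Families of residues, one for each two-sided ideal. Their ring is the product of all quotients of \<open>'a\<close>,
  and as a quotient of a function type by a relation without parameters it is a type. A statement
  proved for all ring types thus becomes available in the quotient by a variable ideal.
\<close>

definition same_residues :: "('a::ring_1 set \<Rightarrow> 'a) \<Rightarrow> ('a set \<Rightarrow> 'a) \<Rightarrow> bool" where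
  "same_residues f g \<longleftrightarrow> (\<forall>J. two_ideal J \<longrightarrow> f J - g J \<in> J)"

lemma equivp_same_residues: "equivp (same_residues :: ('a::ring_1 set \<Rightarrow> 'a) \<Rightarrow> _)"
proof (rule equivpI)
  show "reflp (same_residues :: ('a set \<Rightarrow> 'a) \<Rightarrow> _)" by (auto simp: reflp_def same_residues_def two_idealD)
  show "symp (same_residues :: ('a set \<Rightarrow> 'a) \<Rightarrow> _)"
    by (auto simp: symp_def same_residues_def) (metis minus_diff_eq two_idealD(5))
  show "transp (same_residues :: ('a set \<Rightarrow> 'a) \<Rightarrow> _)"
  proof (rule transpI)
    fix f g h :: "'a set \<Rightarrow> 'a"
    assume a: "same_residues f g" "same_residues g h"
    show "same_residues f h"
      unfolding same_residues_def
    proof (intro allI impI)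
      fix J :: "'a set" assume J: "two_ideal J"
      then have "(f J - g J) + (g J - h J) \<in> J"
        using a by (intro two_idealD(6)) (auto simp: same_residues_def)
      then show "f J - h J \<in> J" by simp
    qed
  qed
qed

quotient_type (overloaded) 'a residues = "'a set \<Rightarrow> 'a::ring_1" / same_residues
  by (rule equivp_same_residues)

instantiation residues :: (ring_1) ring_1
begin

lift_definition zero_residues :: "'a residues" is "\<lambda>J. 0" .

lift_definition one_residues :: "'a residues" is "\<lambda>J. 1" .

lift_definition plus_residues :: "'a residues \<Rightarrow> 'a residues \<Rightarrow> 'a residues" is "\<lambda>f g J. f J + g J"
  unfolding same_residues_def by (metis add_diff_add two_idealD(6))

lift_definition minus_residues :: "'a residues \<Rightarrow> 'a residues \<Rightarrow> 'a residues" is "\<lambda>f g J. f J - g J"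
proof -
  fix f f' g g' :: "'a set \<Rightarrow> 'a"
  assume a: "same_residues f f'" "same_residues g g'"
  have "(f J - f' J) - (g J - g' J) \<in> J" if "two_ideal J" for J
    using a that two_idealD(2)[OF that] by (auto simp only: same_residues_def)
  then show "same_residues (\<lambda>J. f J - g J) (\<lambda>J. f' J - g' J)"
    by (simp add: same_residues_def algebra_simps)
qed

lift_definition uminus_residues :: "'a residues \<Rightarrow> 'a residues" is "\<lambda>f J. - f J"
  unfolding same_residues_def by (metis minus_diff_minus two_idealD(5))

lift_definition times_residues :: "'a residues \<Rightarrow> 'a residues \<Rightarrow> 'a residues" is "\<lambda>f g J. f J * g J"
proof -
  fix f f' g g' :: "'a set \<Rightarrow> 'a"
  assume a: "same_residues f f'" "same_residues g g'"
  have "(f J - f' J) * g J + f' J * (g J - g' J) \<in> J" if "two_ideal J" for J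
    using a that two_idealD(3,4,6)[OF that] by (auto simp only: same_residues_def)
  then show "same_residues (\<lambda>J. f J * g J) (\<lambda>J. f' J * g' J)"
    by (simp add: same_residues_def algebra_simps)
qed

instance
proof
  fix a b c :: "'a residues"
  have r: "same_residues f f" for f :: "'a set \<Rightarrow> 'a" by (simp add: same_residues_def two_idealD)
  show "a + b + c = a + (b + c)" by transfer (simp add: r add.assoc)
  show "a + b = b + a" by transfer (simp add: r add.commute)
  show "0 + a = a" by transfer (simp add: r)
  show "- a + a = 0" by transfer (simp add: r)
  show "a - b = a + - b" by transfer (simp add: r)
  show "a * b * c = a * (b * c)" by transfer (simp add: r mult.assoc)
  show "1 * a = a" by transfer (simp add: r)
  show "a * 1 = a" by transfer (simp add: r)
  show "(a + b) * c = a * c + b * c" by transfer (simp add: r distrib_right)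
  show "a * (b + c) = a * b + a * c" by transfer (simp add: r distrib_left)
  show "(0 :: 'a residues) \<noteq> 1"
  proof transfer
    have "two_ideal {0 :: 'a}" by (simp add: two_ideal_def)
    then show "\<not> same_residues (\<lambda>J. 0) (\<lambda>J. 1 :: 'a)"
      unfolding same_residues_def by fastforce
  qed
qed

end

lift_definition constant_residue :: "'a::ring_1 \<Rightarrow> 'a residues" is "\<lambda>x J. x" .

text \<open>
  The family with the residue of \<open>x\<close> at \<open>J\<close> and that of \<open>e x\<close> everywhere else. A homomorphism \<open>e\<close> that
  kills the relations makes them hold in the other components as well, so that the ring element
  records membership in \<open>J\<close>.
\<close>

lift_definition residue_at :: "'a::ring_1 set \<Rightarrow> ('a \<Rightarrow> 'a) \<Rightarrow> 'a \<Rightarrow> 'a residues"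
  is "\<lambda>J e x J'. if J' = J then x else e x" .

lemma same_residues_refl: "f = g \<Longrightarrow> same_residues f g"
  by (simp add: same_residues_def two_idealD)

lemma constant_residue_hom:
  "constant_residue (a + b) = constant_residue a + constant_residue b"
  "constant_residue (a * b) = constant_residue a * constant_residue b"
  "constant_residue 1 = 1"
  by (transfer, rule same_residues_refl, simp)+

lemma constant_residue_central:
  assumes "\<And>y. a * y = y * a"
  shows "constant_residue a * X = X * constant_residue a"
  using assms by transfer (simp add: same_residues_refl)

lemma residue_at_zeroD:
  assumes "two_ideal J" "residue_at J e x = 0"
  shows "x \<in> J"
  using assms(2,1) by transfer (auto simp: same_residues_def dest: spec[of _ J])

lemma residue_at_zeroI:
  assumes "x \<in> J" "e x = 0"
  shows "residue_at J e x = 0"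
  using assms by transfer (auto simp: same_residues_def two_idealD)

lemma residue_at_hom:
  "e (x + y) = e x + e y \<Longrightarrow> residue_at J e (x + y) = residue_at J e x + residue_at J e y"
  "e (x * y) = e x * e y \<Longrightarrow> residue_at J e (x * y) = residue_at J e x * residue_at J e y"
  "e 1 = 1 \<Longrightarrow> residue_at J e 1 = 1"
  "e (a * x) = a * e x \<Longrightarrow> residue_at J e (a * x) = constant_residue a * residue_at J e x"
  by (transfer, rule same_residues_refl, simp add: fun_eq_iff)+

definition rscale :: "'k::field \<Rightarrow> ('g free_monoid \<Rightarrow>\<^sub>0 'k) residues \<Rightarrow> ('g free_monoid \<Rightarrow>\<^sub>0 'k) residues" where
  "rscale c X = constant_residue (Poly_Mapping.single 0 c) * X"

interpretation residues: algebra_over "rscale :: 'k::field \<Rightarrow> ('g free_monoid \<Rightarrow>\<^sub>0 'k) residues \<Rightarrow> _"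
proof unfold_locales
  fix a b :: 'k and x y :: "('g free_monoid \<Rightarrow>\<^sub>0 'k) residues"
  let ?c = "\<lambda>a. constant_residue (Poly_Mapping.single (0 :: 'g free_monoid) (a :: 'k))"
  show "rscale a (x + y) = rscale a x + rscale a y" by (simp add: rscale_def distrib_left)
  show "rscale (a + b) x = rscale a x + rscale b x"
    by (simp add: rscale_def single_add constant_residue_hom distrib_right)
  have "?c (a * b) = ?c a * ?c b"
    by (simp add: mult_single flip: constant_residue_hom)
  then show "rscale a (rscale b x) = rscale (a * b) x" by (simp add: rscale_def mult.assoc)
  show "rscale 1 x = x" by (simp add: rscale_def constant_residue_hom)
  show "rscale a x * y = rscale a (x * y)" by (simp add: rscale_def mult.assoc)
  have "x * ?c a = ?c a * x" by (rule constant_residue_central[symmetric]) (rule single_0_central)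
  then show "x * rscale a y = rscale a (x * y)" by (simp add: rscale_def flip: mult.assoc)
qed

lemma residue_at_alg_map:
  fixes e :: "('g free_monoid \<Rightarrow>\<^sub>0 'k::field) \<Rightarrow> _"
  assumes "alg_map fscale e"
  shows "alg_map rscale (residue_at J e)"
proof -
  interpret e: alg_map fscale e by fact
  show ?thesis
  proof unfold_locales
    fix x y :: "'g free_monoid \<Rightarrow>\<^sub>0 'k" and c :: 'k
    show "residue_at J e (x + y) = residue_at J e x + residue_at J e y"
      by (rule residue_at_hom(1)) (rule e.add)
    show "residue_at J e (x * y) = residue_at J e x * residue_at J e y"
      by (rule residue_at_hom(2)) (rule e.mult)
    show "residue_at J e 1 = 1"
      by (rule residue_at_hom(3)) (rule e.one)
    show "residue_at J e (fscale c x) = rscale c (residue_at J e x)"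
      unfolding rscale_def fscale_def by (rule residue_at_hom(4)) (rule e.scale[unfolded fscale_def])
  qed
qed


section \<open>Bicharacters and relations\<close>

text \<open>
  Translation between the bicharacter and its matrix $q_{ij}$.
\<close>

locale bicharacter =
  fixes chi :: "('i::finite, 'k::field) bichar" and p :: 'i
  assumes bichar: "is_bichar chi" and p_fin: "p_finite chi p"
begin

abbreviation "\<rho> \<equiv> reflect chi p"
abbreviation "mc \<equiv> mcartan (bq chi) p"

lemma chi_nz: "chi a b \<noteq> 0"
  and chi_add_left: "chi (a + b) z = chi a z * chi b z"
  and chi_add_right: "chi z (a + b) = chi z a * chi z b"
  using bichar by (simp_all add: is_bichar_def)

lemma chi_zero: "chi 0 z = 1" "chi z 0 = 1"
  using chi_add_left[of 0 0 z] chi_add_right[of z 0 0] chi_nz by simp_all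

lemma chi_minus: "chi (- a) z = inverse (chi a z)" "chi z (- a) = inverse (chi z a)"
  using chi_add_left[of "- a" a z] chi_add_right[of z "- a" a] chi_nz[of a z] chi_nz[of z a]
  by (simp_all add: chi_zero field_simps)

lemma chi_mult: "chi (int n *s a) z = chi a z ^ n" "chi z (int n *s a) = chi z a ^ n"
proof -
  have s: "int (Suc n) *s a = a + int n *s a" for n
    by (simp add: vec_eq_iff algebra_simps)
  have z: "int 0 *s a = 0" by (simp add: vec_eq_iff)
  show "chi (int n *s a) z = chi a z ^ n" "chi z (int n *s a) = chi z a ^ n"
    by (induction n) (simp_all only: s z chi_zero chi_add_left chi_add_right power.simps)
qed

lemma cartan_mcartan: "i \<noteq> p \<Longrightarrow> cartan chi p i = - int (mc i)"
  by (simp add: cartan_def mcartan_def)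

lemma cartan_p: "cartan chi p p = 2"
  by (simp add: cartan_def)

lemma height_qheight: "height chi p = qheight (bq chi p p)"
  by (simp add: height_def qheight_def)

lemma matrix: "cartan_matrix (bq chi) p"
proof
  show "bq chi i j \<noteq> 0" for i j by (simp add: bq_def chi_nz)
  show "mfinite (bq chi) p"
    using p_fin by (fastforce simp: p_finite_def mfinite_def)
qed

sublocale M: cartan_matrix "bq chi" p
  by (rule matrix)

lemma lambda_mlambda: "i \<noteq> p \<Longrightarrow> lambda chi p i = mlambda (bq chi) p i"
proof -
  assume i: "i \<noteq> p"
  have "qfact q m = (\<Prod>s<m. qnum q (Suc s))" for q :: 'k and m
    by (simp add: qfact_def prod.atLeast1_atMost_eq)
  then show ?thesis
    by (simp add: lambda_def mlambda_def cartan_mcartan[OF i] acoef_def prod.distrib mult.assoc)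
qed

lemma sigma_component:
  "sigma chi p a $ k = a $ k - (if k = p then (\<Sum>j\<in>UNIV. a $ j * cartan chi p j) else 0)"
proof -
  have "sigma chi p a $ k
    = (\<Sum>j\<in>UNIV. a $ j * ((if k = j then 1 else 0) - cartan chi p j * (if k = p then 1 else 0)))"
    unfolding sigma_def by (simp add: axis_def vector_scalar_mult_def)
  also have "\<dots> = (\<Sum>j\<in>UNIV. if k = j then a $ j else 0)
      - (\<Sum>j\<in>UNIV. a $ j * cartan chi p j * (if k = p then 1 else 0))"
    by (simp only: sum_subtractf[symmetric]) (intro sum.cong refl, simp add: algebra_simps)
  also have "\<dots> = a $ k - (if k = p then (\<Sum>j\<in>UNIV. a $ j * cartan chi p j) else 0)"
    by (simp add: sum.delta')
  finally show ?thesis .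
qed

lemma sigma_add: "sigma chi p (a + b) = sigma chi p a + sigma chi p b"
  by (simp add: vec_eq_iff sigma_component distrib_right sum.distrib)

text \<open>
  $\sigma_p$ is a reflection because $c_{pp} = 2$; therefore the inverse in the definition of $r_p(\chi)$ is
  $\sigma_p$ itself.
\<close>

lemma sigma_sigma: "sigma chi p (sigma chi p a) = a"
proof -
  let ?S = "\<lambda>a. \<Sum>j\<in>UNIV. a $ j * cartan chi p j"
  have "?S (sigma chi p a) = (\<Sum>j\<in>UNIV. a $ j * cartan chi p j - (if p = j then 2 * ?S a else 0))"
    by (intro sum.cong refl) (auto simp: sigma_component left_diff_distrib cartan_p)
  also have "\<dots> = - ?S a" by (simp add: sum_subtractf)
  finally show ?thesis by (auto simp: vec_eq_iff sigma_component[of "sigma chi p a"]) (auto simp: sigma_component)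
qed

lemma inv_sigma: "inv_into UNIV (sigma chi p) = sigma chi p"
  by (rule inv_equality) (rule sigma_sigma)+

lemma reflect_eq: "\<rho> a b = chi (sigma chi p a) (sigma chi p b)"
  by (simp add: reflect_def inv_sigma)

lemma sigma_root:
  "sigma chi p (simple_root i) = (if i = p then - simple_root p else simple_root i + int (mc i) *s simple_root p)"
proof -
  have "(\<Sum>j\<in>UNIV. (simple_root i :: int ^ 'i) $ j * cartan chi p j) = cartan chi p i"
    by (simp add: axis_def if_distrib[of "\<lambda>x. x * _"] cong: if_cong)
  then show ?thesis
    by (auto simp: vec_eq_iff sigma_component axis_def cartan_p cartan_mcartan)
qed

lemma bq_reflect: "bq \<rho> = mreflect p mc (bq chi)"
proof (intro ext)
  fix a b
  show "bq \<rho> a b = mreflect p mc (bq chi) a b"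
    by (simp add: bq_def reflect_eq sigma_root mreflect_def chi_minus chi_add_left chi_add_right
        chi_mult power_mult_distrib power_inverse mult_ac)
qed

lemma cartan_reflect: "cartan \<rho> p i = cartan chi p i"
proof (cases "i = p")
  case True then show ?thesis by (simp add: cartan_def)
next
  case False
  have "cartan \<rho> p i = - int (mcartan (bq \<rho>) p i)"
    using False by (simp add: cartan_def mcartan_def)
  then show ?thesis using False by (simp add: bq_reflect M.mcartan_reflect cartan_mcartan)
qed

lemma reflect_bicharacter: "bicharacter \<rho> p"
proof
  show "is_bichar \<rho>"
    by (simp add: is_bichar_def reflect_eq chi_nz sigma_add chi_add_left chi_add_right)
  interpret R: cartan_matrix "bq \<rho>" p
    unfolding bq_reflect by (rule M.reflect_matrix)
  show "p_finite \<rho> p"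
    using R.mfinite by (auto simp: p_finite_def mfinite_def)
qed

lemma sigma_reflect: "sigma \<rho> p = sigma chi p"
  by (rule ext) (simp add: sigma_def cartan_reflect)

lemma reflect_reflect: "reflect \<rho> p = chi"
proof -
  interpret R: bicharacter \<rho> p by (rule reflect_bicharacter)
  show ?thesis by (intro ext) (simp add: R.reflect_eq reflect_eq sigma_reflect sigma_sigma)
qed

lemma bq_inv: "bq (bichar_inv chi) = minverse (bq chi)"
  by (intro ext) (simp add: bq_def bichar_inv_def)

lemma bq_op: "bq (bichar_op chi) = mtranspose (bq chi)"
  by (intro ext) (simp add: bq_def bichar_op_def)

lemma inv_bicharacter: "bicharacter (bichar_inv chi) p"
proof
  show "is_bichar (bichar_inv chi)"
    by (simp add: is_bichar_def bichar_inv_def chi_nz chi_add_left chi_add_right)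
  interpret R: cartan_matrix "bq (bichar_inv chi)" p
    unfolding bq_inv by (rule M.inverse_matrix)
  show "p_finite (bichar_inv chi) p"
    using R.mfinite by (auto simp: p_finite_def mfinite_def)
qed

lemma op_bicharacter: "bicharacter (bichar_op chi) p"
proof
  show "is_bichar (bichar_op chi)"
    by (simp add: is_bichar_def bichar_op_def chi_nz chi_add_left chi_add_right)
  interpret R: cartan_matrix "bq (bichar_op chi)" p
    unfolding bq_op by (rule M.transpose_matrix)
  show "p_finite (bichar_op chi) p"
    using R.mfinite by (auto simp: p_finite_def mfinite_def)
qed

lemma cartan_inv: "cartan (bichar_inv chi) p i = cartan chi p i"
proof (cases "i = p")
  case False
  have "cartan (bichar_inv chi) p i = - int (mcartan (bq (bichar_inv chi)) p i)"
    using False by (simp add: cartan_def mcartan_def)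
  then show ?thesis using False by (simp add: bq_inv M.mcartan_inverse cartan_mcartan)
qed (simp add: cartan_def)

lemma cartan_op: "cartan (bichar_op chi) p i = cartan chi p i"
proof (cases "i = p")
  case False
  have "cartan (bichar_op chi) p i = - int (mcartan (bq (bichar_op chi)) p i)"
    using False by (simp add: cartan_def mcartan_def)
  then show ?thesis using False by (simp add: bq_op M.mcartan_transpose cartan_mcartan)
qed (simp add: cartan_def)

lemma reflect_inv: "reflect (bichar_inv chi) p = bichar_inv \<rho>"
proof -
  have "sigma (bichar_inv chi) p = sigma chi p"
    by (rule ext) (simp add: sigma_def cartan_inv)
  then show ?thesis by (simp add: reflect_def bichar_inv_def)
qed

lemma reflect_op: "reflect (bichar_op chi) p = bichar_op \<rho>"
proof -
  have "sigma (bichar_op chi) p = sigma chi p"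
    by (rule ext) (simp add: sigma_def cartan_op)
  then show ?thesis by (simp add: reflect_def bichar_op_def)
qed

end

text \<open>
  Preimages in the free algebra of the generators of $(I_p^+, I_p^-)$, together with the relations
  of $U(\chi)$.
\<close>

definition U_serre_relations :: "('i::finite, 'k::field) bichar \<Rightarrow> 'i \<Rightarrow> ('i, 'k) falg set" where
  "U_serre_relations chi p = U_relations chi \<union>
     {letter (gE p) ^ h | h. height chi p = enat h} \<union>
     {letter (gF p) ^ h | h. height chi p = enat h} \<union>
     {qad (letter (gK p)) (letter (gKi p)) (letter (gE p)) (letter (gE i)) (nat (1 - cartan chi p i)) | i.
        i \<noteq> p \<and> enat (nat (1 - cartan chi p i)) < height chi p} \<union>
     {qad (letter (gL p)) (letter (gLi p)) (letter (gF p)) (letter (gF i)) (nat (1 - cartan chi p i)) | i.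
        i \<noteq> p \<and> enat (nat (1 - cartan chi p i)) < height chi p}"

lemma smult_free_alg: "c \<odot>\<^bsub>free_alg\<^esub> x = fscale c x"
  by (simp add: free_alg_def fscale_def)

text \<open>
  The next lemmas relate the two descriptions of the relations, as elements of the free algebra that
  are mapped to zero and as identities between the images of the generators.
\<close>

lemma U_rep_vanish:
  assumes "U_rep sc (bq chi) v" "alg_map sc f" "\<And>g. f (letter g) = v g" "r \<in> U_relations chi"
  shows "f r = 0"
proof -
  interpret U_rep sc "bq chi" v by fact
  interpret f: alg_map sc f by fact
  note hom = f.mult f.diff f.one f.scale f.zero assms(3) smult_free_alg
  have X: "f (letter x * letter y * letter xi - c \<odot>\<^bsub>free_alg\<^esub> letter y) = 0"
    if "qcm c (v x) (v y)" "v x * v xi = 1" for x y xi c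
    using qcm_conj[OF that] by (simp add: hom)
  show ?thesis
    using assms(4) unfolding U_relations_def
    by (elim UnE CollectE exE conjE; (simp only: X KE LE KF LF K_Ki L_Li)?)
      (use EF in \<open>auto simp: hom cartan_comm K_Ki L_Li\<close>)
qed

lemma U_rep_anti_vanish:
  assumes "U_rep sc (bq chi) v" "anti_map sc f" "\<And>g. f (letter g) = swapEF v g" "r \<in> U_relations chi"
  shows "f r = 0"
proof -
  interpret U_rep sc "bq chi" v by fact
  interpret f: anti_map sc f by fact
  note hom = f.mult f.diff f.one f.scale f.zero assms(3) smult_free_alg
  have X: "xi * (y * x) = sc c y" if "qcm (inverse c) x y" "xi * x = 1" "c \<noteq> 0" for x y xi c
  proof -
    have "y * x = sc c (x * y)" using that(1,3) by (simp add: qcm_def)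
    then show ?thesis using that(2) by (simp add: scale_simps flip: mult.assoc)
  qed
  have sw: "swapEF v g = v g" if "g \<in> cartan_gens" for g
    using that by (auto simp: cartan_gens_def)
  have Y: "Ki i * (F j * K i) = sc (bq chi i j) (F j)" "Li i * (F j * L i) = sc (inverse (bq chi j i)) (F j)"
    "Ki i * (E j * K i) = sc (inverse (bq chi i j)) (E j)" "Li i * (E j * L i) = sc (bq chi j i) (E j)" for i j
    by (rule X; use KE LE KF LF Ki_K Li_L q_nz in simp)+
  show ?thesis
    using assms(4) unfolding U_relations_def
    by (elim UnE CollectE exE conjE)
      (use EF in \<open>auto simp: hom cartan_comm Ki_K Li_L Y sw\<close>)
qed

lemma U_serre_vanish:
  assumes "bicharacter chi p" "U_serre sc (bq chi) v p" "alg_map sc f" "\<And>g. f (letter g) = v g"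
    "r \<in> U_serre_relations chi p"
  shows "f r = 0"
proof -
  interpret B: bicharacter chi p by fact
  interpret U_serre sc "bq chi" v p by fact
  interpret f: alg_map sc f by fact
  have n: "nat (1 - cartan chi p i) = Suc (mcartan (bq chi) p i)" if "i \<noteq> p" for i
    using that by (simp add: B.cartan_mcartan)
  show ?thesis
    using assms(5) unfolding U_serre_relations_def
    by (elim UnE CollectE exE conjE)
      (auto simp: U_rep_vanish[OF U_rep_axioms f.alg_map_axioms assms(4)] f.power f.qad assms(4)
        B.height_qheight nilE nilF n qad_XE qad_XF serre simp del: qad.simps qcom.simps)
qed

lemma U_serre_anti_vanish:
  assumes "bicharacter chi p" "U_serre sc (bq chi) v p" "anti_map sc f" "\<And>g. f (letter g) = swapEF v g"
    "r \<in> U_serre_relations chi p"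
  shows "f r = 0"
proof -
  interpret B: bicharacter chi p by fact
  interpret U_serre sc "bq chi" v p by fact
  interpret f: anti_map sc f by fact
  have n: "nat (1 - cartan chi p i) = Suc (mcartan (bq chi) p i)" if "i \<noteq> p" for i
    using that by (simp add: B.cartan_mcartan)
  show ?thesis
    using assms(5) unfolding U_serre_relations_def
    by (elim UnE CollectE exE conjE)
      (auto simp: U_rep_anti_vanish[OF U_rep_axioms f.anti_map_axioms assms(4)] f.power f.qad assms(4)
        B.height_qheight nilE nilF n qadr_serre simp del: qad.simps qadr.simps)
qed

lemma U_repI:
  assumes "is_bichar chi" "alg_map sc f" and van: "\<And>r. r \<in> U_relations chi \<Longrightarrow> f r = 0"
  shows "U_rep sc (bq chi) (\<lambda>g. f (letter g))"
proof -
  interpret f: alg_map sc f by fact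
  note hom = f.mult f.diff f.one f.scale f.zero smult_free_alg
  have comm: "f (letter x) * f (letter y) = f (letter y) * f (letter x)"
    if "x \<in> cartan_gens" "y \<in> cartan_gens" for x y :: "'a gen"
  proof -
    have "letter x * letter y - letter y * letter x \<in> U_relations chi"
      using that by (auto simp: U_relations_def)
    from van[OF this] show ?thesis by (simp add: hom)
  qed
  have Kinv: "f (letter (gK i)) * f (letter (gKi i)) = 1" for i
  proof -
    have "letter (gK i) * letter (gKi i) - 1 \<in> U_relations chi"
      by (auto simp: U_relations_def)
    from van[OF this] show ?thesis by (simp add: hom)
  qed
  have Linv: "f (letter (gL i)) * f (letter (gLi i)) = 1" for i
  proof -
    have "letter (gL i) * letter (gLi i) - 1 \<in> U_relations chi"
      by (auto simp: U_relations_def)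
    from van[OF this] show ?thesis by (simp add: hom)
  qed
  have X: "f.qcm u (f (letter x)) (f (letter y))"
    if "letter x * letter y * letter xi - u \<odot>\<^bsub>free_alg\<^esub> letter y \<in> U_relations chi"
      "f (letter x) * f (letter xi) = 1" "x \<in> cartan_gens" "xi \<in> cartan_gens" for x xi y u
  proof -
    have "f (letter xi) * f (letter x) = 1" using that comm by simp
    moreover have "f (letter x) * f (letter y) * f (letter xi) = sc u (f (letter y))"
      using van[OF that(1)] by (simp add: hom)
    ultimately have "f (letter x) * f (letter y) = sc u (f (letter y)) * f (letter x)"
      by (metis mult.assoc mult_1_right)
    then show ?thesis by (simp add: f.qcm_def f.scale_simps)
  qed
  show ?thesis
  proof unfold_locales
    fix i j
    show "bq chi i j \<noteq> 0" using assms(1) by (simp add: is_bichar_def bq_def)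
    show "f.qcm (bq chi i j) (f (letter (gK i))) (f (letter (gE j)))"
      by (rule X[where xi = "gKi i"]) (auto simp: U_relations_def Kinv cartan_gens_def)
    show "f.qcm (inverse (bq chi j i)) (f (letter (gL i))) (f (letter (gE j)))"
      by (rule X[where xi = "gLi i"]) (auto simp: U_relations_def Linv cartan_gens_def)
    show "f.qcm (inverse (bq chi i j)) (f (letter (gK i))) (f (letter (gF j)))"
      by (rule X[where xi = "gKi i"]) (auto simp: U_relations_def Kinv cartan_gens_def)
    show "f.qcm (bq chi j i) (f (letter (gL i))) (f (letter (gF j)))"
      by (rule X[where xi = "gLi i"]) (auto simp: U_relations_def Linv cartan_gens_def)
    have "letter (gE i) * letter (gF j) - letter (gF j) * letter (gE i)
        - (if i = j then letter (gK i) - letter (gL i) else 0) \<in> U_relations chi"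
      by (auto simp: U_relations_def)
    from van[OF this] show "f (letter (gE i)) * f (letter (gF j)) - f (letter (gF j)) * f (letter (gE i))
      = (if i = j then f (letter (gK i)) - f (letter (gL i)) else 0)"
      by (auto simp: hom split: if_splits)
  qed (rule comm Kinv Linv; assumption)+
qed

lemma U_serreI:
  assumes "bicharacter chi p" "alg_map sc f" and van: "\<And>r. r \<in> U_serre_relations chi p \<Longrightarrow> f r = 0"
  shows "U_serre sc (bq chi) (\<lambda>g. f (letter g)) p"
proof -
  interpret B: bicharacter chi p by fact
  interpret f: alg_map sc f by fact
  interpret U_rep sc "bq chi" "\<lambda>g. f (letter g)"
    by (rule U_repI[OF B.bichar assms(2)]) (rule van, simp add: U_serre_relations_def)
  have n: "nat (1 - cartan chi p i) = Suc (mcartan (bq chi) p i)" if "i \<noteq> p" for i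
    using that by (simp add: B.cartan_mcartan)
  show ?thesis
  proof unfold_locales
    show "mfinite (bq chi) p" by (rule B.M.mfinite)
    fix h i
    show "f (letter (gE p)) ^ h = 0" if "qheight (bq chi p p) = enat h"
      using van[of "letter (gE p) ^ h"] that
      by (auto simp: U_serre_relations_def B.height_qheight f.power)
    show "f (letter (gF p)) ^ h = 0" if "qheight (bq chi p p) = enat h"
      using van[of "letter (gF p) ^ h"] that
      by (auto simp: U_serre_relations_def B.height_qheight f.power)
    assume i: "i \<noteq> p" "enat (Suc (mcartan (bq chi) p i)) < qheight (bq chi p p)"
    have "qad (letter (gK p)) (letter (gKi p)) (letter (gE p)) (letter (gE i)) (nat (1 - cartan chi p i))
        \<in> U_serre_relations chi p"
      using i unfolding U_serre_relations_def B.height_qheight n[OF i(1), symmetric] by blast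
    from van[OF this] show "XE p i (Suc (mcartan (bq chi) p i)) = 0"
      by (simp only: f.qad n[OF i(1)] qad_XE)
    have "qad (letter (gL p)) (letter (gLi p)) (letter (gF p)) (letter (gF i)) (nat (1 - cartan chi p i))
        \<in> U_serre_relations chi p"
      using i unfolding U_serre_relations_def B.height_qheight n[OF i(1), symmetric] by blast
    from van[OF this] show "XF p i (Suc (mcartan (bq chi) p i)) = 0"
      by (simp only: f.qad n[OF i(1)] qad_XF)
  qed
qed

text \<open>
  The counit of $U(\chi)$ satisfies all relations whatever the bicharacter is, and so can serve as the
  homomorphism used by \<open>residue_at\<close> away from \<open>J\<close>.
\<close>

primrec counit :: "'i gen \<Rightarrow> 'r::ring_1" where
  "counit (gK i) = 1"
| "counit (gKi i) = 1"
| "counit (gL i) = 1"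
| "counit (gLi i) = 1"
| "counit (gE i) = 0"
| "counit (gF i) = 0"

lemma (in algebra_over) counit_rep:
  assumes "\<And>i j. q i j \<noteq> 0"
  shows "U_rep scale q counit"
  using assms by unfold_locales (auto simp: cartan_gens_def qcm_def)

lemma (in algebra_over) counit_serre:
  assumes "cartan_matrix q p"
  shows "U_serre scale q counit p"
proof -
  interpret cartan_matrix q p by fact
  interpret U_rep scale q counit by (rule counit_rep) (rule nz)
  have z: "qcom 0 w u 0 m = 0" for w u m by (induction m) simp_all
  have "(0 :: 'r) ^ h = 0" if "qheight (q p p) = enat h" for h
    using qheight_finite(1)[OF that] by (simp add: power_0_left)
  then show ?thesis
    by unfold_locales (simp_all add: mfinite z del: qcom.simps)
qed

definition residue :: "('i, 'k::field) falg set \<Rightarrow> ('i, 'k) falg \<Rightarrow> ('i, 'k) falg residues" where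
  "residue J = residue_at J (subst counit)"

lemma residue_alg_map: "alg_map rscale (residue J)"
  unfolding residue_def by (rule residue_at_alg_map) (rule falg.eval_alg_map)

interpretation residue: alg_map rscale "residue J :: ('i, 'k::field) falg \<Rightarrow> _" for J
  by (rule residue_alg_map)

lemma residue_zeroD: "two_ideal J \<Longrightarrow> residue J x = 0 \<Longrightarrow> x \<in> J"
  unfolding residue_def by (rule residue_at_zeroD)

lemma residue_rep:
  assumes "is_bichar chi" "U_relations chi \<subseteq> J"
  shows "U_rep rscale (bq chi) (\<lambda>g. residue J (letter g))"
proof (rule U_repI[OF assms(1) residue_alg_map])
  fix r assume r: "r \<in> U_relations chi"
  have "U_rep fscale (bq chi) counit"
    by (rule falg.counit_rep) (use assms(1) in \<open>simp add: bq_def is_bichar_def\<close>)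
  then have "subst counit r = 0"
    by (rule U_rep_vanish[OF _ falg.eval_alg_map falg.eval_letter r])
  then show "residue J r = 0"
    unfolding residue_def using assms(2) r by (intro residue_at_zeroI) auto
qed

text \<open>
  The point of the type of residues: in the quotient by an ideal that contains the relations, the
  generators form a valuation to which the results on \<open>U_serre\<close> apply; conversely \<open>residue_zeroD\<close> turns
  identities between residues into membership in the ideal.
\<close>

lemma residue_serre:
  assumes "bicharacter chi p" "U_serre_relations chi p \<subseteq> J"
  shows "U_serre rscale (bq chi) (\<lambda>g. residue J (letter g)) p"
proof (rule U_serreI[OF assms(1) residue_alg_map])
  interpret bicharacter chi p by fact
  fix r assume r: "r \<in> U_serre_relations chi p"
  have "subst counit r = 0"
    by (rule U_serre_vanish[OF assms(1) falg.counit_serre[OF matrix] falg.eval_alg_map falg.eval_letter r])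
  then show "residue J r = 0"
    unfolding residue_def using assms(2) r by (intro residue_at_zeroI) auto
qed


section \<open>Presentations of the algebras\<close>

text \<open>
  An algebra record that is the image of the free algebra under \<open>\<pi>\<close> with kernel \<open>J\<close>. All operations of the
  record can then be computed in the ring type of the free algebra.
\<close>

locale presented =
  fixes B :: "('k::field, 'b) module" (structure) and \<pi> :: "('g free_monoid \<Rightarrow>\<^sub>0 'k) \<Rightarrow> 'b"
    and J :: "('g free_monoid \<Rightarrow>\<^sub>0 'k) set"
  assumes J: "two_ideal J"
    and carrier_B: "carrier B = range \<pi>"
    and \<pi>_eq_iff: "\<pi> x = \<pi> y \<longleftrightarrow> x - y \<in> J"
    and \<pi>_mult: "\<pi> x \<otimes> \<pi> y = \<pi> (x * y)"
    and \<pi>_add: "\<pi> x \<oplus> \<pi> y = \<pi> (x + y)"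
    and \<pi>_one: "\<one> = \<pi> 1"
    and \<pi>_zero: "\<zero> = \<pi> 0"
    and \<pi>_smult: "c \<odot> \<pi> x = \<pi> (fscale c x)"
begin

lemma \<pi>_closed [simp]: "\<pi> x \<in> carrier B"
  by (simp add: carrier_B)

lemma is_ring: "ring B"
proof (rule ringI)
  show "abelian_group B"
  proof (rule abelian_groupI)
    fix x assume "x \<in> carrier B"
    then obtain a where "x = \<pi> a" by (auto simp: carrier_B)
    then have "\<pi> (- a) \<oplus> x = \<zero>" by (simp add: \<pi>_add \<pi>_zero)
    then show "\<exists>y\<in>carrier B. y \<oplus> x = \<zero>" by (rule bexI) simp
  qed (auto simp: carrier_B \<pi>_add \<pi>_zero add_ac)
  show "Group.monoid B"
    by (rule monoidI) (auto simp: carrier_B \<pi>_mult \<pi>_one mult.assoc)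
qed (auto simp: carrier_B \<pi>_add \<pi>_mult algebra_simps)

sublocale ring B
  by (rule is_ring)

lemma \<pi>_uminus: "\<ominus> \<pi> x = \<pi> (- x)"
  by (rule minus_equality) (simp_all add: \<pi>_add \<pi>_zero)

lemma \<pi>_minus: "\<pi> x \<ominus> \<pi> y = \<pi> (x - y)"
  by (simp add: a_minus_def \<pi>_uminus \<pi>_add)

lemma \<pi>_power: "\<pi> x [^] (n::nat) = \<pi> (x ^ n)"
  by (induction n) (simp_all add: \<pi>_one \<pi>_mult power_commutes)

lemma preimage_ideal:
  assumes "ideal I B"
  shows "two_ideal {x. \<pi> x \<in> I}"
proof -
  interpret I: ideal I B by fact
  have zero: "\<pi> 0 \<in> I" using I.zero_closed by (simp add: \<pi>_zero)
  have diff: "\<pi> (x - y) \<in> I" if "\<pi> x \<in> I" "\<pi> y \<in> I" for x y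
    using I.a_closed[OF that(1) I.a_inv_closed[OF that(2)]] by (simp add: \<pi>_uminus \<pi>_add)
  have mult: "\<pi> (a * x) \<in> I \<and> \<pi> (x * a) \<in> I" if "\<pi> x \<in> I" for a x
    using I.I_l_closed[OF that, of "\<pi> a"] I.I_r_closed[OF that, of "\<pi> a"] by (simp add: \<pi>_mult)
  show ?thesis
    unfolding two_ideal_def using zero diff mult by simp
qed

lemma image_mem_iff:
  assumes "two_ideal N" "J \<subseteq> N"
  shows "\<pi> x \<in> \<pi> ` N \<longleftrightarrow> x \<in> N"
proof
  assume "\<pi> x \<in> \<pi> ` N"
  then obtain y where "y \<in> N" "x - y \<in> J" by (auto simp: \<pi>_eq_iff)
  then have "(x - y) + y \<in> N" using assms by (intro two_idealD(6)) auto
  then show "x \<in> N" by simp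
qed simp

lemma image_ideal:
  assumes "two_ideal N"
  shows "ideal (\<pi> ` N) B"
proof (rule idealI[OF is_ring])
  note N = two_idealD[OF assms]
  show "subgroup (\<pi> ` N) (add_monoid B)"
  proof (rule add.subgroupI)
    show "\<pi> ` N \<noteq> {}" using N(1) by auto
    fix a assume "a \<in> \<pi> ` N"
    then obtain x where "a = \<pi> x" "x \<in> N" by auto
    then show "\<ominus> a \<in> \<pi> ` N" using N(5) by (simp add: \<pi>_uminus)
  next
    fix a b assume "a \<in> \<pi> ` N" "b \<in> \<pi> ` N"
    then obtain x y where "a = \<pi> x" "x \<in> N" "b = \<pi> y" "y \<in> N" by auto
    then show "a \<oplus> b \<in> \<pi> ` N" using N(6) by (simp add: \<pi>_add)
  qed auto
  fix a x assume "a \<in> \<pi> ` N" "x \<in> carrier B"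
  then obtain n y where "a = \<pi> n" "n \<in> N" "x = \<pi> y" by (auto simp: carrier_B)
  then show "x \<otimes> a \<in> \<pi> ` N" "a \<otimes> x \<in> \<pi> ` N" using N(3,4) by (simp_all add: \<pi>_mult)
qed

text \<open>
  Closed under quotients, hence applicable to \<open>U chi\<close> and to \<open>Uq chi p\<close>. The union in the scalar
  multiplication of \<open>quot_alg\<close> runs over equal cosets, as an ideal is stable under scalars.
\<close>

lemma quotient_presented:
  assumes "ideal I B"
  shows "presented (quot_alg B I) (\<lambda>x. I +> \<pi> x) {x. \<pi> x \<in> I}"
proof -
  interpret I: ideal I B by fact
  note simps = quot_alg_def FactRing_def
  show ?thesis
  proof
    show "two_ideal {x. \<pi> x \<in> I}" by (rule preimage_ideal[OF assms])
    show "carrier (quot_alg B I) = range (\<lambda>x. I +> \<pi> x)"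
    proof -
      have "carrier (quot_alg B I) = (\<Union>a\<in>carrier B. {I +> a})"
        by (simp add: simps A_RCOSETS_def')
      then show ?thesis unfolding carrier_B by auto
    qed
    fix x y c
    show "I +> \<pi> x = I +> \<pi> y \<longleftrightarrow> x - y \<in> {x. \<pi> x \<in> I}"
      using quotient_eq_iff_same_a_r_cos[OF assms, of "\<pi> x" "\<pi> y"] by (simp add: \<pi>_minus)
    show "(I +> \<pi> x) \<otimes>\<^bsub>quot_alg B I\<^esub> (I +> \<pi> y) = I +> \<pi> (x * y)"
      by (simp add: simps I.rcoset_mult_add \<pi>_mult)
    show "(I +> \<pi> x) \<oplus>\<^bsub>quot_alg B I\<^esub> (I +> \<pi> y) = I +> \<pi> (x + y)"
      by (simp add: simps I.a_rcos_sum \<pi>_add)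
    show "\<one>\<^bsub>quot_alg B I\<^esub> = I +> \<pi> 1" by (simp add: simps \<pi>_one)
    show "\<zero>\<^bsub>quot_alg B I\<^esub> = I +> \<pi> 0"
      by (simp add: simps I.a_subset flip: \<pi>_zero)
    have coset: "I +> c \<odot> a = I +> \<pi> (fscale c x)" if a: "a \<in> I +> \<pi> x" for a
    proof -
      have "a \<in> carrier B"
        using a a_r_coset_subset_G[OF I.a_subset, of "\<pi> x"] by auto
      then obtain y where y: "a = \<pi> y" by (auto simp: carrier_B)
      then have "I +> \<pi> y = I +> \<pi> x"
        using a_repr_independence[OF a _ I.a_subgroup] by simp
      then have "\<pi> (y - x) \<in> I"
        using quotient_eq_iff_same_a_r_cos[OF assms, of "\<pi> y" "\<pi> x"] by (simp add: \<pi>_minus)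
      then have "\<pi> (Poly_Mapping.single 0 c) \<otimes> \<pi> (y - x) \<in> I"
        by (rule I.I_l_closed) simp
      then have "\<pi> (fscale c y) \<ominus> \<pi> (fscale c x) \<in> I"
        by (simp add: \<pi>_mult \<pi>_minus fscale_def algebra_simps)
      then show ?thesis
        using quotient_eq_iff_same_a_r_cos[OF assms, of "\<pi> (fscale c y)" "\<pi> (fscale c x)"]
        by (simp add: y \<pi>_smult)
    qed
    have "\<pi> x \<in> I +> \<pi> x" by (rule I.a_rcos_self) simp
    then show "c \<odot>\<^bsub>quot_alg B I\<^esub> (I +> \<pi> x) = I +> \<pi> (fscale c x)"
      unfolding quot_alg_def using coset by auto
  qed
qed

end

definition typed_ideal :: "'a::ring_1 set \<Rightarrow> 'a set" where
  "typed_ideal S = \<Inter>{J. two_ideal J \<and> S \<subseteq> J}"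

lemma free_alg_presented: "presented free_alg id {0}"
  by unfold_locales (auto simp: free_alg_def two_ideal_def fscale_def)

interpretation free: presented free_alg id "{0}"
  by (rule free_alg_presented)

lemma ideal_free_alg_iff: "ideal I free_alg \<longleftrightarrow> two_ideal I"
  using free.preimage_ideal[of I] free.image_ideal[of I] by auto

lemma U_rel_ideal_eq: "U_rel_ideal chi = typed_ideal (U_relations chi)"
  by (simp add: U_rel_ideal_def genideal_def typed_ideal_def ideal_free_alg_iff)

lemma U_rel_ideal:
  shows "two_ideal (U_rel_ideal chi)" "U_relations chi \<subseteq> U_rel_ideal chi"
    "two_ideal N \<Longrightarrow> U_relations chi \<subseteq> N \<Longrightarrow> U_rel_ideal chi \<subseteq> N"
  unfolding U_rel_ideal_eq typed_ideal_def by (auto simp: two_ideal_def)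

definition uproj :: "('i::finite, 'k::field) bichar \<Rightarrow> ('i, 'k) falg \<Rightarrow> ('i, 'k) ualg" where
  "uproj chi x = U_rel_ideal chi +>\<^bsub>free_alg\<^esub> x"

lemma U_presented: "presented (U chi) (uproj chi) (U_rel_ideal chi)"
  using free.quotient_presented[of "U_rel_ideal chi"] U_rel_ideal(1)[of chi]
  by (simp add: ideal_free_alg_iff U_def uproj_def[abs_def])

interpretation U: presented "U chi" "uproj chi" "U_rel_ideal chi" for chi
  by (rule U_presented)

lemma ugen_uproj: "ugen chi g = uproj chi (letter g)"
  by (simp add: ugen_def uproj_def)

lemma uproj_qad:
  shows "Eplus chi p i m = uproj chi (qad (letter (gK p)) (letter (gKi p)) (letter (gE p)) (letter (gE i)) m)"
    "Eminus chi p i m = uproj chi (qad (letter (gL p)) (letter (gLi p)) (letter (gE p)) (letter (gE i)) m)"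
    "Fplus chi p i m = uproj chi (qad (letter (gL p)) (letter (gLi p)) (letter (gF p)) (letter (gF i)) m)"
    "Fminus chi p i m = uproj chi (qad (letter (gK p)) (letter (gKi p)) (letter (gF p)) (letter (gF i)) m)"
  by (induction m)
    (simp_all add: ugen_uproj adK_def adL_def U.\<pi>_mult U.\<pi>_minus)

lemma residue_U_rep: "is_bichar chi \<Longrightarrow> U_rep rscale (bq chi) (\<lambda>g. residue (U_rel_ideal chi) (letter g))"
  by (rule residue_rep[OF _ U_rel_ideal(2)])

lemma generated_subalg:
  assumes "S \<subseteq> carrier (U chi)"
  defines "A \<equiv> generated_subalg (U chi) S"
  shows "subring A (U chi)" "S \<subseteq> A" "x \<in> A \<Longrightarrow> c \<odot>\<^bsub>U chi\<^esub> x \<in> A"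
proof -
  let ?S = "{B. subring B (U chi) \<and> (\<forall>c. \<forall>x\<in>B. c \<odot>\<^bsub>U chi\<^esub> x \<in> B) \<and> S \<subseteq> B}"
  have "c \<odot>\<^bsub>U chi\<^esub> x \<in> carrier (U chi)" if "x \<in> carrier (U chi)" for c x
    using that by (auto simp: U.carrier_B U.\<pi>_smult)
  then have car: "carrier (U chi) \<in> ?S"
    using U.carrier_is_subring assms by auto
  show "subring A (U chi)"
    unfolding A_def generated_subalg_def
  proof (rule U.subringI)
    show "\<Inter>?S \<subseteq> carrier (U chi)" using car by blast
  qed (auto dest: subringE(3,5,6,7))
qed (auto simp: A_def generated_subalg_def)

lemma (in alg_map) qcom: "f (falg.qcom e w q x m) = qcom (f e) w q (f x) m"
  by (induction m) (simp_all add: diff mult scale)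

lemma generated_subalg_closed:
  assumes "S \<subseteq> carrier (U chi)"
  defines "A \<equiv> generated_subalg (U chi) S"
  shows "uproj chi 1 \<in> A" "uproj chi x \<in> A \<Longrightarrow> uproj chi y \<in> A \<Longrightarrow> uproj chi (x * y) \<in> A"
    "uproj chi x \<in> A \<Longrightarrow> uproj chi y \<in> A \<Longrightarrow> uproj chi (x - y) \<in> A"
    "uproj chi x \<in> A \<Longrightarrow> uproj chi (fscale c x) \<in> A"
    "uproj chi x \<in> A \<Longrightarrow> uproj chi (x ^ n) \<in> A"
    "uproj chi e \<in> A \<Longrightarrow> uproj chi x \<in> A \<Longrightarrow> uproj chi (falg.qcom e w q x n) \<in> A"
proof -
  note g = generated_subalg[OF assms(1), folded A_def]
  note sub = subringE[OF g(1)]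
  show one: "uproj chi 1 \<in> A" using sub(3) by (simp add: U.\<pi>_one)
  show mult: "uproj chi x \<in> A \<Longrightarrow> uproj chi y \<in> A \<Longrightarrow> uproj chi (x * y) \<in> A" for x y
    using sub(6)[of "uproj chi x" "uproj chi y"] by (simp add: U.\<pi>_mult)
  show diff: "uproj chi x \<in> A \<Longrightarrow> uproj chi y \<in> A \<Longrightarrow> uproj chi (x - y) \<in> A" for x y
    using sub(7)[OF _ sub(5), of "uproj chi x" "uproj chi y"] by (simp add: U.\<pi>_uminus U.\<pi>_add)
  show scale: "uproj chi x \<in> A \<Longrightarrow> uproj chi (fscale c x) \<in> A" for x c
    using g(3)[of "uproj chi x" c] by (simp add: U.\<pi>_smult)
  show "uproj chi x \<in> A \<Longrightarrow> uproj chi (x ^ n) \<in> A"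
    by (induction n) (auto intro: one mult)
  show "uproj chi e \<in> A \<Longrightarrow> uproj chi x \<in> A \<Longrightarrow> uproj chi (falg.qcom e w q x n) \<in> A"
    by (induction n) (auto intro!: mult diff scale)
qed

text \<open>
  $I_p^\pm$ are ideals of $U^\pm$ and not of $U$. An ideal \<open>N\<close> of $U$ restricts to an ideal of the
  subalgebra, so it contains $I_p^\pm$ as soon as it contains their generators.
\<close>

lemma genideal_subalg:
  assumes "S \<subseteq> carrier (U chi)"
  defines "A \<equiv> generated_subalg (U chi) S"
  assumes "G \<subseteq> A"
  shows "Idl\<^bsub>(U chi)\<lparr>carrier := A\<rparr>\<^esub> G \<subseteq> A" "G \<subseteq> Idl\<^bsub>(U chi)\<lparr>carrier := A\<rparr>\<^esub> G"
    "ideal N (U chi) \<Longrightarrow> G \<subseteq> N \<Longrightarrow> Idl\<^bsub>(U chi)\<lparr>carrier := A\<rparr>\<^esub> G \<subseteq> N"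
proof -
  note g = generated_subalg[OF assms(1), folded A_def]
  let ?R = "(U chi)\<lparr>carrier := A\<rparr>"
  interpret R: ring ?R by (rule U.subring_is_ring[OF g(1)])
  interpret h: ring_hom_ring ?R "U chi" id
    by (rule ring_hom_ringI2[OF R.ring_axioms U.is_ring])
      (use subringE(1)[OF g(1)] in \<open>auto simp: ring_hom_def\<close>)
  have le: "Idl\<^bsub>?R\<^esub> G \<subseteq> N \<inter> A" if "ideal N (U chi)" "G \<subseteq> N" for N
    using h.ideal_vimage[OF that(1)] that(2) assms(3) unfolding genideal_def by (auto simp: Int_def)
  show "ideal N (U chi) \<Longrightarrow> G \<subseteq> N \<Longrightarrow> Idl\<^bsub>?R\<^esub> G \<subseteq> N" using le by blast
  show "Idl\<^bsub>?R\<^esub> G \<subseteq> A"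
    using le[OF U.oneideal] assms(3) subringE(1)[OF g(1)] by blast
  show "G \<subseteq> Idl\<^bsub>?R\<^esub> G" by (auto simp: genideal_def)
qed

text \<open>
  The kernel of the projection from the free algebra to \<open>Uq chi p\<close>.
\<close>

definition serre_ideal :: "('i::finite, 'k::field) bichar \<Rightarrow> 'i \<Rightarrow> ('i, 'k) falg set" where
  "serre_ideal chi p = {x. uproj chi x \<in> I_both chi p}"

text \<open>
  Replacing conjugation by $K_p$ with its eigenvalue shows that these elements lie in $U^\pm$.
\<close>

lemma Eplus_qcom:
  assumes "is_bichar chi"
  shows "Eplus chi p i m
      = uproj chi (falg.qcom (letter (gE p)) (bq chi p i) (bq chi p p) (letter (gE i)) m)"
    and "Fplus chi p i m
      = uproj chi (falg.qcom (letter (gF p)) (bq chi i p) (bq chi p p) (letter (gF i)) m)"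
proof -
  let ?J = "U_rel_ideal chi"
  interpret U_rep rscale "bq chi" "\<lambda>g. residue ?J (letter g)"
    by (rule residue_U_rep[OF assms])
  have eq: "uproj chi x = uproj chi y" if "residue ?J x = residue ?J y" for x y
    using residue_zeroD[OF U_rel_ideal(1), of chi "x - y"] that
    by (simp add: U.\<pi>_eq_iff residue.diff)
  show "Eplus chi p i m
      = uproj chi (falg.qcom (letter (gE p)) (bq chi p i) (bq chi p p) (letter (gE i)) m)"
    unfolding uproj_qad by (rule eq) (simp only: residue.qad residue.qcom qad_XE)
  show "Fplus chi p i m
      = uproj chi (falg.qcom (letter (gF p)) (bq chi i p) (bq chi p p) (letter (gF i)) m)"
    unfolding uproj_qad by (rule eq) (simp only: residue.qad residue.qcom qad_XF)
qed

text \<open>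
  The kernel is the least ideal that contains \<open>U_serre_relations\<close>. Minimality is what shows that
  substitutions preserve it: only the relations have to be checked.
\<close>

lemma serre_ideal:
  assumes "is_bichar chi"
  shows I_both_ideal: "ideal (I_both chi p) (U chi)"
    and serre_ideal_two_ideal: "two_ideal (serre_ideal chi p)"
    and U_serre_relations_subset: "U_serre_relations chi p \<subseteq> serre_ideal chi p"
    and serre_ideal_minimal:
      "two_ideal N \<Longrightarrow> U_serre_relations chi p \<subseteq> N \<Longrightarrow> serre_ideal chi p \<subseteq> N"
proof -
  let ?GP = "{uE chi p [^]\<^bsub>U chi\<^esub> h | h::nat. height chi p = enat h} \<union>
      {Eplus chi p i (nat (1 - cartan chi p i)) | i.
         i \<noteq> p \<and> enat (nat (1 - cartan chi p i)) < height chi p}"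
  let ?GM = "{uF chi p [^]\<^bsub>U chi\<^esub> h | h::nat. height chi p = enat h} \<union>
      {Fplus chi p i (nat (1 - cartan chi p i)) | i.
         i \<noteq> p \<and> enat (nat (1 - cartan chi p i)) < height chi p}"
  have SP: "range (uE chi) \<subseteq> carrier (U chi)" and SM: "range (uF chi) \<subseteq> carrier (U chi)"
    by (auto simp: ugen_uproj)
  note cP = generated_subalg_closed[OF SP] and cM = generated_subalg_closed[OF SM]
  have "uproj chi (letter (gE i)) \<in> U_plus chi" "uproj chi (letter (gF i)) \<in> U_minus chi" for i
    using generated_subalg(2)[OF SP] generated_subalg(2)[OF SM]
    by (auto simp: U_plus_def U_minus_def ugen_uproj)
  then have GP: "?GP \<subseteq> U_plus chi" and GM: "?GM \<subseteq> U_minus chi"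
    using cP(5,6) cM(5,6)
    by (auto simp: U_plus_def U_minus_def ugen_uproj U.\<pi>_power Eplus_qcom[OF assms])
  note idP = genideal_subalg[OF SP GP[unfolded U_plus_def], folded U_plus_def, folded I_plus_def]
  note idM = genideal_subalg[OF SM GM[unfolded U_minus_def], folded U_minus_def, folded I_minus_def]
  have car: "I_plus chi p \<union> I_minus chi p \<subseteq> carrier (U chi)"
    using idP(1) idM(1) subringE(1)[OF generated_subalg(1)[OF SP, folded U_plus_def]]
      subringE(1)[OF generated_subalg(1)[OF SM, folded U_minus_def]]
    by blast
  show I: "ideal (I_both chi p) (U chi)"
    unfolding I_both_def by (rule U.genideal_ideal[OF car])
  show "two_ideal (serre_ideal chi p)"
    unfolding serre_ideal_def by (rule U.preimage_ideal[OF I])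
  have zero: "uproj chi r \<in> I_both chi p" if "r \<in> U_relations chi" for r
  proof -
    have "uproj chi r = uproj chi 0" using that U_rel_ideal(2)[of chi] by (auto simp: U.\<pi>_eq_iff)
    then show ?thesis
      using additive_subgroup.zero_closed[OF ideal.axioms(1)[OF I]] by (simp add: U.\<pi>_zero)
  qed
  have "?GP \<union> ?GM \<subseteq> I_both chi p"
    using idP(2) idM(2) U.genideal_self[OF car] unfolding I_both_def by blast
  then show "U_serre_relations chi p \<subseteq> serre_ideal chi p"
    using zero unfolding U_serre_relations_def serre_ideal_def uproj_qad
    by (auto simp: ugen_uproj U.\<pi>_power)
  show "serre_ideal chi p \<subseteq> N" if N: "two_ideal N" "U_serre_relations chi p \<subseteq> N" for N
  proof -
    have JN: "U_rel_ideal chi \<subseteq> N"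
      using N by (intro U_rel_ideal(3)) (auto simp: U_serre_relations_def)
    have idN: "ideal (uproj chi ` N) (U chi)" by (rule U.image_ideal[OF N(1)])
    have "?GP \<subseteq> uproj chi ` N" "?GM \<subseteq> uproj chi ` N"
      using N(2) unfolding U_serre_relations_def uproj_qad
      by (auto simp: ugen_uproj U.\<pi>_power)
    then have "I_plus chi p \<union> I_minus chi p \<subseteq> uproj chi ` N"
      using idP(3)[OF idN] idM(3)[OF idN] by blast
    then have "I_both chi p \<subseteq> uproj chi ` N"
      unfolding I_both_def by (rule U.genideal_minimal[OF idN])
    then show ?thesis
      unfolding serre_ideal_def using U.image_mem_iff[OF N(1) JN] by blast
  qed
qed

definition qp :: "('i::finite, 'k::field) bichar \<Rightarrow> 'i \<Rightarrow> ('i, 'k) falg \<Rightarrow> ('i, 'k) qalg" where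
  "qp chi p x = qproj chi p (uproj chi x)"

lemma Uq_presented:
  assumes "is_bichar chi"
  shows "presented (Uq chi p) (qp chi p) (serre_ideal chi p)"
  using U.quotient_presented[OF I_both_ideal[OF assms, of p]]
  by (simp add: Uq_def qp_def[abs_def] qproj_def serre_ideal_def)

lemma cartan_relations:
  shows "x \<in> cartan_gens \<Longrightarrow> y \<in> cartan_gens \<Longrightarrow> letter x * letter y - letter y * letter x \<in> U_relations chi"
    "letter (gK i) * letter (gKi i) - 1 \<in> U_relations chi"
    "letter (gL i) * letter (gLi i) - 1 \<in> U_relations chi"
  by (auto simp: U_relations_def)

text \<open>
  The common form of the characterisations of all algebra maps in the theorem. The inverse generators
  are absent, since their images are determined.
\<close>

definition maps_gens :: "('i::finite, 'k::field) bichar \<Rightarrow> ('i gen \<Rightarrow> 'b) \<Rightarrow> (('i, 'k) ualg \<Rightarrow> 'b) \<Rightarrow> bool" where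
  "maps_gens chi s f \<longleftrightarrow> (\<forall>i. f (uK chi i) = s (gK i) \<and> f (uL chi i) = s (gL i) \<and>
     f (uE chi i) = s (gE i) \<and> f (uF chi i) = s (gF i))"

text \<open>
  A map \<open>s\<close> on the free algebra that is compatible with the operations and kills the relations
  descends to the unique algebra map with the given values on the generators. No product of \<open>B\<close> occurs
  in the definition of \<open>s\<close>, so this covers the opposite algebra needed for $\phi_4$.
\<close>

lemma the_alg_hom_U:
  fixes s :: "('i::finite, 'k::field) falg \<Rightarrow> 'b"
  assumes B: "ring B"
    and closed: "\<And>x. s x \<in> carrier B"
    and mult: "\<And>x y. s (x * y) = s x \<otimes>\<^bsub>B\<^esub> s y"
    and add: "\<And>x y. s (x + y) = s x \<oplus>\<^bsub>B\<^esub> s y"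
    and one: "s 1 = \<one>\<^bsub>B\<^esub>"
    and smult: "\<And>c x. s (fscale c x) = c \<odot>\<^bsub>B\<^esub> s x"
    and cong: "\<And>x y. x - y \<in> U_rel_ideal chi \<Longrightarrow> s x = s y"
  shows "the_alg_hom (U chi) B (maps_gens chi (\<lambda>g. s (letter g))) (uproj chi x) = s x"
    (is "the_alg_hom _ _ ?P _ = _")
proof -
  interpret B: ring B by fact
  define f0 where "f0 = (\<lambda>y\<in>carrier (U chi). s (SOME x. uproj chi x = y))"
  have f0: "f0 (uproj chi x) = s x" for x
  proof -
    have "uproj chi (SOME z. uproj chi z = uproj chi x) = uproj chi x" by (rule someI) (rule refl)
    then have "s (SOME z. uproj chi z = uproj chi x) = s x" by (intro cong) (simp add: U.\<pi>_eq_iff)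
    then show ?thesis by (simp add: f0_def)
  qed
  have "(THE f. f \<in> alg_hom (U chi) B \<and> f \<in> extensional (carrier (U chi)) \<and> ?P f) = f0"
  proof (rule the_equality, intro conjI)
    show "f0 \<in> alg_hom (U chi) B"
      unfolding alg_hom_def ring_hom_def
      by (auto simp: U.carrier_B f0 U.\<pi>_mult U.\<pi>_add U.\<pi>_one U.\<pi>_smult closed mult add one smult)
    show "f0 \<in> extensional (carrier (U chi))" by (simp add: f0_def)
    show "?P f0" by (simp add: maps_gens_def ugen_uproj f0)
  next
    fix f assume f: "f \<in> alg_hom (U chi) B \<and> f \<in> extensional (carrier (U chi)) \<and> ?P f"
    have hom: "f (uproj chi (x * y)) = f (uproj chi x) \<otimes>\<^bsub>B\<^esub> f (uproj chi y)"
      "f (uproj chi (x + y)) = f (uproj chi x) \<oplus>\<^bsub>B\<^esub> f (uproj chi y)"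
      "f (uproj chi 1) = \<one>\<^bsub>B\<^esub>" "f (uproj chi x) \<in> carrier B"
      "f (uproj chi (fscale c x)) = c \<odot>\<^bsub>B\<^esub> f (uproj chi x)" for x y c
      using f unfolding alg_hom_def ring_hom_def
      by (auto simp flip: U.\<pi>_mult U.\<pi>_add U.\<pi>_one U.\<pi>_smult)
    \<comment> \<open>inverses in a monoid are unique, and so are the values on the inverse generators\<close>
    have inv: "f (uproj chi (letter h)) = s (letter h)"
      if rel: "letter g * letter h - 1 \<in> U_relations chi" "letter g * letter h - letter h * letter g \<in> U_relations chi"
        and g: "f (uproj chi (letter g)) = s (letter g)" for g h
    proof -
      have "letter g * letter h - 1 \<in> U_rel_ideal chi"
        and comm: "letter g * letter h - letter h * letter g \<in> U_rel_ideal chi"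
        using rel U_rel_ideal(2)[of chi] by auto
      then have 1: "uproj chi (letter g * letter h) = uproj chi 1" "s (letter g * letter h) = s 1"
        by (auto simp: U.\<pi>_eq_iff intro: cong)
      moreover have 2: "uproj chi (letter g * letter h) = uproj chi (letter h * letter g)"
        using comm by (simp add: U.\<pi>_eq_iff)
      ultimately have "f (uproj chi (letter h)) \<otimes>\<^bsub>B\<^esub> s (letter g) = \<one>\<^bsub>B\<^esub>"
        "s (letter g) \<otimes>\<^bsub>B\<^esub> s (letter h) = \<one>\<^bsub>B\<^esub>"
        using hom(1)[of "letter h" "letter g"] hom(3) g one mult[of "letter g" "letter h"] by simp_all
      then show ?thesis using B.inv_unique closed hom(4) by metis
    qed
    have P: "f (uproj chi (letter (gK i))) = s (letter (gK i))" "f (uproj chi (letter (gL i))) = s (letter (gL i))"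
      "f (uproj chi (letter (gE i))) = s (letter (gE i))" "f (uproj chi (letter (gF i))) = s (letter (gF i))" for i
      using f by (simp_all add: maps_gens_def ugen_uproj)
    have "f (uproj chi (letter g)) = s (letter g)" for g
    proof (cases g)
      case (gKi i)
      show ?thesis unfolding gKi
        by (rule inv[OF cartan_relations(2,1) P(1)]) (simp_all add: cartan_gens_def)
    next
      case (gLi i)
      show ?thesis unfolding gLi
        by (rule inv[OF cartan_relations(3,1) P(2)]) (simp_all add: cartan_gens_def)
    qed (simp_all add: P)
    then have "f (uproj chi x) = s x" for x
      by (induction x rule: falg_induct) (simp_all add: hom mult add one smult)
    then show "f = f0"
      using f by (intro extensionalityI[of f "carrier (U chi)"]) (auto simp: f0_def[symmetric] f0 U.carrier_B, simp add: f0_def U.carrier_B)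
  qed
  then show ?thesis by (simp add: the_alg_hom_def f0)
qed


section \<open>The maps induced by substitutions\<close>

context alg_map
begin

lemma T_val: "f (T_val fscale p c lam v g) = T_val scale p c lam (\<lambda>x. f (v x)) g"
  by (cases g) (simp_all add: mult power qad scale)

lemma Tminus_val: "f (Tminus_val fscale p c lam v g) = Tminus_val scale p c lam (\<lambda>x. f (v x)) g"
  by (cases g) (simp_all add: mult power qad scale)

lemma diag: "f (diag fscale a v g) = diag scale a (\<lambda>x. f (v x)) g"
  by (cases g) (simp_all add: scale)

lemma twist2: "f (twist2 v g) = twist2 (\<lambda>x. f (v x)) g"
  by (cases g) (simp_all add: minus)

end

lemma twist3_nat: "f (twist3 v g) = twist3 (\<lambda>x. f (v x)) g"
  by (cases g) simp_all

lemma swapEF_nat: "f (swapEF v g) = swapEF (\<lambda>x. f (v x)) g"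
  by (cases g) simp_all

text \<open>
  A substitution maps the kernel of \<open>Uq chi p\<close> into \<open>J\<close> if the images of the letters, read modulo \<open>J\<close>,
  satisfy the relations. The following lemmas are the variants for antihomomorphisms and for \<open>U chi\<close>.
\<close>

lemma alg_map_kills:
  assumes "bicharacter chi p" "alg_map fscale g" "two_ideal J"
    and serre: "U_serre rscale (bq chi) (\<lambda>x. residue J (g (letter x))) p"
    and x: "x \<in> serre_ideal chi p"
  shows "g x \<in> J"
proof -
  have "g r \<in> J" if "r \<in> U_serre_relations chi p" for r
    by (rule residue_zeroD[OF assms(3)])
      (rule U_serre_vanish[OF assms(1) serre alg_map_comp[OF residue_alg_map assms(2)] refl that])
  then show ?thesis
    using serre_ideal_minimal[OF bicharacter.bichar[OF assms(1)] alg_map.preimage_two_ideal[OF assms(2,3)], of p] x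
    by blast
qed

lemma anti_map_kills:
  assumes "bicharacter chi p" "anti_map fscale g" "two_ideal J"
    and serre: "U_serre rscale (bq chi) v p" "\<And>x. residue J (g (letter x)) = swapEF v x"
    and x: "x \<in> serre_ideal chi p"
  shows "g x \<in> J"
proof -
  have "g r \<in> J" if "r \<in> U_serre_relations chi p" for r
    by (rule residue_zeroD[OF assms(3)])
      (rule U_serre_anti_vanish[OF assms(1) serre(1) alg_anti_map_comp[OF residue_alg_map assms(2)] serre(2) that])
  then show ?thesis
    using serre_ideal_minimal[OF bicharacter.bichar[OF assms(1)] anti_map.preimage_two_ideal[OF assms(2,3)], of p] x
    by blast
qed

lemma alg_map_kills_U:
  assumes "alg_map fscale g" "two_ideal J"
    and rep: "U_rep rscale (bq chi) (\<lambda>x. residue J (g (letter x)))"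
    and x: "x \<in> U_rel_ideal chi"
  shows "g x \<in> J"
proof -
  have "g r \<in> J" if "r \<in> U_relations chi" for r
    by (rule residue_zeroD[OF assms(2)])
      (rule U_rep_vanish[OF rep alg_map_comp[OF residue_alg_map assms(1)] refl that])
  then show ?thesis using U_rel_ideal(3)[OF alg_map.preimage_two_ideal[OF assms(1,2)], of chi] x by blast
qed

lemma anti_map_kills_U:
  assumes "anti_map fscale g" "two_ideal J"
    and rep: "U_rep rscale (bq chi) v" "\<And>x. residue J (g (letter x)) = swapEF v x"
    and x: "x \<in> U_rel_ideal chi"
  shows "g x \<in> J"
proof -
  have "g r \<in> J" if "r \<in> U_relations chi" for r
    by (rule residue_zeroD[OF assms(2)])
      (rule U_rep_anti_vanish[OF rep(1) alg_anti_map_comp[OF residue_alg_map assms(1)] rep(2) that])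
  then show ?thesis using U_rel_ideal(3)[OF anti_map.preimage_two_ideal[OF assms(1,2)], of chi] x by blast
qed

lemma the_alg_hom_subst:
  fixes t :: "'i gen \<Rightarrow> ('i::finite, 'k::field) falg"
  assumes "presented B \<pi> J" and kills: "\<And>x. x \<in> U_rel_ideal chi \<Longrightarrow> subst t x \<in> J"
  shows "the_alg_hom (U chi) B (maps_gens chi (\<lambda>g. \<pi> (t g))) (uproj chi x) = \<pi> (subst t x)"
proof -
  interpret B: presented B \<pi> J by fact
  interpret t: alg_map fscale "subst t" by (rule falg.eval_alg_map)
  note th = the_alg_hom_U[where s = "\<lambda>x. \<pi> (subst t x)" and B = B and chi = chi and x = x,
      unfolded falg.eval_letter]
  show ?thesis
    by (rule th)
      (auto simp: B.is_ring B.\<pi>_mult B.\<pi>_add B.\<pi>_one B.\<pi>_smult B.\<pi>_eq_iff t.mult t.add t.one t.scale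
        dest: kills simp flip: t.diff)
qed

lemma subst_diff: "subst t (x - y) = subst t x - subst t y"
proof -
  interpret t: alg_map fscale "subst t" by (rule falg.eval_alg_map)
  show ?thesis by (rule t.diff)
qed

lemma anti_subst_diff: "anti_subst t (x - y) = anti_subst t x - anti_subst t y"
proof -
  interpret t: anti_map fscale "anti_subst t" by (rule falg.anti_eval_anti_map)
  show ?thesis by (rule t.diff)
qed

abbreviation "resid J \<equiv> \<lambda>g. residue J (letter g)"

lemma residue_subst:
  "residue J (subst t (letter g)) = residue J (t g)"
  by (simp add: falg.eval_letter)

text \<open>
  Two homomorphisms agree modulo \<open>J\<close> if they agree on letters; this reduces each equation of the
  theorem to an identity of operations on valuations.
\<close>

lemma two_ideal_eqI:
  assumes J: "two_ideal J" and "alg_map rscale (\<lambda>x. residue J (g1 x))" "alg_map rscale (\<lambda>x. residue J (g2 x))"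
    and "\<And>l. residue J (g1 (letter l)) = residue J (g2 (letter l))"
  shows "g1 x - g2 x \<in> J"
proof (rule residue_zeroD[OF J])
  have "residue J (g1 x) = residue J (g2 x)" by (rule alg_map_eqI[OF assms(2,3,4)])
  then show "residue J (g1 x - g2 x) = 0" by (simp add: residue.diff)
qed

lemma two_ideal_anti_eqI:
  assumes J: "two_ideal J" and "anti_map rscale (\<lambda>x. residue J (g1 x))" "anti_map rscale (\<lambda>x. residue J (g2 x))"
    and "\<And>l. residue J (g1 (letter l)) = residue J (g2 (letter l))"
  shows "g1 x - g2 x \<in> J"
proof (rule residue_zeroD[OF J])
  have "residue J (g1 x) = residue J (g2 x)" by (rule anti_map_eqI[OF assms(2,3,4)])
  then show "residue J (g1 x - g2 x) = 0" by (simp add: residue.diff)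
qed

text \<open>
  The substitutions in the free algebra that induce $T_p$ and $T_p^-$.
\<close>

definition T_letters :: "('i::finite, 'k::field) bichar \<Rightarrow> 'i \<Rightarrow> 'i gen \<Rightarrow> ('i, 'k) falg" where
  "T_letters chi p = T_val fscale p (mcartan (bq chi) p) (mlambda (mreflect p (mcartan (bq chi) p) (bq chi)) p) letter"

definition Tminus_letters :: "('i::finite, 'k::field) bichar \<Rightarrow> 'i \<Rightarrow> 'i gen \<Rightarrow> ('i, 'k) falg" where
  "Tminus_letters chi p = Tminus_val fscale p (mcartan (bq chi) p)
     (mlambda (minverse (mreflect p (mcartan (bq chi) p) (bq chi))) p) letter"

lemma (in cartan_matrix) mcartan_reflect_all: "mcartan q' p = c"
proof
  show "mcartan q' p i = c i" for i
    by (cases "i = p") (simp add: mcartan_def q'_p, rule mcartan_reflect)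
qed

context bicharacter
begin

sublocale Q: presented "Uq chi p" "qp chi p" "serre_ideal chi p"
  by (rule Uq_presented[OF bichar])

lemma \<rho>: "bicharacter \<rho> p"
  by (rule reflect_bicharacter)

lemma resid_serre: "U_serre rscale (bq chi) (resid (serre_ideal chi p)) p"
  by (rule residue_serre) (unfold_locales, rule U_serre_relations_subset[OF bichar])

lemma resid_\<rho>_serre: "U_serre rscale (mreflect p mc (bq chi)) (resid (serre_ideal \<rho> p)) p"
  using bicharacter.resid_serre[OF \<rho>] by (simp add: bq_reflect)

text \<open>
  In $T_p : U(\chi) \to U(r_p(\chi))$ the target has the reflected matrix; reflecting once more gives back
  the matrix of the source.
\<close>

lemma T_letters_serre:
  "U_serre rscale (bq chi) (\<lambda>g. residue (serre_ideal \<rho> p) (T_letters chi p g)) p"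
proof -
  interpret S: U_serre rscale "mreflect p mc (bq chi)" "resid (serre_ideal \<rho> p)" p
    by (rule resid_\<rho>_serre)
  show ?thesis
    using S.T_val_serre
    by (simp add: T_letters_def residue.T_val M.mcartan_reflect_all M.mreflect_reflect[unfolded M.mcartan_reflect_all])
qed

lemma Tminus_letters_serre:
  "U_serre rscale (bq chi) (\<lambda>g. residue (serre_ideal \<rho> p) (Tminus_letters chi p g)) p"
proof -
  interpret S: U_serre rscale "mreflect p mc (bq chi)" "resid (serre_ideal \<rho> p)" p
    by (rule resid_\<rho>_serre)
  show ?thesis
    using S.Tminus_val_serre
    by (simp add: Tminus_letters_def residue.Tminus_val M.mcartan_reflect_all M.mreflect_reflect[unfolded M.mcartan_reflect_all])
qed

lemma J\<rho>: "two_ideal (serre_ideal \<rho> p)"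
  by (rule serre_ideal_two_ideal[OF bicharacter.bichar[OF \<rho>]])

lemma T_letters_kills: "x \<in> serre_ideal chi p \<Longrightarrow> subst (T_letters chi p) x \<in> serre_ideal \<rho> p"
  by (rule alg_map_kills[OF bicharacter_axioms falg.eval_alg_map J\<rho>])
    (simp_all add: falg.eval_letter T_letters_serre)

lemma Tminus_letters_kills: "x \<in> serre_ideal chi p \<Longrightarrow> subst (Tminus_letters chi p) x \<in> serre_ideal \<rho> p"
  by (rule alg_map_kills[OF bicharacter_axioms falg.eval_alg_map J\<rho>])
    (simp_all add: falg.eval_letter Tminus_letters_serre)

lemma U_rel_ideal_le: "U_rel_ideal chi \<subseteq> serre_ideal chi p"
  using U_serre_relations_subset[OF bichar, of p]
  by (intro U_rel_ideal(3) serre_ideal_two_ideal bichar) (auto simp: U_serre_relations_def)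

lemma all_gen_iff: "(\<forall>i. P i) \<longleftrightarrow> P p \<and> (\<forall>i. i \<noteq> p \<longrightarrow> P i)"
  by metis

lemma Lusztig_uproj: "Lusztig chi p (uproj chi x) = qp \<rho> p (subst (T_letters chi p) x)"
proof -
  interpret R: bicharacter \<rho> p by (rule \<rho>)
  have lam: "i \<noteq> p \<Longrightarrow> lambda \<rho> p i = mlambda (mreflect p mc (bq chi)) p i" for i
    by (simp add: R.lambda_mlambda bq_reflect)
  have "Lusztig chi p = the_alg_hom (U chi) (Uq \<rho> p) (maps_gens chi (\<lambda>g. qp \<rho> p (T_letters chi p g)))"
    unfolding Lusztig_def Let_def
    by (rule arg_cong[where f = "the_alg_hom _ _"], rule ext, unfold maps_gens_def, subst all_gen_iff)
      (auto simp: T_letters_def cartan_mcartan lam qp_def ugen_uproj uproj_qad U.\<pi>_mult U.\<pi>_power U.\<pi>_smult)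
  then show ?thesis
    using the_alg_hom_subst[OF R.Q.presented_axioms, of chi "T_letters chi p" x] T_letters_kills U_rel_ideal_le
    by auto
qed

lemma Lusztig_minus_uproj: "Lusztig_minus chi p (uproj chi x) = qp \<rho> p (subst (Tminus_letters chi p) x)"
proof -
  interpret R: bicharacter \<rho> p by (rule \<rho>)
  interpret I: bicharacter "bichar_inv \<rho>" p by (rule R.inv_bicharacter)
  have lam: "i \<noteq> p \<Longrightarrow> lambda (reflect (bichar_inv chi) p) p i = mlambda (minverse (mreflect p mc (bq chi))) p i" for i
    by (simp add: reflect_inv I.lambda_mlambda R.bq_inv bq_reflect)
  have sign: "(- 1) powi (- int n) = ((- 1) ^ n :: 'k)" for n
    by (simp add: power_int_def flip: power_inverse)
  have "Lusztig_minus chi p = the_alg_hom (U chi) (Uq \<rho> p) (maps_gens chi (\<lambda>g. qp \<rho> p (Tminus_letters chi p g)))"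
    unfolding Lusztig_minus_def Let_def
    by (rule arg_cong[where f = "the_alg_hom _ _"], rule ext, unfold maps_gens_def, subst all_gen_iff)
      (auto simp: Tminus_letters_def cartan_mcartan lam sign qp_def ugen_uproj uproj_qad U.\<pi>_mult U.\<pi>_power U.\<pi>_smult)
  then show ?thesis
    using the_alg_hom_subst[OF R.Q.presented_axioms, of chi "Tminus_letters chi p" x] Tminus_letters_kills U_rel_ideal_le
    by auto
qed

text \<open>
  The maps on \<open>Uq chi p\<close> are defined by choosing the only element of the image of a coset. This
  computes it for a map that is constant on cosets.
\<close>

lemma the_elem_qp:
  assumes "\<And>z. F (uproj chi z) = G z" "\<And>y z. y - z \<in> serre_ideal chi p \<Longrightarrow> G y = G z"
  shows "the_elem (F ` qp chi p x) = G x"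
proof -
  interpret I: ideal "I_both chi p" "U chi" by (rule I_both_ideal[OF bichar])
  have X: "qp chi p x = I_both chi p +>\<^bsub>U chi\<^esub> uproj chi x" by (simp add: qp_def qproj_def)
  have self: "uproj chi x \<in> qp chi p x"
    unfolding X by (rule I.a_rcos_self) simp
  have "F y = G x" if y: "y \<in> qp chi p x" for y
  proof -
    have "y \<in> carrier (U chi)"
      using y U.a_r_coset_subset_G[OF I.a_subset, of "uproj chi x"] by (auto simp: X)
    then obtain z where z: "y = uproj chi z" by (auto simp: U.carrier_B)
    have "I_both chi p +>\<^bsub>U chi\<^esub> uproj chi x = I_both chi p +>\<^bsub>U chi\<^esub> y"
      using y U.a_repr_independence[OF _ _ I.a_subgroup] by (simp add: X)
    then have "qp chi p z = qp chi p x" by (simp add: z qp_def qproj_def)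
    then show ?thesis using assms by (simp add: z Q.\<pi>_eq_iff)
  qed
  then have "F ` qp chi p x = {G x}"
    using image_eqI[of "G x" F, OF _ self] assms(1) by auto
  then show ?thesis by simp
qed

lemma Lusztig_q_qp: "Lusztig_q chi p (qp chi p x) = qp \<rho> p (subst (T_letters chi p) x)"
proof -
  interpret R: bicharacter \<rho> p by (rule \<rho>)
  show ?thesis
    unfolding Lusztig_q_def
    by (rule the_elem_qp[where G = "\<lambda>x. qp \<rho> p (subst (T_letters chi p) x)"])
      (auto simp: Lusztig_uproj R.Q.\<pi>_eq_iff simp flip: subst_diff intro: T_letters_kills)
qed

lemma Lusztig_minus_q_qp: "Lusztig_minus_q chi p (qp chi p x) = qp \<rho> p (subst (Tminus_letters chi p) x)"
proof -
  interpret R: bicharacter \<rho> p by (rule \<rho>)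
  show ?thesis
    unfolding Lusztig_minus_q_def
    by (rule the_elem_qp[where G = "\<lambda>x. qp \<rho> p (subst (Tminus_letters chi p) x)"])
      (auto simp: Lusztig_minus_uproj R.Q.\<pi>_eq_iff simp flip: subst_diff intro: Tminus_letters_kills)
qed

end

text \<open>
  The maps $\varphi_a$, $\phi_2$ and $\phi_3$ at once; \<open>w\<close> is the corresponding operation on valuations.
\<close>

lemma phi_uproj:
  fixes chi psi :: "('i::finite, 'k::field) bichar"
  assumes "is_bichar chi" "is_bichar psi" "\<And>v. U_rep rscale (bq psi) v \<Longrightarrow> U_rep rscale (bq chi) (w v)"
    "\<And>g. residue (U_rel_ideal psi) (t g) = w (resid (U_rel_ideal psi)) g"
  shows "the_alg_hom (U chi) (U psi) (maps_gens chi (\<lambda>g. uproj psi (t g))) (uproj chi x)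
    = uproj psi (subst t x)"
proof (rule the_alg_hom_subst[OF U_presented])
  fix x assume x: "x \<in> U_rel_ideal chi"
  show "subst t x \<in> U_rel_ideal psi"
  proof (rule alg_map_kills_U[OF falg.eval_alg_map U_rel_ideal(1) _ x])
    show "U_rep rscale (bq chi) (\<lambda>x. residue (U_rel_ideal psi) (subst t (letter x)))"
      using assms(3)[OF residue_U_rep[OF assms(2)]] by (simp add: residue_subst assms(4))
  qed
qed

context bicharacter
begin

lemma phi_diag_uproj:
  assumes "\<And>i. a i \<noteq> 0"
  shows "phi_diag chi a (uproj chi x) = uproj chi (subst (diag fscale a letter) x)"
proof -
  have "phi_diag chi a = the_alg_hom (U chi) (U chi) (maps_gens chi (\<lambda>g. uproj chi (diag fscale a letter g)))"
    by (simp add: phi_diag_def maps_gens_def[abs_def] ugen_uproj U.\<pi>_smult)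
  then show ?thesis
    using phi_uproj[where w = "diag rscale a" and t = "diag fscale a letter" and x = x,
        OF bichar bichar U_rep.diag_rep[OF _ assms]]
    by (simp add: residue.diag)
qed

lemma phi2_uproj: "phi2 chi (uproj chi x) = uproj (bichar_inv chi) (subst (twist2 letter) x)"
proof -
  interpret I: bicharacter "bichar_inv chi" p by (rule inv_bicharacter)
  have "phi2 chi = the_alg_hom (U chi) (U (bichar_inv chi))
      (maps_gens chi (\<lambda>g. uproj (bichar_inv chi) (twist2 letter g)))"
    by (simp add: phi2_def maps_gens_def[abs_def] Let_def ugen_uproj U.\<pi>_uminus)
  moreover have rep: "U_rep rscale (bq chi) (twist2 v)" if "U_rep rscale (bq (bichar_inv chi)) v" for v
    using U_rep.twist2_rep[OF that] by (simp add: bq_inv)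
  ultimately show ?thesis
    using phi_uproj[where w = twist2 and t = "twist2 letter" and x = x, OF bichar I.bichar rep]
    by (simp add: residue.twist2)
qed

lemma phi3_uproj: "phi3 chi (uproj chi x) = uproj (bichar_op chi) (subst (twist3 letter) x)"
proof -
  interpret I: bicharacter "bichar_op chi" p by (rule op_bicharacter)
  have "phi3 chi = the_alg_hom (U chi) (U (bichar_op chi))
      (maps_gens chi (\<lambda>g. uproj (bichar_op chi) (twist3 letter g)))"
    by (simp add: phi3_def maps_gens_def[abs_def] Let_def ugen_uproj)
  moreover have rep: "U_rep rscale (bq chi) (twist3 v)" if "U_rep rscale (bq (bichar_op chi)) v" for v
    using U_rep.twist3_rep[OF that] by (simp add: bq_op)
  ultimately show ?thesis
    using phi_uproj[where w = twist3 and t = "twist3 letter" and x = x, OF bichar I.bichar rep]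
    by (simp add: twist3_nat[of "residue _"])
qed

lemma phi4_uproj: "phi4 chi (uproj chi x) = uproj chi (anti_subst (swapEF letter) x)"
proof -
  let ?s = "\<lambda>x. uproj chi (anti_subst (swapEF letter) x)" and ?B = "opposite_alg (U chi)"
  interpret t: anti_map fscale "anti_subst (swapEF letter :: 'i gen \<Rightarrow> ('i, 'k) falg)"
    by (rule falg.anti_eval_anti_map)
  have kills: "anti_subst (swapEF letter) x \<in> U_rel_ideal chi" if "x \<in> U_rel_ideal chi" for x
    by (rule anti_map_kills_U[OF t.anti_map_axioms U_rel_ideal(1) residue_U_rep[OF bichar] _ that])
      (simp add: falg.anti_eval_letter swapEF_nat[of "residue _"])
  have ring: "ring ?B"
  proof (rule ringI)
    show "abelian_group ?B"
      using U.abelian_group_axioms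
      unfolding abelian_group_def abelian_monoid_def abelian_group_axioms_def opposite_alg_def by simp
    show "Group.monoid ?B"
      by (rule monoidI) (auto simp: opposite_alg_def U.m_assoc)
  qed (auto simp: opposite_alg_def U.l_distr U.r_distr)
  let ?P = "maps_gens chi (\<lambda>g. ?s (letter g))"
  have "phi4 chi = the_alg_hom (U chi) ?B ?P"
    by (simp add: phi4_def maps_gens_def[abs_def] ugen_uproj falg.anti_eval_letter)
  moreover have "the_alg_hom (U chi) ?B ?P (uproj chi x) = ?s x"
  proof (rule the_alg_hom_U[where s = ?s, OF ring])
    fix x y :: "('i, 'k) falg" and c :: 'k
    show "?s x \<in> carrier ?B" by (simp add: opposite_alg_def)
    show "?s (x * y) = ?s x \<otimes>\<^bsub>?B\<^esub> ?s y" by (simp add: opposite_alg_def U.\<pi>_mult t.mult)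
    show "?s (x + y) = ?s x \<oplus>\<^bsub>?B\<^esub> ?s y" by (simp add: opposite_alg_def U.\<pi>_add t.add)
    show "?s 1 = \<one>\<^bsub>?B\<^esub>" by (simp add: opposite_alg_def U.\<pi>_one t.one)
    show "?s (fscale c x) = c \<odot>\<^bsub>?B\<^esub> ?s x" by (simp add: opposite_alg_def U.\<pi>_smult t.scale)
    assume "x - y \<in> U_rel_ideal chi"
    then show "?s x = ?s y" using kills[of "x - y"] by (simp add: U.\<pi>_eq_iff t.diff)
  qed
  ultimately show ?thesis by (simp only:)
qed

lemma phi_q:
  assumes "bicharacter psi p" "\<And>x. f (uproj chi x) = uproj psi (g x)"
    "\<And>x y. g (x - y) = g x - g y" "\<And>x. x \<in> serre_ideal chi p \<Longrightarrow> g x \<in> serre_ideal psi p"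
  shows "induced_q psi p f (qp chi p x) = qp psi p (g x)"
proof -
  interpret R: bicharacter psi p by fact
  show ?thesis
    unfolding induced_q_def
    by (rule the_elem_qp[where G = "\<lambda>x. qp psi p (g x)"])
      (auto simp: assms(2) R.Q.\<pi>_eq_iff qp_def[symmetric] simp flip: assms(3) intro: assms(4))
qed

lemma phi_diag_q_qp:
  assumes "\<And>i. a i \<noteq> 0"
  shows "phi_diag_q chi p a (qp chi p x) = qp chi p (subst (diag fscale a letter) x)"
  unfolding phi_diag_q_def
proof (rule phi_q[OF _ phi_diag_uproj[OF assms] subst_diff])
  show bi: "bicharacter chi p" by unfold_locales
  fix x assume x: "x \<in> serre_ideal chi p"
  show "subst (diag fscale a letter) x \<in> serre_ideal chi p"
    by (rule alg_map_kills[OF bi falg.eval_alg_map Q.J _ x])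
      (use U_serre.diag_serre[OF resid_serre, of a] assms in \<open>simp add: residue_subst residue.diag\<close>)
qed

lemma phi2_q_qp: "phi2_q chi p (qp chi p x) = qp (bichar_inv chi) p (subst (twist2 letter) x)"
  unfolding phi2_q_def
proof (rule phi_q[OF inv_bicharacter phi2_uproj subst_diff])
  interpret I: bicharacter "bichar_inv chi" p by (rule inv_bicharacter)
  fix x assume x: "x \<in> serre_ideal chi p"
  show "subst (twist2 letter) x \<in> serre_ideal (bichar_inv chi) p"
    by (rule alg_map_kills[OF bicharacter_axioms falg.eval_alg_map I.Q.J _ x])
      (use U_serre.twist2_serre[OF I.resid_serre] in \<open>simp add: residue_subst residue.twist2 bq_inv\<close>)
qed

lemma phi3_q_qp: "phi3_q chi p (qp chi p x) = qp (bichar_op chi) p (subst (twist3 letter) x)"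
  unfolding phi3_q_def
proof (rule phi_q[OF op_bicharacter phi3_uproj subst_diff])
  interpret I: bicharacter "bichar_op chi" p by (rule op_bicharacter)
  fix x assume x: "x \<in> serre_ideal chi p"
  show "subst (twist3 letter) x \<in> serre_ideal (bichar_op chi) p"
    by (rule alg_map_kills[OF bicharacter_axioms falg.eval_alg_map I.Q.J _ x])
      (use U_serre.twist3_serre[OF I.resid_serre] in \<open>simp add: residue_subst twist3_nat[of "residue _"] bq_op\<close>)
qed

lemma phi4_q_qp: "phi4_q chi p (qp chi p x) = qp chi p (anti_subst (swapEF letter) x)"
  unfolding phi4_q_def
proof (rule phi_q[OF bicharacter_axioms phi4_uproj anti_subst_diff])
  fix x assume x: "x \<in> serre_ideal chi p"
  show "anti_subst (swapEF letter) x \<in> serre_ideal chi p"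
    by (rule anti_map_kills[OF bicharacter_axioms falg.anti_eval_anti_map Q.J resid_serre _ x])
      (simp add: falg.anti_eval_letter swapEF_nat[of "residue _"])
qed

end


section \<open>The Lusztig isomorphisms\<close>

text \<open>
  The relation with $\phi_4$ on generators. Since \<open>f\<close> reverses products, the Cartan factors have to be
  commuted past each other and past $E_p$, $F_p$, which is the source of the scalar at \<open>p\<close>.
\<close>

lemma (in U_serre) swapEF_T_val:
  assumes "anti_map scale f" and f: "\<And>l. f (letter l) = swapEF v l"
  shows "swapEF (T_val scale p c (mlambda q p) v) g
    = diag scale anti_coef (\<lambda>l. f (Tminus_val fscale p c (mlambda (minverse q) p) letter l)) g"
proof -
  interpret f: anti_map scale f by fact
  have comm: "v y ^ n * v x = v x * v y ^ n" if "x \<in> cartan_gens" "y \<in> cartan_gens" for x y n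
    by (rule power_commuting_commutes) (rule cartan_comm[OF that(2,1)])
  have 1: "E p * Ki p = q p p \<cdot> (Ki p * E p)"
    using qcm_inverse_left[OF KE q_nz K_Ki Ki_K, of p p] q_nz by (simp add: qcm_def)
  have 2: "F p * Li p = q p p \<cdot> (Li p * F p)"
    using qcm_inverse_left[OF LF q_nz L_Li Li_L, of p p] q_nz by (simp add: qcm_def)
  show ?thesis
  proof (cases g)
    case (gE i)
    show ?thesis
    proof (cases "i = p")
      case True
      then show ?thesis using gE 1 q_nz by (simp add: f.mult f anti_coef_def)
    next
      case False
      then show ?thesis using gE anti_E[OF False] by (simp add: f.scale f.qad f qad_XF)
    qed
  next
    case (gF i)
    show ?thesis
    proof (cases "i = p")
      case True
      then show ?thesis using gF 2 by (simp add: f.mult f anti_coef_def)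
    next
      case False
      then show ?thesis using gF anti_F[OF False] by (simp add: f.scale f.qad f qad_XE)
    qed
  qed (simp_all add: f.mult f.power f comm)
qed

lemma (in anti_map) diag: "f (diag fscale a v g) = diag scale a (\<lambda>x. f (v x)) g"
  by (cases g) (simp_all add: scale)

lemma presented_alg_hom:
  assumes "presented A \<pi> I" "presented B \<pi>' I'" "alg_map fscale g" "\<And>x. F (\<pi> x) = \<pi>' (g x)"
  shows "F \<in> alg_hom A B"
proof -
  interpret A: presented A \<pi> I by fact
  interpret B: presented B \<pi>' I' by fact
  interpret g: alg_map fscale g by fact
  show ?thesis
    unfolding alg_hom_def ring_hom_def
    by (auto simp: A.carrier_B A.\<pi>_mult A.\<pi>_add A.\<pi>_one A.\<pi>_smult assms(4)
        B.\<pi>_mult B.\<pi>_add B.\<pi>_one B.\<pi>_smult g.mult g.add g.one g.scale)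
qed

lemma alg_map_residue_subst: "alg_map rscale (\<lambda>x. residue J (subst t x))"
  by (rule alg_map_comp[OF residue_alg_map falg.eval_alg_map])

lemma alg_map_residue_subst2: "alg_map rscale (\<lambda>x. residue J (subst t (subst u x)))"
  by (rule alg_map_comp[OF alg_map_residue_subst falg.eval_alg_map])

lemma alg_map_residue_subst3: "alg_map rscale (\<lambda>x. residue J (subst t (subst u (subst w x))))"
  by (rule alg_map_comp[OF alg_map_residue_subst2 falg.eval_alg_map])

text \<open>
  Composites of \<open>residue J\<close> with substitutions are again homomorphisms, so the operations on valuations
  commute with them.
\<close>

interpretation rs: alg_map rscale "\<lambda>x. residue J (subst t x)" for J t
  by (rule alg_map_residue_subst)

interpretation rs2: alg_map rscale "\<lambda>x. residue J (subst t (subst u x))" for J t u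
  by (rule alg_map_residue_subst2)

context bicharacter
begin

abbreviation (input) "q\<rho> \<equiv> mreflect p mc (bq chi)"

lemma T_letters_eq: "T_letters chi p = T_val fscale p mc (mlambda q\<rho> p) letter"
  and Tminus_letters_eq: "Tminus_letters chi p = Tminus_val fscale p mc (mlambda (minverse q\<rho>) p) letter"
  and T_letters_\<rho>: "T_letters \<rho> p = T_val fscale p mc (mlambda (bq chi) p) letter"
  and Tminus_letters_\<rho>: "Tminus_letters \<rho> p = Tminus_val fscale p mc (mlambda (minverse (bq chi)) p) letter"
  by (simp_all add: T_letters_def Tminus_letters_def bq_reflect M.mcartan_reflect_all
      M.mreflect_reflect[unfolded M.mcartan_reflect_all])

lemma qpI:
  assumes "alg_map rscale (\<lambda>x. residue (serre_ideal chi p) (g1 x))"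
    "alg_map rscale (\<lambda>x. residue (serre_ideal chi p) (g2 x))"
    "\<And>l. residue (serre_ideal chi p) (g1 (letter l)) = residue (serre_ideal chi p) (g2 (letter l))"
  shows "qp chi p (g1 x) = qp chi p (g2 x)"
  using two_ideal_eqI[OF Q.J assms] by (simp add: Q.\<pi>_eq_iff)

lemma qp_antiI:
  assumes "anti_map rscale (\<lambda>x. residue (serre_ideal chi p) (g1 x))"
    "anti_map rscale (\<lambda>x. residue (serre_ideal chi p) (g2 x))"
    "\<And>l. residue (serre_ideal chi p) (g1 (letter l)) = residue (serre_ideal chi p) (g2 (letter l))"
  shows "qp chi p (g1 x) = qp chi p (g2 x)"
  using two_ideal_anti_eqI[OF Q.J assms] by (simp add: Q.\<pi>_eq_iff)

lemma Lusztig_q_Lusztig_minus_q: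
  assumes "X \<in> carrier (Uq chi p)"
  shows "Lusztig_q \<rho> p (Lusztig_minus_q chi p X) = X"
    and "Lusztig_minus_q \<rho> p (Lusztig_q chi p X) = X"
proof -
  interpret R: bicharacter \<rho> p by (rule \<rho>)
  interpret S: U_serre rscale "bq chi" "resid (serre_ideal chi p)" p by (rule resid_serre)
  obtain x where x: "X = qp chi p x" using assms by (auto simp: Q.carrier_B)
  have "qp chi p (subst (T_letters \<rho> p) (subst (Tminus_letters chi p) x)) = qp chi p x"
    by (rule qpI[OF alg_map_residue_subst2 residue_alg_map])
      (simp only: falg.eval_letter Tminus_letters_eq rs.Tminus_val T_letters_\<rho> residue.T_val S.Tminus_val_T_val_inverse)
  then show "Lusztig_q \<rho> p (Lusztig_minus_q chi p X) = X"
    by (simp add: x Lusztig_minus_q_qp R.Lusztig_q_qp reflect_reflect)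
  have "qp chi p (subst (Tminus_letters \<rho> p) (subst (T_letters chi p) x)) = qp chi p x"
    by (rule qpI[OF alg_map_residue_subst2 residue_alg_map])
      (simp only: falg.eval_letter T_letters_eq rs.T_val Tminus_letters_\<rho> residue.Tminus_val S.T_val_Tminus_val_inverse)
  then show "Lusztig_minus_q \<rho> p (Lusztig_q chi p X) = X"
    by (simp add: x Lusztig_q_qp R.Lusztig_minus_q_qp reflect_reflect)
qed

text \<open>
  Each of the two maps has the other one, taken for the reflected bicharacter, as a two-sided inverse.
\<close>

lemma Lusztig_q_iso: "Lusztig_q chi p \<in> alg_iso (Uq chi p) (Uq \<rho> p)"
  and Lusztig_minus_q_iso: "Lusztig_minus_q chi p \<in> alg_iso (Uq chi p) (Uq \<rho> p)"
proof -
  interpret R: bicharacter \<rho> p by (rule \<rho>)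
  note inv = Lusztig_q_Lusztig_minus_q and inv' = R.Lusztig_q_Lusztig_minus_q[unfolded reflect_reflect]
  have h: "Lusztig_q chi p \<in> alg_hom (Uq chi p) (Uq \<rho> p)" "Lusztig_minus_q chi p \<in> alg_hom (Uq chi p) (Uq \<rho> p)"
    by (rule presented_alg_hom[OF Q.presented_axioms R.Q.presented_axioms falg.eval_alg_map];
        rule Lusztig_q_qp Lusztig_minus_q_qp)+
  have r: "Lusztig_q \<rho> p ` carrier (Uq \<rho> p) \<subseteq> carrier (Uq chi p)"
    "Lusztig_minus_q \<rho> p ` carrier (Uq \<rho> p) \<subseteq> carrier (Uq chi p)"
    "Lusztig_q chi p ` carrier (Uq chi p) \<subseteq> carrier (Uq \<rho> p)"
    "Lusztig_minus_q chi p ` carrier (Uq chi p) \<subseteq> carrier (Uq \<rho> p)"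
    by (auto simp: Q.carrier_B R.Q.carrier_B Lusztig_q_qp Lusztig_minus_q_qp R.Lusztig_q_qp
        R.Lusztig_minus_q_qp reflect_reflect)
  have "bij_betw (Lusztig_q chi p) (carrier (Uq chi p)) (carrier (Uq \<rho> p))"
    by (rule bij_betw_byWitness[where f' = "Lusztig_minus_q \<rho> p"]) (use inv inv' r in auto)
  then show "Lusztig_q chi p \<in> alg_iso (Uq chi p) (Uq \<rho> p)" using h by (simp add: alg_iso_def)
  have "bij_betw (Lusztig_minus_q chi p) (carrier (Uq chi p)) (carrier (Uq \<rho> p))"
    by (rule bij_betw_byWitness[where f' = "Lusztig_q \<rho> p"]) (use inv inv' r in auto)
  then show "Lusztig_minus_q chi p \<in> alg_iso (Uq chi p) (Uq \<rho> p)" using h by (simp add: alg_iso_def)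
qed

lemma Lusztig_induces:
  "induces (U chi) (I_both chi p) (Lusztig chi p) (Lusztig_q chi p)"
  "induces (U chi) (I_both chi p) (Lusztig_minus chi p) (Lusztig_minus_q chi p)"
  unfolding induces_def U.carrier_B
  by (auto simp: Lusztig_uproj Lusztig_minus_uproj simp flip: qproj_def qp_def Lusztig_q_qp Lusztig_minus_q_qp)

lemma Lusztig_phi_diag:
  assumes a: "\<And>i. a i \<noteq> 0" and b: "\<And>i. b i = a i * a p powi (- cartan chi p i)"
    and X: "X \<in> carrier (Uq chi p)"
  shows "Lusztig_q chi p (phi_diag_q chi p a X) = phi_diag_q \<rho> p b (Lusztig_q chi p X)"
    and "Lusztig_minus_q chi p (phi_diag_q chi p a X) = phi_diag_q \<rho> p b (Lusztig_minus_q chi p X)"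
proof -
  interpret R: bicharacter \<rho> p by (rule \<rho>)
  obtain x where x: "X = qp chi p x" using X by (auto simp: Q.carrier_B)
  have b': "b i = a i * (if i = p then inverse (a p * a p) else a p ^ mc i)" for i
    using b by (auto simp: cartan_p cartan_mcartan power_int_minus power2_eq_square)
  have bnz: "b i \<noteq> 0" for i using a by (simp add: b')
  have "qp \<rho> p (subst (T_letters chi p) (subst (diag fscale a letter) x))
    = qp \<rho> p (subst (diag fscale b letter) (subst (T_letters chi p) x))"
    by (rule R.qpI[OF alg_map_residue_subst2 alg_map_residue_subst2])
      (simp only: falg.eval_letter T_letters_eq rs.T_val rs.diag residue.T_val residue.diag
        residues.T_val_diag[where a = a and b = b, OF b' a])
  then show "Lusztig_q chi p (phi_diag_q chi p a X) = phi_diag_q \<rho> p b (Lusztig_q chi p X)"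
    by (simp add: x phi_diag_q_qp[OF a] R.phi_diag_q_qp[OF bnz] Lusztig_q_qp)
  have "qp \<rho> p (subst (Tminus_letters chi p) (subst (diag fscale a letter) x))
    = qp \<rho> p (subst (diag fscale b letter) (subst (Tminus_letters chi p) x))"
    by (rule R.qpI[OF alg_map_residue_subst2 alg_map_residue_subst2])
      (simp only: falg.eval_letter Tminus_letters_eq rs.Tminus_val rs.diag residue.Tminus_val residue.diag
        residues.Tminus_val_diag[where a = a and b = b, OF b' a])
  then show "Lusztig_minus_q chi p (phi_diag_q chi p a X) = phi_diag_q \<rho> p b (Lusztig_minus_q chi p X)"
    by (simp add: x phi_diag_q_qp[OF a] R.phi_diag_q_qp[OF bnz] Lusztig_minus_q_qp)
qed

lemma Lusztig_phi2:
  assumes X: "X \<in> carrier (Uq chi p)"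
  shows "Lusztig_q (bichar_inv chi) p (phi2_q chi p X)
    = phi2_q \<rho> p (Lusztig_minus_q chi p (phi_diag_q chi p (\<lambda>i. if i = p then - 1 else 1) X))"
proof -
  interpret R: bicharacter \<rho> p by (rule \<rho>)
  interpret I: bicharacter "bichar_inv chi" p by (rule inv_bicharacter)
  interpret RI: bicharacter "bichar_inv \<rho>" p by (rule R.inv_bicharacter)
  obtain x where x: "X = qp chi p x" using X by (auto simp: Q.carrier_B)
  have t: "T_letters (bichar_inv chi) p = T_val fscale p mc (mlambda (minverse q\<rho>) p) letter"
    by (simp add: I.T_letters_eq bq_inv M.mcartan_inverse M.mreflect_inverse)
  let ?a = "\<lambda>i. if i = p then - 1 else 1 :: 'k"
  have "qp (bichar_inv \<rho>) p (subst (T_letters (bichar_inv chi) p) (subst (twist2 letter) x))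
    = qp (bichar_inv \<rho>) p (subst (twist2 letter) (subst (Tminus_letters chi p) (subst (diag fscale ?a letter) x)))"
    by (rule RI.qpI[OF alg_map_residue_subst2 alg_map_residue_subst3])
      (simp only: falg.eval_letter t Tminus_letters_eq rs2.diag rs.Tminus_val rs.twist2 residue.T_val residue.twist2
        residues.twist2_T_val)
  then show ?thesis
    by (simp add: x phi2_q_qp phi_diag_q_qp Lusztig_minus_q_qp R.phi2_q_qp I.Lusztig_q_qp reflect_inv)
qed

lemma Lusztig_phi3:
  assumes X: "X \<in> carrier (Uq chi p)"
  shows "Lusztig_q (bichar_op chi) p (phi3_q chi p X)
    = phi3_q \<rho> p (Lusztig_q chi p (phi_diag_q chi p
        (\<lambda>i. if i = p then inverse (bq chi p p) else inverse (lambda \<rho> p i)) X))"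
    and "Lusztig_minus_q (bichar_op chi) p (phi3_q chi p X)
    = phi3_q \<rho> p (Lusztig_minus_q chi p (phi_diag_q chi p
        (\<lambda>i. if i = p then inverse (bq chi p p)
             else (- 1) powi (cartan chi p i) * lambda (reflect (bichar_inv chi) p) p i) X))"
proof -
  interpret R: bicharacter \<rho> p by (rule \<rho>)
  interpret O: bicharacter "bichar_op chi" p by (rule op_bicharacter)
  interpret RO: bicharacter "bichar_op \<rho>" p by (rule R.op_bicharacter)
  interpret RI: bicharacter "bichar_inv \<rho>" p by (rule R.inv_bicharacter)
  let ?v = "resid (serre_ideal (bichar_op \<rho>) p) :: 'i gen \<Rightarrow> _"
  have bqRO: "bq (bichar_op \<rho>) = mtranspose q\<rho>"
    by (simp add: R.bq_op bq_reflect)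
  interpret S: U_serre rscale "mtranspose q\<rho>" ?v p
    using RO.resid_serre unfolding bqRO .
  interpret C: cartan_matrix q\<rho> p by (rule M.reflect_matrix)
  interpret CI: cartan_matrix "minverse q\<rho>" p by (rule C.inverse_matrix)
  obtain x where x: "X = qp chi p x" using X by (auto simp: Q.carrier_B)
  have t: "T_letters (bichar_op chi) p = T_val fscale p mc (mlambda q\<rho> p) letter"
    by (simp add: O.T_letters_eq bq_op M.mcartan_transpose M.mreflect_transpose)
      (simp add: C.mlambda_transpose[abs_def])
  have tm: "Tminus_letters (bichar_op chi) p = Tminus_val fscale p mc (mlambda (minverse q\<rho>) p) letter"
    by (simp add: O.Tminus_letters_eq bq_op M.mcartan_transpose M.mreflect_transpose)
      (simp add: CI.mlambda_transpose[abs_def])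
  have lam: "lambda \<rho> p i = mlambda q\<rho> p i" "lambda (reflect (bichar_inv chi) p) p i = mlambda (minverse q\<rho>) p i"
    if "i \<noteq> p" for i
    using that by (simp_all add: R.lambda_mlambda bq_reflect reflect_inv RI.lambda_mlambda R.bq_inv)
  have sign: "(- 1) powi (cartan chi p i) = ((- 1) ^ mc i :: 'k)" if "i \<noteq> p" for i
    using that by (simp add: cartan_mcartan power_int_def flip: power_inverse)
  let ?a = "\<lambda>i. if i = p then inverse (bq chi p p) else inverse (mlambda q\<rho> p i)"
  have a: "(\<lambda>i. if i = p then inverse (bq chi p p) else inverse (lambda \<rho> p i)) = ?a"
    by (auto simp: lam)
  have anz: "?a i \<noteq> 0" for i using C.mlambda_nonzero by simp
  have 1: "twist3 (T_val rscale p mc (mlambda q\<rho> p) ?v) = diag rscale ?a (T_val rscale p mc (mlambda q\<rho> p) (twist3 ?v))"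
    using S.twist3_T_val[of p "mlambda q\<rho> p" mc] C.mlambda_nonzero by (simp add: M.q'_p cong: if_cong)
  have "qp (bichar_op \<rho>) p (subst (T_letters (bichar_op chi) p) (subst (twist3 letter) x))
    = qp (bichar_op \<rho>) p (subst (twist3 letter) (subst (T_letters chi p) (subst (diag fscale ?a letter) x)))"
    by (rule RO.qpI[OF alg_map_residue_subst2 alg_map_residue_subst3])
      (simp only: falg.eval_letter t T_letters_eq rs2.diag rs.T_val twist3_nat[where f = "\<lambda>x. residue _ (subst _ x)"]
        twist3_nat[where f = "residue _"] residue.T_val 1)
  then show "Lusztig_q (bichar_op chi) p (phi3_q chi p X)
    = phi3_q \<rho> p (Lusztig_q chi p (phi_diag_q chi p
        (\<lambda>i. if i = p then inverse (bq chi p p) else inverse (lambda \<rho> p i)) X))"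
    unfolding a by (simp add: x phi3_q_qp phi_diag_q_qp[OF anz] Lusztig_q_qp R.phi3_q_qp O.Lusztig_q_qp reflect_op)
  let ?b = "\<lambda>i. if i = p then inverse (bq chi p p) else (- 1) ^ mc i * mlambda (minverse q\<rho>) p i"
  have b: "(\<lambda>i. if i = p then inverse (bq chi p p)
      else (- 1) powi (cartan chi p i) * lambda (reflect (bichar_inv chi) p) p i) = ?b"
    by (auto simp: lam sign)
  have bnz: "?b i \<noteq> 0" for i using CI.mlambda_nonzero by simp
  have 2: "twist3 (Tminus_val rscale p mc (mlambda (minverse q\<rho>) p) ?v)
    = diag rscale ?b (Tminus_val rscale p mc (mlambda (minverse q\<rho>) p) (twist3 ?v))"
    using S.twist3_Tminus_val[of p "mlambda (minverse q\<rho>) p" mc] CI.mlambda_nonzero by (simp add: M.q'_p cong: if_cong)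
  have "qp (bichar_op \<rho>) p (subst (Tminus_letters (bichar_op chi) p) (subst (twist3 letter) x))
    = qp (bichar_op \<rho>) p (subst (twist3 letter) (subst (Tminus_letters chi p) (subst (diag fscale ?b letter) x)))"
    by (rule RO.qpI[OF alg_map_residue_subst2 alg_map_residue_subst3])
      (simp only: falg.eval_letter tm Tminus_letters_eq rs2.diag rs.Tminus_val twist3_nat[where f = "\<lambda>x. residue _ (subst _ x)"]
        twist3_nat[where f = "residue _"] residue.Tminus_val 2)
  then show "Lusztig_minus_q (bichar_op chi) p (phi3_q chi p X)
    = phi3_q \<rho> p (Lusztig_minus_q chi p (phi_diag_q chi p
        (\<lambda>i. if i = p then inverse (bq chi p p)
             else (- 1) powi (cartan chi p i) * lambda (reflect (bichar_inv chi) p) p i) X))"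
    unfolding b by (simp add: x phi3_q_qp phi_diag_q_qp[OF bnz] Lusztig_minus_q_qp R.phi3_q_qp O.Lusztig_minus_q_qp reflect_op)
qed

lemma Lusztig_phi4:
  "\<exists>a. (\<forall>i. a i \<noteq> 0) \<and> (\<forall>X\<in>carrier (Uq chi p).
      Lusztig_q chi p (phi4_q chi p X) = phi4_q \<rho> p (Lusztig_minus_q chi p (phi_diag_q chi p a X)))"
proof -
  interpret R: bicharacter \<rho> p by (rule \<rho>)
  let ?J = "serre_ideal \<rho> p"
  interpret S: U_serre rscale q\<rho> "resid ?J" p by (rule resid_\<rho>_serre)
  let ?s = "anti_subst (swapEF letter :: 'i gen \<Rightarrow> ('i, 'k) falg)"
  have anti: "anti_map rscale (\<lambda>x. residue ?J (?s x))"
    by (rule alg_anti_map_comp[OF residue_alg_map falg.anti_eval_anti_map])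
  have anti2: "anti_map rscale (\<lambda>x. residue ?J (?s (subst t x)))" for t :: "'i gen \<Rightarrow> ('i, 'k) falg"
    by (rule anti_alg_map_comp[OF anti falg.eval_alg_map])
  have anti3: "anti_map rscale (\<lambda>x. residue ?J (?s (subst t (subst u x))))" for t u :: "'i gen \<Rightarrow> ('i, 'k) falg"
    by (rule anti_alg_map_comp[OF anti2 falg.eval_alg_map])
  have anti4: "anti_map rscale (\<lambda>x. residue ?J (subst t (?s x)))" for t :: "'i gen \<Rightarrow> ('i, 'k) falg"
    by (rule alg_anti_map_comp[OF alg_map_residue_subst falg.anti_eval_anti_map])
  have f: "residue ?J (?s (letter l)) = swapEF (resid ?J) l" for l
    by (simp add: falg.anti_eval_letter swapEF_nat[of "residue _"])
  have "Lusztig_q chi p (phi4_q chi p X) = phi4_q \<rho> p (Lusztig_minus_q chi p (phi_diag_q chi p S.anti_coef X))"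
    if "X \<in> carrier (Uq chi p)" for X
  proof -
    obtain x where x: "X = qp chi p x" using \<open>X \<in> carrier (Uq chi p)\<close> by (auto simp: Q.carrier_B)
    have "residue ?J (subst (T_letters chi p) (?s (letter l)))
      = residue ?J (?s (subst (Tminus_letters chi p) (subst (diag fscale S.anti_coef letter) (letter l))))" for l
    proof -
      have "residue ?J (subst (T_letters chi p) (?s (letter l)))
        = swapEF (T_val rscale p mc (mlambda q\<rho> p) (resid ?J)) l"
        by (simp only: falg.anti_eval_letter swapEF_nat[where f = "\<lambda>x. residue _ (subst _ x)"]
            falg.eval_letter T_letters_eq residue.T_val)
      also have "\<dots> = diag rscale S.anti_coef (\<lambda>l. residue ?J (?s (Tminus_letters chi p l))) l"
        using S.swapEF_T_val[OF anti f, of l] by (simp only: M.mcartan_reflect_all Tminus_letters_eq)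
      also have "\<dots> = residue ?J (?s (subst (Tminus_letters chi p) (subst (diag fscale S.anti_coef letter) (letter l))))"
        by (simp only: falg.eval_letter anti_map.diag[OF anti2])
      finally show ?thesis .
    qed
    then have "qp \<rho> p (subst (T_letters chi p) (?s x))
      = qp \<rho> p (?s (subst (Tminus_letters chi p) (subst (diag fscale S.anti_coef letter) x)))"
      by (rule R.qp_antiI[OF anti4 anti3])
    then show ?thesis
      by (simp add: x phi4_q_qp phi_diag_q_qp S.anti_coef_nz Lusztig_minus_q_qp Lusztig_q_qp R.phi4_q_qp)
  qed
  then show ?thesis using S.anti_coef_nz by blast
qed

end

theorem proposition6p8:
  fixes chi :: "('i::finite, 'k::field) bichar" and p :: 'i
  assumes "is_bichar chi" and "p_finite chi p"
  shows
    "(induces (U chi) (I_both chi p) (Lusztig chi p) (Lusztig_q chi p)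
       \<and> Lusztig_q chi p \<in> alg_iso (Uq chi p) (Uq (reflect chi p) p)
       \<and> induces (U chi) (I_both chi p) (Lusztig_minus chi p) (Lusztig_minus_q chi p)
       \<and> Lusztig_minus_q chi p \<in> alg_iso (Uq chi p) (Uq (reflect chi p) p))
     \<and> (\<forall>X\<in>carrier (Uq chi p).
          Lusztig_q (reflect chi p) p (Lusztig_minus_q chi p X) = X
          \<and> Lusztig_minus_q (reflect chi p) p (Lusztig_q chi p X) = X)
     \<and> (\<forall>a b. (\<forall>i. a i \<noteq> 0) \<and> (\<forall>i. b i = a i * a p powi (- cartan chi p i)) \<longrightarrow>
          (\<forall>X\<in>carrier (Uq chi p).
             Lusztig_q chi p (phi_diag_q chi p a X)
               = phi_diag_q (reflect chi p) p b (Lusztig_q chi p X)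
             \<and> Lusztig_minus_q chi p (phi_diag_q chi p a X)
               = phi_diag_q (reflect chi p) p b (Lusztig_minus_q chi p X)))
     \<and> (\<forall>X\<in>carrier (Uq chi p).
          Lusztig_q (bichar_inv chi) p (phi2_q chi p X)
            = phi2_q (reflect chi p) p (Lusztig_minus_q chi p
                (phi_diag_q chi p (\<lambda>i. if i = p then -1 else 1) X)))
     \<and> (\<forall>X\<in>carrier (Uq chi p).
          Lusztig_q (bichar_op chi) p (phi3_q chi p X)
            = phi3_q (reflect chi p) p (Lusztig_q chi p
                (phi_diag_q chi p
                  (\<lambda>i. if i = p then inverse (bq chi p p)
                       else inverse (lambda (reflect chi p) p i)) X)))
     \<and> (\<forall>X\<in>carrier (Uq chi p).
          Lusztig_minus_q (bichar_op chi) p (phi3_q chi p X)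
            = phi3_q (reflect chi p) p (Lusztig_minus_q chi p
                (phi_diag_q chi p
                  (\<lambda>i. if i = p then inverse (bq chi p p)
                       else (-1) powi (cartan chi p i)
                              * lambda (reflect (bichar_inv chi) p) p i) X)))
     \<and> (\<exists>a. (\<forall>i. a i \<noteq> 0) \<and> (\<forall>X\<in>carrier (Uq chi p).
          Lusztig_q chi p (phi4_q chi p X)
            = phi4_q (reflect chi p) p (Lusztig_minus_q chi p (phi_diag_q chi p a X))))"
proof -
  interpret bicharacter chi p by unfold_locales (rule assms)+
  show ?thesis
    by (intro conjI ballI allI impI Lusztig_induces Lusztig_q_iso Lusztig_minus_q_iso
        Lusztig_q_Lusztig_minus_q Lusztig_phi_diag Lusztig_phi2 Lusztig_phi3 Lusztig_phi4) auto
qed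

end
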